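(* Consider the problem of determining the trajectories $x\in C^1(P)$ and $T\in(a,b]$ that give an extremum to $z[x,T]=z(T)$, where $z$ satisfies $$\dot z(t)=\int_\Omega L[x,z]_{n,\gamma}^{\alpha,\beta}(t,s)\,d^ns,\quad t\in[a,b],\qquad z(a)=z_a,$$ with $z_a\in\mathbb{R}$ fixed, subject to the constraint $x(t,s)=g(t,s)$ for all $(t,s)\in\partial P$, where $g:\partial P\to\mathbb{R}$ is a given function. If $(x,z,T)$ is an extremizer of this functional, then $(x,z,T)$ satisfies the fractional differential equations $$\partial_{n+2}L[x,z]_{n,\gamma}^{\alpha,\beta}(t,s)\lambda(t)+D_{\overline\gamma}^{\beta(\cdot,\cdot),\alpha(\cdot,\cdot)}\left(\lambda(t)\partial_{n+3}L[x,z]_{n,\gamma}^{\alpha,\beta}(t,s)\right)+\sum_{i=1}^nD_{\overline\gamma^i}^{\beta_i(\cdot,\cdot),\alpha_i(\cdot,\cdot)}\left(\lambda(t)\partial_{n+3+i}L[x,z]_{n,\gamma}^{\alpha,\beta}(t,s)\right)=0$$ on $[a,T]\times\Omega$, and $$\gamma_2\left({}_aD_t^{\beta(\cdot,\cdot)}\left(\lambda(t)\partial_{n+3}L[x,z]_{n,\gamma}^{\alpha,\beta}(t,s)\right)-{}_TD_t^{\beta(\cdot,\cdot)}\left(\lambda(t)\partial_{n+3}L[x,z]_{n,\gamma}^{\alpha,\beta}(t,s)\right)\right)=0$$ on $[T,b]\times\Omega$. Moreover, $(x,z)$ satisfies the transversality condition $$\left[\gamma_1\,{}_tI_T^{1-\alpha(\cdot,\cdot)}\left(\lambda(t)\partial_{n+3}L[x,z]_{n,\gamma}^{\alpha,\beta}(t,s)\right)-\gamma_2\,{}_TI_t^{1-\beta(\cdot,\cdot)}\left(\lambda(t)\partial_{n+3}L[x,z]_{n,\gamma}^{\alpha,\beta}(t,s)\right)\right]_{t=T}=0,\quad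 s\in\Omega.$$ If $T<b$, then $\displaystyle\int_\Omega L[x,z]_{n,\gamma}^{\alpha,\beta}(T,s)\,d^ns=0$.
   Context: Let $n\in\mathbb{N}$, $a<b$, $a_i<b_i$ reals, $\Omega=\prod_{i=1}^n[a_i,b_i]$, $P=[a,b]\times\Omega$ with boundary $\partial P$, $s=(s_1,\ldots,s_n)\in\Omega$ and $d^ns=ds_1\cdots ds_n$. Let $\alpha,\beta:[a,b]^2\to(0,1)$ and $\alpha_i,\beta_i:[a_i,b_i]^2\to(0,1)$ ($i=1,\ldots,n$) be continuous, and $\gamma=(\gamma_1,\gamma_2)$, $\gamma^i=(\gamma_1^i,\gamma_2^i)$ vectors in $[0,1]^2$, each with components not both zero; $\overline\gamma=(\gamma_2,\gamma_1)$, $\overline\gamma^i=(\gamma_2^i,\gamma_1^i)$. For a variable-order function $\delta$ with values in $(0,1)$ on the square of an interval and a point $c$ of that interval, define $${}_cI_u^{1-\delta(\cdot,\cdot)}f(u)=\int_c^u\frac{(u-\tau)^{-\delta(u,\tau)}}{\Gamma(1-\delta(u,\tau))}f(\tau)\,d\tau\ (u>c),\qquad {}_uI_c^{1-\delta(\cdot,\cdot)}f(u)=\int_u^c\frac{(\tau-u)^{-\delta(\tau,u)}}{\Gamma(1-\delta(\tau,u))}f(\tau)\,d\tau\ (u<c),$$ ${}_cD_u^{\delta(\cdot,\cdot)}f=\frac{d}{du}\,{}_cI_u^{1-\delta(\cdot,\cdot)}f$, ${}_uD_c^{\delta(\cdot,\cdot)}f=-\frac{d}{du}\,{}_uI_c^{1-\delta(\cdot,\cdot)}f$,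 and the Caputo derivatives ${}_c^CD_u^{\delta(\cdot,\cdot)}f={}_cI_u^{1-\delta(\cdot,\cdot)}f'$, ${}_u^CD_c^{\delta(\cdot,\cdot)}f=-{}_uI_c^{1-\delta(\cdot,\cdot)}f'$. Combined Caputo derivatives: with respect to $t$, ${}^CD_\gamma^{\alpha(\cdot,\cdot),\beta(\cdot,\cdot)}x(t,s)=\gamma_1\,{}_a^CD_t^{\alpha(\cdot,\cdot)}x(t,s)+\gamma_2\,{}_t^CD_b^{\beta(\cdot,\cdot)}x(t,s)$; with respect to $s_i$, ${}^CD_{\gamma^i}^{\alpha_i(\cdot,\cdot),\beta_i(\cdot,\cdot)}x(t,s)=\gamma_1^i\,{}_{a_i}^CD_{s_i}^{\alpha_i(\cdot,\cdot)}x(t,s)+\gamma_2^i\,{}_{s_i}^CD_{b_i}^{\beta_i(\cdot,\cdot)}x(t,s)$. These are assumed to exist and be continuous. Dual derivatives: with respect to $t$, $D_{\overline\gamma}^{\beta(\cdot,\cdot),\alpha(\cdot,\cdot)}=\gamma_2\,{}_aD_t^{\beta(\cdot,\cdot)}+\gamma_1\,{}_tD_T^{\alpha(\cdot,\cdot)}$; with respect to $s_i$, $D_{\overline\gamma^i}^{\beta_i(\cdot,\cdot),\alpha_i(\cdot,\cdot)}=\gamma_2^i\,{}_{a_i}D_{s_i}^{\beta_i(\cdot,\cdot)}+\gamma_1^i\,{}_{s_i}D_{b_i}^{\alpha_i(\cdot,\cdot)}$. The Lagrangian $L:P\times\mathbb{R}^{n+3}\to\mathbb{R}$ is of class $C^1$,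 and $L[x,z]_{n,\gamma}^{\alpha,\beta}(t,s)$ denotes $L$ evaluated at $$\left(t,s,x(t,s),{}^CD_\gamma^{\alpha(\cdot,\cdot),\beta(\cdot,\cdot)}x(t,s),{}^CD_{\gamma^1}^{\alpha_1(\cdot,\cdot),\beta_1(\cdot,\cdot)}x(t,s),\ldots,{}^CD_{\gamma^n}^{\alpha_n(\cdot,\cdot),\beta_n(\cdot,\cdot)}x(t,s),z(t)\right),$$ a vector with $2n+4$ scalar entries; $\partial_jL$ is the partial derivative with respect to the $j$th scalar argument. Finally, $$\lambda(t)=\exp\left(-\int_a^t\int_\Omega\partial_{2n+4}L[x,z]_{n,\gamma}^{\alpha,\beta}(\tau,s)\,d^ns\,d\tau\right).$$
   Formalization: First equation: shown on any set between the open and closed box [a,T]×Ω where the dual derivatives exist and are continuous; second: for T<b, where both derivatives exist. They need not exist for merely continuous orders. Transversality at t=T is stated as value and as limit. *)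

theory Defs
  imports "HOL-Analysis.Analysis"
begin

section \<open>Variable-order fractional operators of one real variable\<close>

definition frac_kernel :: "(real \<Rightarrow> real \<Rightarrow> real) \<Rightarrow> real \<Rightarrow> real \<Rightarrow> real" where
  "frac_kernel \<delta> u v = (u - v) powr (- \<delta> u v) / Gamma (1 - \<delta> u v)"

text \<open>The integrals of order \<open>1 - \<delta>\<close>.  The left operator evaluates \<open>\<delta>\<close> at \<open>(u, \<tau>)\<close>,
  the right one at \<open>(\<tau>, u)\<close>.  At \<open>u = c\<close>, and on the wrong side of \<open>c\<close>, the value is \<open>0\<close>.\<close>

definition frac_left :: "real \<Rightarrow> (real \<Rightarrow> real \<Rightarrow> real) \<Rightarrow> (real \<Rightarrow> real) \<Rightarrow> real \<Rightarrow> real" where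
  "frac_left c \<delta> f u = integral {c..u} (\<lambda>\<tau>. frac_kernel \<delta> u \<tau> * f \<tau>)"

definition frac_right :: "real \<Rightarrow> (real \<Rightarrow> real \<Rightarrow> real) \<Rightarrow> (real \<Rightarrow> real) \<Rightarrow> real \<Rightarrow> real" where
  "frac_right c \<delta> f u = integral {u..c} (\<lambda>\<tau>. frac_kernel \<delta> \<tau> u * f \<tau>)"

text \<open>Derivatives on an interval \<open>[lo, hi]\<close>: left operators are based at \<open>lo\<close>, right operators
  at \<open>hi\<close>, and derivatives at the end points are one-sided.\<close>

definition RL_left ::
    "real \<Rightarrow> real \<Rightarrow> (real \<Rightarrow> real \<Rightarrow> real) \<Rightarrow> (real \<Rightarrow> real) \<Rightarrow> real \<Rightarrow> real" where
  "RL_left lo hi \<delta> f u = vector_derivative (frac_left lo \<delta> f) (at u within {lo..hi})"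

definition RL_right ::
    "real \<Rightarrow> real \<Rightarrow> (real \<Rightarrow> real \<Rightarrow> real) \<Rightarrow> (real \<Rightarrow> real) \<Rightarrow> real \<Rightarrow> real" where
  "RL_right lo hi \<delta> f u = - vector_derivative (frac_right hi \<delta> f) (at u within {lo..hi})"

definition deriv_on :: "real \<Rightarrow> real \<Rightarrow> (real \<Rightarrow> real) \<Rightarrow> real \<Rightarrow> real" where
  "deriv_on lo hi f \<tau> = vector_derivative f (at \<tau> within {lo..hi})"

definition caputo_left ::
    "real \<Rightarrow> real \<Rightarrow> (real \<Rightarrow> real \<Rightarrow> real) \<Rightarrow> (real \<Rightarrow> real) \<Rightarrow> real \<Rightarrow> real" where
  "caputo_left lo hi \<delta> f u = frac_left lo \<delta> (deriv_on lo hi f) u"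

definition caputo_right ::
    "real \<Rightarrow> real \<Rightarrow> (real \<Rightarrow> real \<Rightarrow> real) \<Rightarrow> (real \<Rightarrow> real) \<Rightarrow> real \<Rightarrow> real" where
  "caputo_right lo hi \<delta> f u = - frac_right hi \<delta> (deriv_on lo hi f) u"

definition combined_caputo :: "real \<Rightarrow> real \<Rightarrow> real \<times> real \<Rightarrow> (real \<Rightarrow> real \<Rightarrow> real) \<Rightarrow>
    (real \<Rightarrow> real \<Rightarrow> real) \<Rightarrow> (real \<Rightarrow> real) \<Rightarrow> real \<Rightarrow> real" where
  "combined_caputo lo hi \<gamma> \<alpha> \<beta> f u =
     fst \<gamma> * caputo_left lo hi \<alpha> f u + snd \<gamma> * caputo_right lo hi \<beta> f u"

definition combined_caputo_exists :: "real \<Rightarrow> real \<Rightarrow> real \<times> real \<Rightarrow> (real \<Rightarrow> real \<Rightarrow> real) \<Rightarrow>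
    (real \<Rightarrow> real \<Rightarrow> real) \<Rightarrow> (real \<Rightarrow> real) \<Rightarrow> real \<Rightarrow> bool" where
  "combined_caputo_exists lo hi \<gamma> \<alpha> \<beta> f u \<longleftrightarrow>
     (fst \<gamma> \<noteq> 0 \<longrightarrow> (\<lambda>\<tau>. frac_kernel \<alpha> u \<tau> * deriv_on lo hi f \<tau>) integrable_on {lo..u}) \<and>
     (snd \<gamma> \<noteq> 0 \<longrightarrow> (\<lambda>\<tau>. frac_kernel \<beta> \<tau> u * deriv_on lo hi f \<tau>) integrable_on {u..hi})"

text \<open>The dual derivative of \<open>combined_caputo lo hi \<gamma> \<alpha> \<beta>\<close> is
  \<open>dual_RL lo hi (prod.swap \<gamma>) \<beta> \<alpha>\<close>: both weights and orders are swapped.\<close>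

definition dual_RL :: "real \<Rightarrow> real \<Rightarrow> real \<times> real \<Rightarrow> (real \<Rightarrow> real \<Rightarrow> real) \<Rightarrow>
    (real \<Rightarrow> real \<Rightarrow> real) \<Rightarrow> (real \<Rightarrow> real) \<Rightarrow> real \<Rightarrow> real" where
  "dual_RL lo hi \<gamma>' \<beta> \<alpha> f u = fst \<gamma>' * RL_left lo hi \<beta> f u + snd \<gamma>' * RL_right lo hi \<alpha> f u"

definition dual_RL_exists :: "real \<Rightarrow> real \<Rightarrow> real \<times> real \<Rightarrow> (real \<Rightarrow> real \<Rightarrow> real) \<Rightarrow>
    (real \<Rightarrow> real \<Rightarrow> real) \<Rightarrow> (real \<Rightarrow> real) \<Rightarrow> real \<Rightarrow> bool" where
  "dual_RL_exists lo hi \<gamma>' \<beta> \<alpha> f u \<longleftrightarrow>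
     (fst \<gamma>' \<noteq> 0 \<longrightarrow> frac_left lo \<beta> f differentiable (at u within {lo..hi})) \<and>
     (snd \<gamma>' \<noteq> 0 \<longrightarrow> frac_right hi \<alpha> f differentiable (at u within {lo..hi}))"

definition admissible_order :: "real \<Rightarrow> real \<Rightarrow> (real \<Rightarrow> real \<Rightarrow> real) \<Rightarrow> bool" where
  "admissible_order lo hi \<delta> \<longleftrightarrow>
     continuous_on ({lo..hi} \<times> {lo..hi}) (\<lambda>(u, v). \<delta> u v) \<and>
     (\<forall>u\<in>{lo..hi}. \<forall>v\<in>{lo..hi}. \<delta> u v \<in> {0<..<1})"

definition admissible_weight :: "real \<times> real \<Rightarrow> bool" where
  "admissible_weight \<gamma> \<longleftrightarrow> fst \<gamma> \<in> {0..1} \<and> snd \<gamma> \<in> {0..1} \<and> \<gamma> \<noteq> (0, 0)"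

section \<open>Functions of \<open>(t, s)\<close>\<close>

text \<open>Class \<open>C\<^sup>1\<close> on a set that need not be open; intended for sets such as boxes, where
  derivatives within the set are unique.\<close>

definition C1_on :: "('a::real_normed_vector) set \<Rightarrow> ('a \<Rightarrow> 'b::real_normed_vector) \<Rightarrow> bool" where
  "C1_on S f \<longleftrightarrow> (\<exists>f' :: 'a \<Rightarrow> 'a \<Rightarrow>\<^sub>L 'b.
     (\<forall>p\<in>S. (f has_derivative blinfun_apply (f' p)) (at p within S)) \<and> continuous_on S f')"

type_synonym 'n pt = "real \<times> (real^'n)"

definition slice_t :: "('n pt \<Rightarrow> real) \<Rightarrow> real^'n \<Rightarrow> real \<Rightarrow> real" where
  "slice_t f s = (\<lambda>\<tau>. f (\<tau>, s))"

definition coord_upd :: "real^'n \<Rightarrow> 'n \<Rightarrow> real \<Rightarrow> real^'n" where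
  "coord_upd s i r = (\<chi> j. if j = i then r else s $ j)"

definition slice_s :: "'n \<Rightarrow> ('n pt \<Rightarrow> real) \<Rightarrow> real \<Rightarrow> real^'n \<Rightarrow> real \<Rightarrow> real" where
  "slice_s i f t s = (\<lambda>\<sigma>. f (t, coord_upd s i \<sigma>))"

section \<open>The Lagrangian and its partial derivatives\<close>

text \<open>The argument tuple is \<open>(t, s, x, v, w, r)\<close>, where \<open>v\<close> stands for the combined derivative in
  \<open>t\<close>, \<open>w $ i\<close> for the one in the \<open>i\<close>-th coordinate of \<open>s\<close>, and \<open>r\<close> for \<open>z t\<close>.  Counting scalar
  entries, the derivatives below are those of index \<open>n+2\<close>, \<open>n+3\<close>, \<open>n+3+i\<close> and \<open>2n+4\<close>.\<close>

type_synonym 'n lag_arg = "real \<times> (real^'n) \<times> real \<times> real \<times> (real^'n) \<times> real"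

definition pd_x :: "(('n::finite) lag_arg \<Rightarrow> real) \<Rightarrow> 'n lag_arg \<Rightarrow> real" where
  "pd_x L = (\<lambda>(t, s, x, v, w, r). deriv (\<lambda>h. L (t, s, h, v, w, r)) x)"

definition pd_v :: "(('n::finite) lag_arg \<Rightarrow> real) \<Rightarrow> 'n lag_arg \<Rightarrow> real" where
  "pd_v L = (\<lambda>(t, s, x, v, w, r). deriv (\<lambda>h. L (t, s, x, h, w, r)) v)"

definition pd_w :: "('n::finite) \<Rightarrow> ('n lag_arg \<Rightarrow> real) \<Rightarrow> 'n lag_arg \<Rightarrow> real" where
  "pd_w i L = (\<lambda>(t, s, x, v, w, r). deriv (\<lambda>h. L (t, s, x, v, coord_upd w i h, r)) (w $ i))"

definition pd_z :: "(('n::finite) lag_arg \<Rightarrow> real) \<Rightarrow> 'n lag_arg \<Rightarrow> real" where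
  "pd_z L = (\<lambda>(t, s, x, v, w, r). deriv (\<lambda>h. L (t, s, x, v, w, h)) r)"

section \<open>The Herglotz problem\<close>

text \<open>The data of the problem; \<open>\<Omega> = cbox lo_s hi_s\<close>.  Only the values of \<open>bdry\<close> on the frontier
  of \<open>P\<close>, and those of \<open>Lag\<close> at arguments with \<open>(t, s) \<in> P\<close>, are used.\<close>

record 'n herglotz =
  lo_t :: real
  hi_t :: real
  lo_s :: "real^'n"
  hi_s :: "real^'n"
  weight_t :: "real \<times> real"
  ord_l_t :: "real \<Rightarrow> real \<Rightarrow> real"
  ord_r_t :: "real \<Rightarrow> real \<Rightarrow> real"
  weight_s :: "'n \<Rightarrow> real \<times> real"
  ord_l_s :: "'n \<Rightarrow> real \<Rightarrow> real \<Rightarrow> real"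
  ord_r_s :: "'n \<Rightarrow> real \<Rightarrow> real \<Rightarrow> real"
  Lag :: "'n lag_arg \<Rightarrow> real"
  z_init :: real
  bdry :: "'n pt \<Rightarrow> real"

definition dom_P :: "('n::finite) herglotz \<Rightarrow> 'n pt set" where
  "dom_P H = {lo_t H..hi_t H} \<times> cbox (lo_s H) (hi_s H)"

definition dom_L :: "('n::finite) herglotz \<Rightarrow> 'n lag_arg set" where
  "dom_L H = {lo_t H..hi_t H} \<times> cbox (lo_s H) (hi_s H) \<times> UNIV"

definition caputo_t ::
    "('n::finite) herglotz \<Rightarrow> ('n pt \<Rightarrow> real) \<Rightarrow> 'n pt \<Rightarrow> real" where
  "caputo_t H x = (\<lambda>(t, s). combined_caputo (lo_t H) (hi_t H)
     (weight_t H) (ord_l_t H) (ord_r_t H) (slice_t x s) t)"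

definition caputo_s ::
    "('n::finite) herglotz \<Rightarrow> 'n \<Rightarrow> ('n pt \<Rightarrow> real) \<Rightarrow> 'n pt \<Rightarrow> real" where
  "caputo_s H i x = (\<lambda>(t, s). combined_caputo (lo_s H $ i) (hi_s H $ i)
     (weight_s H i) (ord_l_s H i) (ord_r_s H i) (slice_s i x t s) (s $ i))"

definition caputo_regular :: "('n::finite) herglotz \<Rightarrow> ('n pt \<Rightarrow> real) \<Rightarrow> bool" where
  "caputo_regular H x \<longleftrightarrow>
     (\<forall>(t, s)\<in>dom_P H. combined_caputo_exists (lo_t H) (hi_t H)
        (weight_t H) (ord_l_t H) (ord_r_t H) (slice_t x s) t) \<and>
     continuous_on (dom_P H) (caputo_t H x) \<and>
     (\<forall>i. \<forall>(t, s)\<in>dom_P H. combined_caputo_exists (lo_s H $ i) (hi_s H $ i)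
        (weight_s H i) (ord_l_s H i) (ord_r_s H i) (slice_s i x t s) (s $ i)) \<and>
     (\<forall>i. continuous_on (dom_P H) (caputo_s H i x))"

text \<open>The tuple at which the Lagrangian is evaluated along \<open>(x, z)\<close>.\<close>

definition lag_at :: "('n::finite) herglotz \<Rightarrow> ('n pt \<Rightarrow> real) \<Rightarrow> (real \<Rightarrow> real) \<Rightarrow>
    'n pt \<Rightarrow> 'n lag_arg" where
  "lag_at H x z p =
     (fst p, snd p, x p, caputo_t H x p, (\<chi> i. caputo_s H i x p), z (fst p))"

definition admissible ::
    "('n::finite) herglotz \<Rightarrow> ('n pt \<Rightarrow> real) \<Rightarrow> (real \<Rightarrow> real) \<Rightarrow> bool" where
  "admissible H x z \<longleftrightarrow>
     C1_on (dom_P H) x \<and> caputo_regular H x \<and>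
     (\<forall>p\<in>frontier (dom_P H). x p = bdry H p) \<and>
     z (lo_t H) = z_init H \<and>
     (\<forall>t\<in>{lo_t H..hi_t H}.
        (z has_real_derivative
           integral (cbox (lo_s H) (hi_s H)) (\<lambda>s. Lag H (lag_at H x z (t, s))))
        (at t within {lo_t H..hi_t H}))"

definition C1_close :: "('n::finite) herglotz \<Rightarrow> real \<Rightarrow> ('n pt \<Rightarrow> real) \<Rightarrow>
    ('n pt \<Rightarrow> real) \<Rightarrow> bool" where
  "C1_close H \<epsilon> x y \<longleftrightarrow> (\<forall>p\<in>dom_P H. \<bar>y p - x p\<bar> < \<epsilon> \<and>
     onorm (frechet_derivative (\<lambda>q. y q - x q) (at p within dom_P H)) < \<epsilon>)"

text \<open>Local minimizers and maximizers of \<open>(y, \<tau>) \<mapsto> w \<tau>\<close>, where \<open>w\<close> is the solution belonging to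
  \<open>y\<close>; in particular every global extremizer qualifies.\<close>

definition extremizer :: "('n::finite) herglotz \<Rightarrow> ('n pt \<Rightarrow> real) \<Rightarrow> (real \<Rightarrow> real) \<Rightarrow>
    real \<Rightarrow> bool" where
  "extremizer H x z T \<longleftrightarrow>
     admissible H x z \<and> T \<in> {lo_t H<..hi_t H} \<and>
     (\<exists>\<epsilon>>0.
        (\<forall>y w \<tau>. admissible H y w \<and> \<tau> \<in> {lo_t H<..hi_t H} \<and> C1_close H \<epsilon> x y \<and> \<bar>\<tau> - T\<bar> < \<epsilon>
           \<longrightarrow> z T \<le> w \<tau>) \<or>
        (\<forall>y w \<tau>. admissible H y w \<and> \<tau> \<in> {lo_t H<..hi_t H} \<and> C1_close H \<epsilon> x y \<and> \<bar>\<tau> - T\<bar> < \<epsilon>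
           \<longrightarrow> w \<tau> \<le> z T))"

definition multiplier :: "('n::finite) herglotz \<Rightarrow> ('n pt \<Rightarrow> real) \<Rightarrow> (real \<Rightarrow> real) \<Rightarrow>
    real \<Rightarrow> real" where
  "multiplier H x z t = exp (- integral {lo_t H..t} (\<lambda>\<tau>.
     integral (cbox (lo_s H) (hi_s H)) (\<lambda>s. pd_z (Lag H) (lag_at H x z (\<tau>, s)))))"

definition weighted_pd_v :: "('n::finite) herglotz \<Rightarrow> ('n pt \<Rightarrow> real) \<Rightarrow> (real \<Rightarrow> real) \<Rightarrow>
    'n pt \<Rightarrow> real" where
  "weighted_pd_v H x z p = multiplier H x z (fst p) * pd_v (Lag H) (lag_at H x z p)"

definition weighted_pd_w :: "('n::finite) herglotz \<Rightarrow> ('n pt \<Rightarrow> real) \<Rightarrow> (real \<Rightarrow> real) \<Rightarrow>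
    'n \<Rightarrow> 'n pt \<Rightarrow> real" where
  "weighted_pd_w H x z i p = multiplier H x z (fst p) * pd_w i (Lag H) (lag_at H x z p)"

text \<open>The dual derivative in \<open>t\<close> is taken on \<open>[lo_t H, T]\<close>, those in the coordinates of \<open>s\<close> on the
  full edges of \<open>\<Omega>\<close>.\<close>

definition dual_t :: "('n::finite) herglotz \<Rightarrow> real \<Rightarrow> ('n pt \<Rightarrow> real) \<Rightarrow>
    'n pt \<Rightarrow> real" where
  "dual_t H T f = (\<lambda>(t, s). dual_RL (lo_t H) T
     (prod.swap (weight_t H)) (ord_r_t H) (ord_l_t H) (slice_t f s) t)"

definition dual_s :: "('n::finite) herglotz \<Rightarrow> 'n \<Rightarrow> ('n pt \<Rightarrow> real) \<Rightarrow>
    'n pt \<Rightarrow> real" where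
  "dual_s H i f = (\<lambda>(t, s). dual_RL (lo_s H $ i) (hi_s H $ i)
     (prod.swap (weight_s H i)) (ord_r_s H i) (ord_l_s H i) (slice_s i f t s) (s $ i))"

text \<open>Existence and continuity on \<open>R\<close> of all dual derivatives in the Euler--Lagrange equation.
  Unlike the Caputo derivatives of a \<open>C\<^sup>1\<close> function, these need not exist automatically.  At a
  point where \<open>t\<close> or some \<open>s $ i\<close> is an end point of its interval an operator of
  Riemann--Liouville type is in general singular (for a constant function it behaves like
  \<open>(u - lo) powr (- \<delta>)\<close>), which is why \<open>R\<close> may be smaller than the closed box.\<close>

definition dual_regular :: "('n::finite) herglotz \<Rightarrow> ('n pt \<Rightarrow> real) \<Rightarrow> (real \<Rightarrow> real) \<Rightarrow>
    real \<Rightarrow> 'n pt set \<Rightarrow> bool" where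
  "dual_regular H x z T R \<longleftrightarrow>
     (\<forall>(t, s)\<in>R. dual_RL_exists (lo_t H) T
        (prod.swap (weight_t H)) (ord_r_t H) (ord_l_t H) (slice_t (weighted_pd_v H x z) s) t) \<and>
     continuous_on R (dual_t H T (weighted_pd_v H x z)) \<and>
     (\<forall>i. \<forall>(t, s)\<in>R. dual_RL_exists (lo_s H $ i) (hi_s H $ i)
        (prod.swap (weight_s H i)) (ord_r_s H i) (ord_l_s H i)
        (slice_s i (weighted_pd_w H x z i) t s) (s $ i)) \<and>
     (\<forall>i. continuous_on R (dual_s H i (weighted_pd_w H x z i)))"

text \<open>For \<open>t < T\<close> only the first summand is nonzero, for \<open>t > T\<close> only the second; at \<open>t = T\<close>, where
  the operators are defined only as limits, both integrals are over a degenerate interval.  Hence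
  the condition at \<open>t = T\<close> has to be stated as a limit as well.\<close>

definition transversality_term :: "'n herglotz \<Rightarrow> ('n pt \<Rightarrow> real) \<Rightarrow>
    (real \<Rightarrow> real) \<Rightarrow> real \<Rightarrow> real^'n \<Rightarrow> real \<Rightarrow> real" where
  "transversality_term H x z T s t =
     fst (weight_t H) * frac_right T (ord_l_t H) (slice_t (weighted_pd_v H x z) s) t -
     snd (weight_t H) * frac_left T (ord_r_t H) (slice_t (weighted_pd_v H x z) s) t"

end

theory Submission
  imports Defs
begin

text \<open>For a test function \<open>h\<close> vanishing on the frontier of \<open>P\<close>, replace \<open>x\<close> by \<open>x + \<epsilon> h\<close>.
  The solution of the perturbed equation deviates from \<open>z\<close> at \<open>T\<close> by \<open>\<epsilon> / \<lambda> T\<close> times the integral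
  of \<open>\<lambda>\<close> against the linearisation of the Lagrangian in the direction \<open>h\<close>, up to \<open>o(\<epsilon>)\<close>, so
  extremality makes this integral vanish.  The kernels are weakly singular, i.e. limits of
  continuous kernels in \<open>L\<^sup>1\<close> of every row and column; hence the fractional integrals are continuous
  and Fubini's theorem moves them from \<open>h\<close> to the Lagrangian, which leaves only first derivatives
  of \<open>h\<close>.  The adjoint of the operator in \<open>t\<close>, integrated over \<open>[a, T]\<close> only, is continuous across
  \<open>T\<close>.  Before \<open>T\<close> it is differentiable by assumption, and bump functions give the first equation;
  after \<open>T\<close> an argument of du Bois-Reymond type shows that it is constant, which gives the second.
  The transversality condition only expresses that fractional integrals of continuous functions
  over shrinking intervals tend to \<open>0\<close>.\<close>

section \<open>Weakly singular kernels\<close>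

text \<open>Extremality enters twice: varying \<open>x\<close> with \<open>T\<close> fixed gives
  both differential equations, while varying \<open>T\<close> with \<open>x\<close> fixed makes
  \<open>T < b\<close> a local extremum of \<open>z\<close>, which is the last conclusion. Three
  obstacles shape the rest. A competitor must solve its equation on all of \<open>[a, b]\<close>,
  but a C^1 Lagrangian is only locally Lipschitz in \<open>z\<close>; so the right-hand side is
  clamped to a tube around \<open>z\<close> and solved globally, and a growth bound shows that for
  small \<epsilon> the solution never leaves the tube. The dual derivatives are known only where
  \<open>dual_regular\<close> provides them and may blow up at the faces of the box; hence the weak
  form is stated for the undifferentiated adjoints, which are continuous on \<open>P\<close>, and a
  derivative is moved back only against bumps supported in a compact part of the open box. Finally,
  integration by parts in one coordinate of \<open>real^'n\<close> calls for an inner integral over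
  that coordinate; it is obtained by averaging along coordinate lines, which preserves the integral
  over the box.\<close>

definition weakly_singular :: "real \<Rightarrow> real \<Rightarrow> (real \<Rightarrow> real \<Rightarrow> real) \<Rightarrow> bool" where
  "weakly_singular lo hi K \<longleftrightarrow>
     (\<forall>u\<in>{lo..hi}. (\<lambda>v. K u v) absolutely_integrable_on {lo..hi} \<and>
        (\<lambda>v. K v u) absolutely_integrable_on {lo..hi}) \<and>
     (\<forall>\<eta>>0. \<exists>K'. continuous_on ({lo..hi} \<times> {lo..hi}) (\<lambda>(u, v). K' u v) \<and>
        (\<forall>u\<in>{lo..hi}. integral {lo..hi} (\<lambda>v. \<bar>K u v - K' u v\<bar>) \<le> \<eta> \<and>
           integral {lo..hi} (\<lambda>v. \<bar>K v u - K' v u\<bar>) \<le> \<eta>))"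

lemma continuous_on_row:
  fixes K :: "'a::topological_space \<Rightarrow> 'b::topological_space \<Rightarrow> 'c::topological_space"
  assumes "continuous_on (A \<times> B) (\<lambda>(u, v). K u v)" and "u \<in> A"
  shows "continuous_on B (K u)"
proof -
  have "continuous_on B (\<lambda>v. (\<lambda>(u, v). K u v) (u, v))"
    by (rule continuous_on_compose2[OF assms(1)]) (use assms(2) in \<open>auto intro!: continuous_intros\<close>)
  then show ?thesis by simp
qed

lemma continuous_on_swap_args:
  assumes "continuous_on (A \<times> B) (\<lambda>(u, v). K u v)"
  shows "continuous_on (B \<times> A) (\<lambda>(v, u). K u v)"
proof -
  have "continuous_on (B \<times> A) (\<lambda>p. (\<lambda>(u, v). K u v) (snd p, fst p))"
    by (rule continuous_on_compose2[OF assms]) (auto intro!: continuous_intros)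
  then show ?thesis by (simp add: split_beta)
qed

text \<open>The right-sided operators use the transposed kernel; rows and columns are treated alike
  in \<open>weakly_singular\<close> so that every result applies to both.\<close>

lemma weakly_singular_swap:
  assumes "weakly_singular lo hi K"
  shows "weakly_singular lo hi (\<lambda>u v. K v u)"
  unfolding weakly_singular_def
proof (intro conjI allI impI)
  show "\<forall>u\<in>{lo..hi}. (\<lambda>v. K v u) absolutely_integrable_on {lo..hi} \<and>
        (\<lambda>v. K u v) absolutely_integrable_on {lo..hi}"
    using assms unfolding weakly_singular_def by blast
next
  fix \<eta> :: real
  assume "\<eta> > 0"
  then obtain K' where K': "continuous_on ({lo..hi} \<times> {lo..hi}) (\<lambda>(u, v). K' u v)"
      "\<forall>u\<in>{lo..hi}. integral {lo..hi} (\<lambda>v. \<bar>K u v - K' u v\<bar>) \<le> \<eta> \<and>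
           integral {lo..hi} (\<lambda>v. \<bar>K v u - K' v u\<bar>) \<le> \<eta>"
    using assms unfolding weakly_singular_def by blast
  show "\<exists>K'. continuous_on ({lo..hi} \<times> {lo..hi}) (\<lambda>(u, v). K' u v) \<and>
        (\<forall>u\<in>{lo..hi}. integral {lo..hi} (\<lambda>v. \<bar>K v u - K' u v\<bar>) \<le> \<eta> \<and>
           integral {lo..hi} (\<lambda>v. \<bar>K u v - K' v u\<bar>) \<le> \<eta>)"
    using continuous_on_swap_args[OF K'(1)] K'(2) by (intro exI[of _ "\<lambda>u v. K' v u"]) auto
qed

lemma abs_integrable_mult_continuous:
  fixes g f :: "real \<Rightarrow> real"
  assumes "g absolutely_integrable_on {lo..hi}" and "continuous_on {lo..hi} f"
  shows "(\<lambda>v. g v * f v) absolutely_integrable_on {lo..hi}"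
proof -
  have "(\<lambda>v. f v * g v) absolutely_integrable_on {lo..hi}"
  proof (rule absolutely_integrable_bounded_measurable_product_real)
    show "f \<in> borel_measurable (lebesgue_on {lo..hi})"
      using assms(2) by (intro continuous_imp_measurable_on_sets_lebesgue) auto
    show "bounded (f ` {lo..hi})"
      using assms(2) by (intro compact_imp_bounded compact_continuous_image) auto
  qed (use assms in auto)
  then show ?thesis
    by (simp add: mult.commute)
qed

lemma weakly_singular_integrable:
  assumes "weakly_singular lo hi K" "continuous_on {lo..hi} f" "{c..d} \<subseteq> {lo..hi}" "u \<in> {lo..hi}"
  shows "(\<lambda>v. K u v * f v) integrable_on {c..d}"
proof -
  have "(\<lambda>v. K u v * f v) absolutely_integrable_on {lo..hi}"
    using assms unfolding weakly_singular_def by (intro abs_integrable_mult_continuous) auto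
  then show ?thesis
    using assms(3) set_lebesgue_integral_eq_integral(1) integrable_on_subinterval by blast
qed

text \<open>An L^1 error of the kernel costs at most the supremum of \<open>f\<close> times \<eta>,
  whatever subinterval is integrated over: the integrand is dominated by
  \<open>B * \<bar>k v - k' v\<bar>\<close>, and enlarging the interval only increases that
  integral.\<close>

lemma kernel_diff_bound:
  fixes k k' f :: "real \<Rightarrow> real"
  assumes "k absolutely_integrable_on {lo..hi}" "continuous_on {lo..hi} k'"
    and "continuous_on {lo..hi} f" and "\<And>v. v \<in> {lo..hi} \<Longrightarrow> \<bar>f v\<bar> \<le> B" and "0 \<le> B"
    and "{c..d} \<subseteq> {lo..hi}" and "integral {lo..hi} (\<lambda>v. \<bar>k v - k' v\<bar>) \<le> \<eta>"
  shows "\<bar>integral {c..d} (\<lambda>v. k v * f v) - integral {c..d} (\<lambda>v. k' v * f v)\<bar> \<le> B * \<eta>"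
proof -
  have k': "k' absolutely_integrable_on {lo..hi}"
    by (rule absolutely_integrable_continuous_real[OF assms(2)])
  have d: "(\<lambda>v. k v - k' v) absolutely_integrable_on {lo..hi}"
    using set_integral_diff(1)[OF assms(1) k'] .
  have i1: "(\<lambda>v. k v * f v) integrable_on {c..d}" "(\<lambda>v. k' v * f v) integrable_on {c..d}"
    using abs_integrable_mult_continuous[OF assms(1,3)] abs_integrable_mult_continuous[OF k' assms(3)]
      assms(6) set_lebesgue_integral_eq_integral(1) integrable_on_subinterval by blast+
  have dd: "(\<lambda>v. \<bar>k v - k' v\<bar>) integrable_on {lo..hi}"
    using d unfolding absolutely_integrable_on_def by simp
  have dc: "(\<lambda>v. B * \<bar>k v - k' v\<bar>) integrable_on {c..d}" 
    using integrable_cmul[OF integrable_on_subinterval[OF dd assms(6)], of B] by simp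
  have "\<bar>integral {c..d} (\<lambda>v. k v * f v) - integral {c..d} (\<lambda>v. k' v * f v)\<bar>
      = norm (integral {c..d} (\<lambda>v. k v * f v - k' v * f v))"
    using integral_diff[OF i1] by simp
  also have "\<dots> \<le> integral {c..d} (\<lambda>v. B * \<bar>k v - k' v\<bar>)"
  proof (rule integral_norm_bound_integral)
    show "(\<lambda>v. k v * f v - k' v * f v) integrable_on {c..d}"
      using i1 by (rule integrable_diff)
    show "norm (k v * f v - k' v * f v) \<le> B * \<bar>k v - k' v\<bar>" if "v \<in> {c..d}" for v
      using assms(4)[of v] assms(6) that
      by (auto simp: abs_mult mult.commute[of B] left_diff_distrib[symmetric] intro!: mult_left_mono)
  qed (rule dc)
  also have "\<dots> \<le> integral {lo..hi} (\<lambda>v. B * \<bar>k v - k' v\<bar>)"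
    using dc dd assms(5,6) by (intro integral_subset_le mult_nonneg_nonneg integrable_cmul[OF dd, of
        B, simplified] ballI) auto
  also have "\<dots> = B * integral {lo..hi} (\<lambda>v. \<bar>k v - k' v\<bar>)"
    by simp
  also have "\<dots> \<le> B * \<eta>"
    using assms(5,7) by (rule mult_left_mono[rotated])
  finally show ?thesis .
qed

text \<open>A uniform limit of continuous functions: the approximations \<open>K' n\<close> give
  errors at most \<open>B / Suc n\<close> for all \<open>u\<close> and \<open>y\<close> together.
  The limits \<open>c\<close> and \<open>d\<close> are fixed; moving limits are later absorbed into
  kernels that vanish beyond the diagonal. The parameter \<open>y\<close> later carries the other
  variables.\<close>

lemma continuous_on_weakly_singular:
  fixes f :: "real \<Rightarrow> 'b::topological_space \<Rightarrow> real"
  assumes K: "weakly_singular lo hi K" and cd: "{c..d} \<subseteq> {lo..hi}"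
    and Y: "compact Y" and f: "continuous_on ({lo..hi} \<times> Y) (\<lambda>(v, y). f v y)"
  shows "continuous_on ({lo..hi} \<times> Y) (\<lambda>(u, y). integral {c..d} (\<lambda>v. K u v * f v y))"
proof -
  let ?I = "{lo..hi}"
  have "bounded ((\<lambda>(v, y). f v y) ` (?I \<times> Y))"
    by (intro compact_imp_bounded compact_continuous_image f compact_Times Y) auto
  then obtain B where B: "0 < B" "\<And>v y. v \<in> ?I \<Longrightarrow> y \<in> Y \<Longrightarrow> \<bar>f v y\<bar> \<le> B"
    unfolding bounded_pos by force
  have "\<exists>K'. continuous_on (?I \<times> ?I) (\<lambda>(u, v). K' u v) \<and>
        (\<forall>u\<in>?I. integral ?I (\<lambda>v. \<bar>K u v - K' u v\<bar>) \<le> 1 / Suc n)" for n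
    using K[unfolded weakly_singular_def, THEN conjunct2, rule_format, of "1 / Suc n"] by auto
  then obtain K' where K': "\<And>n. continuous_on (?I \<times> ?I) (\<lambda>(u, v). K' n u v)"
     "\<And>n u. u \<in> ?I \<Longrightarrow> integral ?I (\<lambda>v. \<bar>K u v - K' n u v\<bar>) \<le> 1 / Suc n"
    by metis
  have fy: "continuous_on ?I (\<lambda>v. f v y)" if "y \<in> Y" for y
    using continuous_on_row[OF continuous_on_swap_args[OF f]] that by simp
  show ?thesis
  proof (rule uniform_limit_theorem[where F = sequentially
        and f = "\<lambda>n (u, y). integral {c..d} (\<lambda>v. K' n u v * f v y)"])
    show "\<forall>\<^sub>F n in sequentially.
        continuous_on (?I \<times> Y) (\<lambda>(u, y). integral {c..d} (\<lambda>v. K' n u v * f v y))"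
    proof (intro always_eventually allI)
      fix n
      have 1: "continuous_on ((?I \<times> Y) \<times> {c..d}) (\<lambda>p. (\<lambda>(u, v). K' n u v) (fst (fst p), snd p))"
        using cd by (intro continuous_on_compose2[OF K'(1)[of n]] continuous_intros) auto
      have 2: "continuous_on ((?I \<times> Y) \<times> {c..d}) (\<lambda>p. (\<lambda>(v, y). f v y) (snd p, snd (fst p)))"
        using cd by (intro continuous_on_compose2[OF f] continuous_intros) auto
      have "continuous_on ((?I \<times> Y) \<times> cbox c d) (\<lambda>(x, t). K' n (fst x) t * f t (snd x))"
        using continuous_on_mult[OF 1 2] by (simp add: split_beta)
      from integral_continuous_on_param[OF this]
      show "continuous_on (?I \<times> Y) (\<lambda>(u, y). integral {c..d} (\<lambda>v. K' n u v * f v y))"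
        by (simp add: split_beta)
    qed
    have b: "\<bar>integral {c..d} (\<lambda>v. K' n u v * f v y) - integral {c..d} (\<lambda>v. K u v * f v y)\<bar>
        \<le> B * (1 / Suc n)" if "u \<in> ?I" "y \<in> Y" for u y n
      unfolding abs_minus_commute[of "integral {c..d} (\<lambda>v. K' n u v * f v y)"]
    proof (rule kernel_diff_bound)
      show "K u absolutely_integrable_on ?I"
        using K that unfolding weakly_singular_def by auto
      show "continuous_on ?I (K' n u)"
        by (rule continuous_on_row[OF K'(1) that(1)])
    qed (use B K' cd fy that in auto)
    have "(\<lambda>n. B * (1 / Suc n)) \<longlonglongrightarrow> 0"
      using tendsto_mult_right_zero[OF LIMSEQ_Suc[OF lim_1_over_n], of B] by simp
    then have ev: "\<forall>\<^sub>F n in sequentially. B * (1 / Suc n) < e" if "e > 0" for e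
      using order_tendstoD(2) that by blast
    show "uniform_limit (?I \<times> Y) (\<lambda>n (u, y). integral {c..d} (\<lambda>v. K' n u v * f v y))
        (\<lambda>(u, y). integral {c..d} (\<lambda>v. K u v * f v y)) sequentially"
      unfolding uniform_limit_iff
    proof (intro allI impI)
      fix e :: real assume "e > 0"
      from ev[OF this] show "\<forall>\<^sub>F n in sequentially. \<forall>x\<in>?I \<times> Y.
          dist (case x of (u, y) \<Rightarrow> integral {c..d} (\<lambda>v. K' n u v * f v y))
            (case x of (u, y) \<Rightarrow> integral {c..d} (\<lambda>v. K u v * f v y)) < e"
        by eventually_elim (auto simp: dist_real_def intro!: le_less_trans[OF b])
    qed
  qed auto
qed

lemma continuous_on_weakly_singular_1:
  assumes K: "weakly_singular lo hi K" and cd: "{c..d} \<subseteq> {lo..hi}"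
    and f: "continuous_on {lo..hi} f"
  shows "continuous_on {lo..hi} (\<lambda>u. integral {c..d} (\<lambda>v. K u v * f v))"
proof -
  \<comment> \<open>A one-point parameter space reduces this to the version with parameters.\<close>
  have "continuous_on ({lo..hi} \<times> {0::real}) (\<lambda>(v, y::real). f v)"
    unfolding split_beta by (rule continuous_on_compose2[OF f]) (auto intro!: continuous_intros)
  from continuous_on_weakly_singular[OF K cd _ this]
  have *: "continuous_on ({lo..hi} \<times> {0::real}) (\<lambda>(u, y). integral {c..d} (\<lambda>v. K u v * f v))"
    by simp
  show ?thesis
    using continuous_on_row[OF continuous_on_swap_args[OF *], of "0::real"] by simp
qed

text \<open>Both sides depend continuously on the kernel, the left one through its rows and the
  right one through its columns, and for continuous kernels the exchange is the classical one. In
  this way only one-dimensional integrability of \<open>K\<close> is used.\<close>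

lemma weakly_singular_Fubini:
  assumes K: "weakly_singular lo hi K" and sub: "{c..d} \<subseteq> {lo..hi}" "{c'..d'} \<subseteq> {lo..hi}"
    and f: "continuous_on {lo..hi} f" and g: "continuous_on {lo..hi} g"
  shows "integral {c..d} (\<lambda>u. f u * integral {c'..d'} (\<lambda>v. K u v * g v))
       = integral {c'..d'} (\<lambda>v. g v * integral {c..d} (\<lambda>u. K u v * f u))" (is "?l = ?r")
proof -
  let ?I = "{lo..hi}"
  have "bounded (f ` ?I)" "bounded (g ` ?I)"
    by (intro compact_imp_bounded compact_continuous_image f g; auto)+
  then obtain F G where F: "0 < F" "\<And>v. v \<in> ?I \<Longrightarrow> \<bar>f v\<bar> \<le> F"
    and G: "0 < G" "\<And>v. v \<in> ?I \<Longrightarrow> \<bar>g v\<bar> \<le> G"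
    unfolding bounded_pos by force
  \<comment> \<open>Stated for an arbitrary kernel, so that it serves once for \<open>K\<close> and
    once for its transpose.\<close>
  have half: "\<bar>integral {a..b} (\<lambda>u. p u * integral {a'..b'} (\<lambda>v. L u v * q v))
      - integral {a..b} (\<lambda>u. p u * integral {a'..b'} (\<lambda>v. L' u v * q v))\<bar> \<le> P * (Q * \<eta>) * \<bar>hi - lo\<bar>"
    if "weakly_singular lo hi L" "continuous_on (?I \<times> ?I) (\<lambda>(u, v). L' u v)" "0 < \<eta>"
      "\<forall>u\<in>?I. integral ?I (\<lambda>v. \<bar>L u v - L' u v\<bar>) \<le> \<eta>"
      "{a..b} \<subseteq> ?I" "{a'..b'} \<subseteq> ?I" "continuous_on ?I p" "continuous_on ?I q"
      "0 < P" "\<And>v. v \<in> ?I \<Longrightarrow> \<bar>p v\<bar> \<le> P" "0 < Q" "\<And>v. v \<in> ?I \<Longrightarrow> \<bar>q v\<bar> \<le> Q"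
    for L L' \<eta> a b a' b' p q P Q
  proof (cases "a \<le> b")
    case False
    then show ?thesis using that by simp
  next
    case True
    have cL: "continuous_on ?I (\<lambda>u. integral {a'..b'} (\<lambda>v. L u v * q v))"
      using continuous_on_weakly_singular_1 that by blast
    have "continuous_on (?I \<times> cbox a' b') (\<lambda>(u, v). L' u v * q v)"
    proof -
      have 1: "continuous_on (?I \<times> cbox a' b') (\<lambda>p. (\<lambda>(u, v). L' u v) p)"
        using that by (intro continuous_on_subset[OF that(2)]) auto
      have 2: "continuous_on (?I \<times> cbox a' b') (\<lambda>p. q (snd p))"
        using that by (intro continuous_on_compose2[OF that(8)] continuous_intros) auto
      show ?thesis using continuous_on_mult[OF 1 2] by (simp add: split_beta)
    qed
    from integral_continuous_on_param[OF this]
    have cL': "continuous_on ?I (\<lambda>u. integral {a'..b'} (\<lambda>v. L' u v * q v))" by simp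
    have i: "(\<lambda>u. p u * integral {a'..b'} (\<lambda>v. L u v * q v)) integrable_on {a..b}"
        "(\<lambda>u. p u * integral {a'..b'} (\<lambda>v. L' u v * q v)) integrable_on {a..b}"
      by (intro integrable_continuous_real continuous_on_subset[OF _ that(5)]
            continuous_on_mult that(7) cL cL')+
    have "norm (integral {a..b} (\<lambda>u. p u * integral {a'..b'} (\<lambda>v. L u v * q v)
          - p u * integral {a'..b'} (\<lambda>v. L' u v * q v))) \<le> P * (Q * \<eta>) * (b - a)"
    proof (rule integral_bound)
      show "continuous_on {a..b} (\<lambda>u. p u * integral {a'..b'} (\<lambda>v. L u v * q v)
          - p u * integral {a'..b'} (\<lambda>v. L' u v * q v))"
        by (intro continuous_on_subset[OF _ that(5)] continuous_intros that(7) cL cL')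
      fix u assume u: "u \<in> {a..b}"
      then have uI: "u \<in> ?I" using that by auto
      have "\<bar>integral {a'..b'} (\<lambda>v. L u v * q v) - integral {a'..b'} (\<lambda>v. L' u v * q v)\<bar> \<le> Q * \<eta>"
      proof (rule kernel_diff_bound)
        show "L u absolutely_integrable_on ?I"
          using that(1) uI unfolding weakly_singular_def by auto
        show "continuous_on ?I (L' u)"
          by (rule continuous_on_row[OF that(2) uI])
      qed (use that uI in auto)
      then show "norm (p u * integral {a'..b'} (\<lambda>v. L u v * q v)
          - p u * integral {a'..b'} (\<lambda>v. L' u v * q v)) \<le> P * (Q * \<eta>)"
        using that(10)[OF uI] that(9)
        by (simp add: right_diff_distrib[symmetric] abs_mult mult_mono)
    qed (use True in simp)
    also have "\<dots> \<le> P * (Q * \<eta>) * \<bar>hi - lo\<bar>"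
      using True that by (intro mult_left_mono) auto
    finally show ?thesis
      using integral_diff[OF i] by simp
  qed
  have "\<bar>?l - ?r\<bar> \<le> e" if "e > 0" for e
  proof -
    \<comment> \<open>Each of the two errors is then at most \<open>e / 2\<close>; adding 1 to the
      length keeps the denominator positive for a degenerate interval.\<close>
    define \<eta> where "\<eta> = e / (2 * (F * G * (\<bar>hi - lo\<bar> + 1)))"
    have \<eta>: "\<eta> > 0" using F(1) G(1) that by (simp add: \<eta>_def)
    obtain K' where K': "continuous_on (?I \<times> ?I) (\<lambda>(u, v). K' u v)"
      "\<forall>u\<in>?I. integral ?I (\<lambda>v. \<bar>K u v - K' u v\<bar>) \<le> \<eta>"
      "\<forall>u\<in>?I. integral ?I (\<lambda>v. \<bar>K v u - K' v u\<bar>) \<le> \<eta>"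
      using K \<eta> unfolding weakly_singular_def by meson
    have l: "\<bar>?l - integral {c..d} (\<lambda>u. f u * integral {c'..d'} (\<lambda>v. K' u v * g v))\<bar>
        \<le> F * (G * \<eta>) * \<bar>hi - lo\<bar>"
      by (rule half[OF K K'(1) \<eta> K'(2) sub f g F G])
    have r: "\<bar>?r - integral {c'..d'} (\<lambda>v. g v * integral {c..d} (\<lambda>u. K' u v * f u))\<bar>
        \<le> G * (F * \<eta>) * \<bar>hi - lo\<bar>"
      by (rule half[OF weakly_singular_swap[OF K] continuous_on_swap_args[OF K'(1)] \<eta> K'(3)
            sub(2,1) g f G F])
    have "continuous_on (cbox (c, c') (d, d')) (\<lambda>(u, v). f u * (K' u v * g v))"
    proof -
      have s: "cbox (c, c') (d, d') \<subseteq> ?I \<times> ?I"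
        using sub by (auto simp: cbox_Pair_eq)
      have "continuous_on (?I \<times> ?I) (\<lambda>p. f (fst p))" "continuous_on (?I \<times> ?I) (\<lambda>p. g (snd p))"
        by (auto intro!: continuous_on_compose2[OF f] continuous_on_compose2[OF g] continuous_intros)
      then have "continuous_on (?I \<times> ?I) (\<lambda>(u, v). f u * (K' u v * g v))"
        using K'(1) unfolding split_beta by (intro continuous_on_mult)
      then show ?thesis using s continuous_on_subset by blast
    qed
    from integral_swap_continuous[OF this]
    have "integral {c..d} (\<lambda>u. f u * integral {c'..d'} (\<lambda>v. K' u v * g v))
        = integral {c'..d'} (\<lambda>v. g v * integral {c..d} (\<lambda>u. K' u v * f u))"
      by (simp add: mult.commute mult.left_commute integral_mult_right[symmetric] del:
          integral_mult_right)
    with l r have "\<bar>?l - ?r\<bar> \<le> 2 * (F * G * \<bar>hi - lo\<bar>) * \<eta>"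
      by (simp add: algebra_simps)
    also have "\<dots> \<le> 2 * (F * G * (\<bar>hi - lo\<bar> + 1)) * \<eta>"
      using F(1) G(1) \<eta> by (intro mult_right_mono mult_left_mono) auto
    also have "\<dots> = e"
      using F(1) G(1) by (simp add: \<eta>_def)
    finally show ?thesis .
  qed
  then have "\<bar>?l - ?r\<bar> \<le> 0"
    by (rule field_le_epsilon) simp
  then show ?thesis by simp
qed

section \<open>The variable-order kernel\<close>

text \<open>Extension by zero beyond the diagonal turns an integral with a moving limit into one
  over a fixed interval; read by rows or by columns, one kernel gives both the left and the right
  operator.\<close>

definition sing_kernel :: "(real \<Rightarrow> real \<Rightarrow> real) \<Rightarrow> real \<Rightarrow> real \<Rightarrow> real" where
  "sing_kernel \<delta> u v = (if v < u then frac_kernel \<delta> u v else 0)"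

text \<open>Taking the maximum with \<open>1 / m\<close> does not change the value, as the last factor vanishes for
  \<open>u - v \<le> 1 / m\<close>, but it makes continuity on the whole square obvious; the last factor is \<open>1\<close> where
  \<open>u - v \<ge> 2 / m\<close>.\<close>

definition cut_kernel :: "(real \<Rightarrow> real \<Rightarrow> real) \<Rightarrow> real \<Rightarrow> real \<Rightarrow> real \<Rightarrow> real" where
  "cut_kernel \<delta> m u v = max (u - v) (1 / m) powr (- \<delta> u v) / Gamma (1 - \<delta> u v)
     * max 0 (min 1 (m * (u - v) - 1))"

lemma cut_kernel_eq:
  assumes "m > 0"
  shows "cut_kernel \<delta> m u v = sing_kernel \<delta> u v * max 0 (min 1 (m * (u - v) - 1))"
proof (cases "1 / m < u - v")
  case True
  then have "v < u" using assms by (smt (verit) divide_pos_pos)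
  then show ?thesis using True by (simp add: cut_kernel_def sing_kernel_def frac_kernel_def)
next
  case False
  then have "m * (u - v) \<le> 1" using assms by (simp add: field_simps)
  then show ?thesis by (simp add: cut_kernel_def)
qed

lemma one_minus_order_pos:
  assumes "admissible_order lo hi \<delta>" "u \<in> {lo..hi}" "v \<in> {lo..hi}"
  shows "0 < 1 - \<delta> u v" "0 < \<delta> u v"
proof -
  have "\<delta> u v \<in> {0<..<1}"
    using assms unfolding admissible_order_def by blast
  then show "0 < 1 - \<delta> u v" "0 < \<delta> u v" by simp_all
qed

lemma continuous_on_Gamma_order:
  assumes "admissible_order lo hi \<delta>"
  shows "continuous_on ({lo..hi} \<times> {lo..hi}) (\<lambda>(u, v). Gamma (1 - \<delta> u v))"
proof -
  have "continuous_on ({lo..hi} \<times> {lo..hi}) (\<lambda>p. Gamma ((\<lambda>(u, v). 1 - \<delta> u v) p))"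
  proof (rule continuous_on_compose2[of "{0<..}" Gamma])
    show "continuous_on {0<..} (Gamma :: real \<Rightarrow> real)"
      by (rule continuous_on_Gamma) (auto elim: nonpos_Ints_cases)
    show "continuous_on ({lo..hi} \<times> {lo..hi}) (\<lambda>(u, v). 1 - \<delta> u v)"
      using assms unfolding admissible_order_def by (auto simp: split_beta intro!: continuous_intros)
  qed (use one_minus_order_pos[OF assms] in auto)
  then show ?thesis by (simp add: split_beta)
qed

lemma continuous_on_cut_kernel:
  assumes "admissible_order lo hi \<delta>" "m > 0"
  shows "continuous_on ({lo..hi} \<times> {lo..hi}) (\<lambda>(u, v). cut_kernel \<delta> m u v)"
proof -
  have d: "continuous_on ({lo..hi} \<times> {lo..hi}) (\<lambda>p. \<delta> (fst p) (snd p))"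
    using assms unfolding admissible_order_def by (simp add: split_beta)
  have g: "continuous_on ({lo..hi} \<times> {lo..hi}) (\<lambda>p. Gamma (1 - \<delta> (fst p) (snd p)))"
    using continuous_on_Gamma_order[OF assms(1)] by (simp add: split_beta)
  have ne: "Gamma (1 - \<delta> (fst p) (snd p)) \<noteq> 0" if "p \<in> {lo..hi} \<times> {lo..hi}" for p
    using Gamma_real_pos[OF one_minus_order_pos(1)[OF assms(1)]] that
    by (metis less_irrefl mem_Sigma_iff prod.collapse)
  have mx: "max (fst p - snd p) (1 / m) \<noteq> 0" for p
    using assms(2) by (smt (verit) divide_pos_pos max_def)
  show ?thesis
    unfolding cut_kernel_def split_beta
    using d g ne mx by (intro continuous_intros) auto
qed

text \<open>By compactness the order has a maximum \<open>q < 1\<close> and the Gamma factor a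
  minimum \<open>g > 0\<close>. A power of the distance with exponent between \<open>-q\<close> and
  0 is at most the \<open>-q\<close>-th power at distances up to 1 and at most 1 beyond, hence the
  sum. The bound depends on the distance only, so it controls rows and columns alike.\<close>

lemma sing_kernel_bound:
  assumes ord: "admissible_order lo hi \<delta>"
  obtains M q where "0 \<le> M" "0 < q" "q < 1"
    "\<And>u v. u \<in> {lo..hi} \<Longrightarrow> v \<in> {lo..hi} \<Longrightarrow> \<bar>sing_kernel \<delta> u v\<bar> \<le> M * (1 + \<bar>v - u\<bar> powr (-q))"
proof (cases "{lo..hi} = {}")
  case True
  then show ?thesis by (intro that[of 0 "1/2"]) auto
next
  case False
  let ?S = "{lo..hi} \<times> {lo..hi}"
  have cS: "compact ?S" "?S \<noteq> {}" using False by (auto intro: compact_Times)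
  have "continuous_on ?S (\<lambda>(u, v). \<delta> u v)"
    using ord by (simp add: admissible_order_def)
  from continuous_attains_sup[OF cS this] obtain p where p: "p \<in> ?S"
    "\<And>r. r \<in> ?S \<Longrightarrow> (\<lambda>(u, v). \<delta> u v) r \<le> (\<lambda>(u, v). \<delta> u v) p" by blast
  from continuous_attains_inf[OF cS continuous_on_Gamma_order[OF ord]]
  obtain r where r: "r \<in> ?S" "\<And>r'. r' \<in> ?S \<Longrightarrow>
      (\<lambda>(u, v). Gamma (1 - \<delta> u v)) r \<le> (\<lambda>(u, v). Gamma (1 - \<delta> u v)) r'" by blast
  define q where "q = (\<lambda>(u, v). \<delta> u v) p"
  define g where "g = (\<lambda>(u, v). Gamma (1 - \<delta> u v)) r"
  have q: "0 < q" "q < 1"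
    using one_minus_order_pos[OF ord] p(1) by (auto simp: q_def)
  have g: "g > 0"
    using Gamma_real_pos[OF one_minus_order_pos(1)[OF ord]] r(1) by (auto simp: g_def)
  show ?thesis
  proof (rule that[of "1 / g" q])
    fix u v assume uv: "u \<in> {lo..hi}" "v \<in> {lo..hi}"
    have rhs: "0 \<le> 1 / g * (1 + \<bar>v - u\<bar> powr (-q))" using g by auto
    show "\<bar>sing_kernel \<delta> u v\<bar> \<le> 1 / g * (1 + \<bar>v - u\<bar> powr (-q))"
    proof (cases "v < u")
      case True
      have dq: "\<delta> u v \<le> q" "0 < \<delta> u v" using p(2)[of "(u, v)"] uv one_minus_order_pos[OF ord] by
          (auto simp: q_def)
      have gG: "g \<le> Gamma (1 - \<delta> u v)" using r(2)[of "(u, v)"] uv by (auto simp: g_def)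
      have "(u - v) powr (- \<delta> u v) \<le> 1 + (u - v) powr (-q)"
      proof (cases "u - v \<le> 1")
        case le: True
        have "(u - v) powr (- \<delta> u v) \<le> (u - v) powr (-q)"
          using True le dq by (intro powr_mono') auto
        then show ?thesis by simp
      next
        case False
        then have "(u - v) powr (- \<delta> u v) \<le> (u - v) powr 0"
          using dq by (intro powr_mono) auto
        then show ?thesis using False by (smt (verit) powr_ge_zero powr_zero_eq_one)
      qed
      moreover have "\<bar>sing_kernel \<delta> u v\<bar> = (u - v) powr (- \<delta> u v) / Gamma (1 - \<delta> u v)"
        using True g gG by (simp add: sing_kernel_def frac_kernel_def)
      moreover have "(u - v) powr (- \<delta> u v) / Gamma (1 - \<delta> u v) \<le> (u - v) powr (- \<delta> u v) / g"
        using g gG by (intro divide_left_mono) auto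
      moreover have "(u - v) powr (- \<delta> u v) / g \<le> (1 + (u - v) powr (-q)) / g"
        using g calculation(1) by (intro divide_right_mono) auto
      ultimately show ?thesis using True by (simp add: abs_if)
    qed (use rhs in \<open>simp add: sing_kernel_def\<close>)
  qed (use g q in auto)
qed

section \<open>Integrals of powers of the distance, and integrability by domination\<close>

lemma has_integral_abs_powr_window:
  fixes u q \<rho> :: real
  assumes "q < 1" "0 \<le> \<rho>"
  shows "((\<lambda>v. \<bar>v - u\<bar> powr (-q)) has_integral 2 * (\<rho> powr (1 - q) / (1 - q))) {u - \<rho>..u + \<rho>}"
proof -
  \<comment> \<open>The integrand is unbounded at \<open>u\<close>, but the primitive is continuous
    up to it since \<open>1 - q > 0\<close>, so differentiability in the interior suffices.\<close>
  have 1: "((\<lambda>v. \<bar>v - u\<bar> powr (-q)) has_integral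
      (\<lambda>v. - ((u - v) powr (1 - q) / (1 - q))) u - (\<lambda>v. - ((u - v) powr (1 - q) / (1 - q))) (u - \<rho>))
      {u - \<rho>..u}"
  proof (rule fundamental_theorem_of_calculus_interior)
    show "continuous_on {u - \<rho>..u} (\<lambda>v. - ((u - v) powr (1 - q) / (1 - q)))"
      using assms by (intro continuous_intros continuous_on_powr') auto
    fix v assume "v \<in> {u - \<rho><..<u}"
    then have "((\<lambda>v. - ((u - v) powr (1 - q) / (1 - q))) has_real_derivative (u - v) powr (-q)) (at v)"
      using assms by (auto intro!: derivative_eq_intros)
    then show "((\<lambda>v. - ((u - v) powr (1 - q) / (1 - q))) has_vector_derivative \<bar>v - u\<bar> powr (-q))
        (at v)"
      using \<open>v \<in> {u - \<rho><..<u}\<close> by (simp add: has_real_derivative_iff_has_vector_derivative)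
  qed (use assms in auto)
  have 2: "((\<lambda>v. \<bar>v - u\<bar> powr (-q)) has_integral
      (\<lambda>v. (v - u) powr (1 - q) / (1 - q)) (u + \<rho>) - (\<lambda>v. (v - u) powr (1 - q) / (1 - q)) u)
      {u..u + \<rho>}"
  proof (rule fundamental_theorem_of_calculus_interior)
    show "continuous_on {u..u + \<rho>} (\<lambda>v. (v - u) powr (1 - q) / (1 - q))"
      using assms by (intro continuous_intros continuous_on_powr') auto
    fix v assume "v \<in> {u<..<u + \<rho>}"
    then have "((\<lambda>v. (v - u) powr (1 - q) / (1 - q)) has_real_derivative (v - u) powr (-q)) (at v)"
      using assms by (auto intro!: derivative_eq_intros)
    then show "((\<lambda>v. (v - u) powr (1 - q) / (1 - q)) has_vector_derivative \<bar>v - u\<bar> powr (-q)) (at v)"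
      using \<open>v \<in> {u<..<u + \<rho>}\<close> by (simp add: has_real_derivative_iff_has_vector_derivative)
  qed (use assms in auto)
  show ?thesis
    using has_integral_combine[OF _ _ 1 2] assms by simp
qed

text \<open>The window may stick out of \<open>[lo, hi]\<close>; extending the dominating function
  by zero to the whole line makes the bound independent of the position of \<open>u\<close>, which
  is the uniformity required by \<open>weakly_singular\<close>.\<close>

lemma integral_le_window:
  fixes k :: "real \<Rightarrow> real"
  assumes "k absolutely_integrable_on {lo..hi}" and "0 \<le> M" "q < 1" "0 \<le> \<rho>"
    and "\<And>v. v \<in> {lo..hi} \<Longrightarrow> \<bar>v - u\<bar> \<le> \<rho> \<Longrightarrow> \<bar>k v\<bar> \<le> M * (1 + \<bar>v - u\<bar> powr (-q))"
    and "\<And>v. v \<in> {lo..hi} \<Longrightarrow> \<rho> < \<bar>v - u\<bar> \<Longrightarrow> k v = 0"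
  shows "integral {lo..hi} (\<lambda>v. \<bar>k v\<bar>) \<le> M * (2 * \<rho> + 2 * (\<rho> powr (1 - q) / (1 - q)))"
proof -
  let ?W = "{u - \<rho>..u + \<rho>}"
  define g where "g = (\<lambda>v. M * (1 + \<bar>v - u\<bar> powr (-q)))"
  have "((\<lambda>v. 1 + \<bar>v - u\<bar> powr (-q)) has_integral
      (2 * \<rho> + 2 * (\<rho> powr (1 - q) / (1 - q)))) ?W"
    using has_integral_add[OF has_integral_const_real[of "1::real" "u - \<rho>" "u + \<rho>"]
        has_integral_abs_powr_window[OF assms(3,4), of u]] assms(4) by simp
  from has_integral_mult_right[OF this, of M]
  have g: "(g has_integral M * (2 * \<rho> + 2 * (\<rho> powr (1 - q) / (1 - q)))) ?W"
    by (simp add: g_def)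
  then have gU: "((\<lambda>v. if v \<in> ?W then g v else 0) has_integral
      M * (2 * \<rho> + 2 * (\<rho> powr (1 - q) / (1 - q)))) UNIV"
    by (simp only: has_integral_restrict_UNIV)
  have gI: "(\<lambda>v. if v \<in> ?W then g v else 0) integrable_on {lo..hi}"
    using integrable_on_subinterval[OF has_integral_integrable[OF gU], of lo hi] by simp
  have g0: "0 \<le> g v" for v using assms(2) by (simp add: g_def)
  have "integral {lo..hi} (\<lambda>v. \<bar>k v\<bar>) \<le> integral {lo..hi} (\<lambda>v. if v \<in> ?W then g v else 0)"
  proof (rule integral_le[OF _ gI])
    show "(\<lambda>v. \<bar>k v\<bar>) integrable_on {lo..hi}"
      using assms(1) unfolding absolutely_integrable_on_def by simp
    show "\<bar>k v\<bar> \<le> (if v \<in> ?W then g v else 0)" if "v \<in> {lo..hi}" for v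
    proof (cases "\<bar>v - u\<bar> \<le> \<rho>")
      case True
      then show ?thesis using assms(5)[OF that] by (auto simp: g_def abs_le_iff)
    next
      case False
      then show ?thesis using assms(6)[OF that] by (auto simp: abs_le_iff)
    qed
  qed
  also have "\<dots> \<le> integral UNIV (\<lambda>v. if v \<in> ?W then g v else 0)"
    by (rule integral_subset_le) (use gI gU g0 in auto)
  also have "\<dots> = M * (2 * \<rho> + 2 * (\<rho> powr (1 - q) / (1 - q)))"
    using gU by (rule integral_unique)
  finally show ?thesis .
qed

text \<open>Measurability comes from the continuous approximations, integrability from the
  domination.\<close>

lemma abs_integrable_limit_dominated:
  fixes k :: "real \<Rightarrow> real" and k' :: "nat \<Rightarrow> real \<Rightarrow> real"
  assumes "\<And>n. continuous_on {lo..hi} (k' n)" "\<And>v. v \<in> {lo..hi} \<Longrightarrow> (\<lambda>n. k' n v) \<longlonglongrightarrow> k v"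
    and "q < 1" "u \<in> {lo..hi}" "\<And>v. v \<in> {lo..hi} \<Longrightarrow> \<bar>k v\<bar> \<le> M * (1 + \<bar>v - u\<bar> powr (-q))"
  shows "k absolutely_integrable_on {lo..hi}"
proof (rule measurable_bounded_by_integrable_imp_absolutely_integrable)
  show "k \<in> borel_measurable (lebesgue_on {lo..hi})"
  proof (rule borel_measurable_LIMSEQ_metric)
    show "k' n \<in> borel_measurable (lebesgue_on {lo..hi})" for n
      using assms(1) by (intro continuous_imp_measurable_on_sets_lebesgue) auto
  qed (use assms(2) in simp)
  \<comment> \<open>A window of this radius covers the interval, wherever \<open>u\<close> lies in
    it.\<close>
  let ?W = "{u - (hi - lo)..u + (hi - lo)}"
  have "(\<lambda>v. \<bar>v - u\<bar> powr (-q)) integrable_on ?W"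
    using has_integral_abs_powr_window[OF assms(3), of "hi - lo" u] assms(4) by (auto simp:
        has_integral_integrable)
  then have "(\<lambda>v. \<bar>v - u\<bar> powr (-q)) integrable_on {lo..hi}"
    by (rule integrable_on_subinterval) (use assms(4) in auto)
  then show "(\<lambda>v. M * (1 + \<bar>v - u\<bar> powr (-q))) integrable_on {lo..hi}"
    using integrable_cmul[OF integrable_add[OF integrable_const_ivl[of "1::real"]], of _ lo hi M] by
        simp
qed (use assms(5) in auto)

lemma cut_eventually_1:
  fixes d :: real
  assumes "d > 0"
  shows "(\<lambda>n. max 0 (min 1 (real (Suc n) * d - 1))) \<longlonglongrightarrow> 1"
proof (rule tendsto_eventually)
  obtain N :: nat where N: "2 / d < N" using reals_Archimedean2 by blast
  show "\<forall>\<^sub>F n in sequentially. max 0 (min 1 (real (Suc n) * d - 1)) = 1"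
    using eventually_ge_at_top[of N]
  proof eventually_elim
    case (elim n)
    then have "2 / d < real (Suc n)" using N by linarith
    then have "2 < real (Suc n) * d" using assms by (simp only: pos_divide_less_eq)
    then show ?case by simp
  qed
qed

text \<open>Kernel and cut kernel differ only where the distance is at most \<open>2 / m\<close>,
  and there by no more than the kernel itself. By the common bound, the L^1 error of each row and
  column is of order \<open>1 / m + m powr (q - 1)\<close>, which tends to 0 because
  \<open>q < 1\<close>.\<close>

theorem weakly_singular_sing_kernel:
  assumes ord: "admissible_order lo hi \<delta>"
  shows "weakly_singular lo hi (sing_kernel \<delta>)"
proof -
  let ?I = "{lo..hi}"
  obtain M q where M: "0 \<le> M" "0 < q" "q < 1"
    and b: "\<And>u v. u \<in> ?I \<Longrightarrow> v \<in> ?I \<Longrightarrow> \<bar>sing_kernel \<delta> u v\<bar> \<le> M * (1 + \<bar>v - u\<bar> powr (-q))"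
    using sing_kernel_bound[OF ord] by blast
  have b': "\<bar>sing_kernel \<delta> v u\<bar> \<le> M * (1 + \<bar>v - u\<bar> powr (-q))" if "u \<in> ?I" "v \<in> ?I" for u v
    using b[OF that(2,1)] by (simp add: abs_minus_commute)
  have cc: "continuous_on (?I \<times> ?I) (\<lambda>(u, v). cut_kernel \<delta> m u v)" if "m > 0" for m
    by (rule continuous_on_cut_kernel[OF ord that])
  have lim: "(\<lambda>n. cut_kernel \<delta> (real (Suc n)) u v) \<longlonglongrightarrow> sing_kernel \<delta> u v" for u v
  proof (cases "v < u")
    case True
    from tendsto_mult_left[OF cut_eventually_1[of "u - v"], of "sing_kernel \<delta> u v"] True
    show ?thesis by (simp add: cut_kernel_eq)
  qed (simp add: cut_kernel_eq sing_kernel_def)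
  have row: "sing_kernel \<delta> u absolutely_integrable_on ?I" if "u \<in> ?I" for u
    by (rule abs_integrable_limit_dominated[OF _ lim M(3) that b[OF that]])
       (rule continuous_on_row[OF cc that], simp)
  have col: "(\<lambda>v. sing_kernel \<delta> v u) absolutely_integrable_on ?I" if "u \<in> ?I" for u
    by (rule abs_integrable_limit_dominated[OF _ lim M(3) that b'[OF that]])
       (rule continuous_on_row[OF continuous_on_swap_args[OF cc] that], simp)
  have appr: "\<exists>K'. continuous_on (?I \<times> ?I) (\<lambda>(u, v). K' u v) \<and>
        (\<forall>u\<in>?I. integral ?I (\<lambda>v. \<bar>sing_kernel \<delta> u v - K' u v\<bar>) \<le> \<eta> \<and>
           integral ?I (\<lambda>v. \<bar>sing_kernel \<delta> v u - K' v u\<bar>) \<le> \<eta>)" if "\<eta> > 0" for \<eta>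
  proof -
    have "(\<lambda>n. M * (2 * (2 / Suc n) + 2 * ((2 / Suc n) powr (1 - q) / (1 - q)))) \<longlonglongrightarrow>
        M * (2 * 0 + 2 * (0 powr (1 - q) / (1 - q)))"
    proof -
      have l: "(\<lambda>n. 2 / real (Suc n)) \<longlonglongrightarrow> 0"
        using LIMSEQ_Suc[OF lim_const_over_n[of "2::real"]] by simp
      have "(\<lambda>n. (2 / real (Suc n)) powr (1 - q)) \<longlonglongrightarrow> 0 powr (1 - q)"
        using M by (intro tendsto_powr'[OF l tendsto_const]) auto
      then show ?thesis using l M by (intro tendsto_intros) auto
    qed
    then have "\<forall>\<^sub>F n in sequentially. M * (2 * (2 / Suc n) + 2 * ((2 / Suc n) powr (1 - q) / (1 -
        q))) < \<eta>"
      using that M by (intro order_tendstoD(2)) auto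
    then obtain n where n: "M * (2 * (2 / Suc n) + 2 * ((2 / Suc n) powr (1 - q) / (1 - q))) < \<eta>"
      using eventually_happens'[OF sequentially_bot] by blast
    define m where "m = real (Suc n)"
    have m: "m > 0" by (simp add: m_def)
    define c where "c = (\<lambda>u v. max 0 (min 1 (m * (u - v) - 1)))"
    have c: "0 \<le> c u v" "c u v \<le> 1" for u v by (auto simp: c_def)
    have diff: "sing_kernel \<delta> u v - cut_kernel \<delta> m u v = sing_kernel \<delta> u v * (1 - c u v)" for u v
      unfolding cut_kernel_eq[OF m] c_def by (simp add: right_diff_distrib)
    have le: "\<bar>sing_kernel \<delta> u v - cut_kernel \<delta> m u v\<bar> \<le> \<bar>sing_kernel \<delta> u v\<bar>" for u v
      unfolding diff abs_mult using c[of u v] by (intro mult_left_le) auto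
    have z: "sing_kernel \<delta> u v - cut_kernel \<delta> m u v = 0" if "2 / m < \<bar>v - u\<bar>" for u v
    proof (cases "v < u")
      case True
      then have "2 < m * (u - v)" using that m by (simp add: field_simps)
      then show ?thesis unfolding diff c_def by simp
    qed (simp add: sing_kernel_def cut_kernel_eq[OF m])
    have cr: "cut_kernel \<delta> m u absolutely_integrable_on ?I"
        "(\<lambda>v. cut_kernel \<delta> m v u) absolutely_integrable_on ?I" if "u \<in> ?I" for u
      using continuous_on_row[OF cc[OF m] that] continuous_on_row[OF continuous_on_swap_args[OF
          cc[OF m]] that]
      by (auto intro: absolutely_integrable_continuous_real)
    have "integral ?I (\<lambda>v. \<bar>sing_kernel \<delta> u v - cut_kernel \<delta> m u v\<bar>) \<le> \<eta>"
      "integral ?I (\<lambda>v. \<bar>sing_kernel \<delta> v u - cut_kernel \<delta> m v u\<bar>) \<le> \<eta>" if "u \<in> ?I" for u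
    proof -
      have "integral ?I (\<lambda>v. \<bar>sing_kernel \<delta> u v - cut_kernel \<delta> m u v\<bar>)
          \<le> M * (2 * (2 / m) + 2 * ((2 / m) powr (1 - q) / (1 - q)))"
        using M m z le order_trans[OF le b[OF that]] set_integral_diff(1)[OF row[OF that] cr(1)[OF
            that]]
        by (intro integral_le_window[where u = u]) auto
      then show "integral ?I (\<lambda>v. \<bar>sing_kernel \<delta> u v - cut_kernel \<delta> m u v\<bar>) \<le> \<eta>"
        using n by (simp add: m_def)
      have "integral ?I (\<lambda>v. \<bar>sing_kernel \<delta> v u - cut_kernel \<delta> m v u\<bar>)
          \<le> M * (2 * (2 / m) + 2 * ((2 / m) powr (1 - q) / (1 - q)))"
        using M m z[of u] le order_trans[OF le b'[OF that]] set_integral_diff(1)[OF col[OF that]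
            cr(2)[OF that]]
        by (intro integral_le_window[where u = u]) (auto simp: abs_minus_commute intro!: z)
      then show "integral ?I (\<lambda>v. \<bar>sing_kernel \<delta> v u - cut_kernel \<delta> m v u\<bar>) \<le> \<eta>"
        using n by (simp add: m_def)
    qed
    then show ?thesis using cc[OF m] by (intro exI[of _ "cut_kernel \<delta> m"]) auto
  qed
  show ?thesis
    unfolding weakly_singular_def using row col appr by blast
qed

section \<open>Fractional integrals as integrals against the kernel\<close>

lemma frac_left_eq:
  assumes "c \<in> {lo..hi}" "u \<in> {lo..hi}"
  shows "frac_left c \<delta> f u = integral {c..hi} (\<lambda>v. sing_kernel \<delta> u v * f v)"
proof -
  \<comment> \<open>The two kernels may differ on the diagonal, a null set. For \<open>u < c\<close>
    the interval is empty and the kernel vanishes on \<open>{c..hi}\<close>, so both sides are 0;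
    thus an integral based at \<open>c\<close> continues by 0 to the wrong side of
    \<open>c\<close>.\<close>
  have "frac_left c \<delta> f u = integral {c..u} (\<lambda>v. sing_kernel \<delta> u v * f v)"
    unfolding frac_left_def
    by (rule integral_spike[of "{u}"]) (auto simp: sing_kernel_def)
  also have "\<dots> = integral {c..hi} (\<lambda>v. if v \<in> {c..u} then sing_kernel \<delta> u v * f v else 0)"
    using assms integral_restrict_Int[of "{c..hi}" "{c..u}" "\<lambda>v. sing_kernel \<delta> u v * f v"]
    by (simp add: min_absorb2)
  also have "\<dots> = integral {c..hi} (\<lambda>v. sing_kernel \<delta> u v * f v)"
    by (rule integral_cong) (simp add: sing_kernel_def)
  finally show ?thesis .
qed

lemma frac_right_eq:
  assumes "c \<in> {lo..hi}" "u \<in> {lo..hi}"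
  shows "frac_right c \<delta> f u = integral {lo..c} (\<lambda>v. sing_kernel \<delta> v u * f v)"
proof -
  have "frac_right c \<delta> f u = integral {u..c} (\<lambda>v. sing_kernel \<delta> v u * f v)"
    unfolding frac_right_def
    by (rule integral_spike[of "{u}"]) (auto simp: sing_kernel_def)
  also have "\<dots> = integral {lo..c} (\<lambda>v. if v \<in> {u..c} then sing_kernel \<delta> v u * f v else 0)"
    using assms integral_restrict_Int[of "{lo..c}" "{u..c}" "\<lambda>v. sing_kernel \<delta> v u * f v"]
    by (simp add: max_absorb2)
  also have "\<dots> = integral {lo..c} (\<lambda>v. sing_kernel \<delta> v u * f v)"
    by (rule integral_cong) (simp add: sing_kernel_def)
  finally show ?thesis .
qed

lemma continuous_on_frac_left:
  fixes f :: "real \<Rightarrow> 'b::topological_space \<Rightarrow> real"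
  assumes "admissible_order lo hi \<delta>" "c \<in> {lo..hi}" "compact Y"
    and "continuous_on ({lo..hi} \<times> Y) (\<lambda>(v, y). f v y)"
  shows "continuous_on ({lo..hi} \<times> Y) (\<lambda>(u, y). frac_left c \<delta> (\<lambda>v. f v y) u)"
proof -
  have "continuous_on ({lo..hi} \<times> Y) (\<lambda>(u, y). integral {c..hi} (\<lambda>v. sing_kernel \<delta> u v * f v y))"
    using assms by (intro continuous_on_weakly_singular weakly_singular_sing_kernel) auto
  then show ?thesis
    by (rule continuous_on_eq) (auto simp: frac_left_eq[OF assms(2)])
qed

lemma continuous_on_frac_right:
  fixes f :: "real \<Rightarrow> 'b::topological_space \<Rightarrow> real"
  assumes "admissible_order lo hi \<delta>" "c \<in> {lo..hi}" "compact Y"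
    and "continuous_on ({lo..hi} \<times> Y) (\<lambda>(v, y). f v y)"
  shows "continuous_on ({lo..hi} \<times> Y) (\<lambda>(u, y). frac_right c \<delta> (\<lambda>v. f v y) u)"
proof -
  have "continuous_on ({lo..hi} \<times> Y) (\<lambda>(u, y). integral {lo..c} (\<lambda>v. sing_kernel \<delta> v u * f v y))"
    using assms
    by (intro continuous_on_weakly_singular[OF weakly_singular_swap[OF
        weakly_singular_sing_kernel]]) auto
  then show ?thesis
    by (rule continuous_on_eq) (auto simp: frac_right_eq[OF assms(2)])
qed

lemma frac_left_integrable:
  assumes "admissible_order lo hi \<delta>" "continuous_on {lo..hi} f" "c \<in> {lo..hi}" "u \<in> {lo..hi}"
  shows "(\<lambda>v. frac_kernel \<delta> u v * f v) integrable_on {c..u}"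
proof -
  have "(\<lambda>v. sing_kernel \<delta> u v * f v) integrable_on {c..u}"
    using weakly_singular_integrable[OF weakly_singular_sing_kernel[OF assms(1)] assms(2)]
        assms(3,4) by auto
  then show ?thesis
    by (rule integrable_spike[of _ _ "{u}"]) (auto simp: sing_kernel_def)
qed

lemma frac_right_integrable:
  assumes "admissible_order lo hi \<delta>" "continuous_on {lo..hi} f" "c \<in> {lo..hi}" "u \<in> {lo..hi}"
  shows "(\<lambda>v. frac_kernel \<delta> v u * f v) integrable_on {u..c}"
proof -
  have "(\<lambda>v. sing_kernel \<delta> v u * f v) integrable_on {u..c}"
    using weakly_singular_integrable[OF weakly_singular_swap[OF weakly_singular_sing_kernel[OF
        assms(1)]] assms(2)]
      assms(3,4) by auto
  then show ?thesis
    by (rule integrable_spike[of _ _ "{u}"]) (auto simp: sing_kernel_def)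
qed

text \<open>Exchange of integrals. The kernel vanishes unless \<open>v < u\<close>, so for fixed
  \<open>v\<close> the variable \<open>u\<close> runs over \<open>[v, c]\<close>: this is the right
  integral based at \<open>c\<close>, and it is 0 for \<open>v\<close> beyond
  \<open>c\<close>.\<close>

lemma frac_left_by_parts:
  assumes ord: "admissible_order lo hi \<delta>" and c: "c \<in> {lo..hi}"
    and f: "continuous_on {lo..hi} f" and p: "continuous_on {lo..hi} p"
  shows "integral {lo..c} (\<lambda>u. f u * frac_left lo \<delta> p u) = integral {lo..hi} (\<lambda>v. p v * frac_right c
      \<delta> f v)"
proof -
  have "integral {lo..c} (\<lambda>u. f u * frac_left lo \<delta> p u)
      = integral {lo..c} (\<lambda>u. f u * integral {lo..hi} (\<lambda>v. sing_kernel \<delta> u v * p v))"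
    using c by (intro integral_cong) (auto simp: frac_left_eq[of lo lo hi])
  also have "\<dots> = integral {lo..hi} (\<lambda>v. p v * integral {lo..c} (\<lambda>u. sing_kernel \<delta> u v * f u))"
    using c by (intro weakly_singular_Fubini[OF weakly_singular_sing_kernel[OF ord] _ _ f p]) auto
  also have "\<dots> = integral {lo..hi} (\<lambda>v. p v * frac_right c \<delta> f v)"
    using c by (intro integral_cong) (auto simp: frac_right_eq[of c lo hi])
  finally show ?thesis .
qed

text \<open>Here \<open>u < v\<close> and \<open>u \<le> c\<close>, so \<open>u\<close> runs over
  \<open>[lo, min v c]\<close>, which is the left integral from \<open>lo\<close> minus the part
  from \<open>c\<close> on. This need not vanish for \<open>v\<close> beyond \<open>c\<close>; it is
  the source of the equation after \<open>T\<close>.\<close>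

lemma frac_right_by_parts:
  assumes ord: "admissible_order lo hi \<delta>" and c: "c \<in> {lo..hi}"
    and f: "continuous_on {lo..hi} f" and p: "continuous_on {lo..hi} p"
  shows "integral {lo..c} (\<lambda>u. f u * frac_right hi \<delta> p u)
       = integral {lo..hi} (\<lambda>v. p v * (frac_left lo \<delta> f v - frac_left c \<delta> f v))"
proof -
  have w: "weakly_singular lo hi (sing_kernel \<delta>)" by (rule weakly_singular_sing_kernel[OF ord])
  have "integral {lo..c} (\<lambda>u. f u * frac_right hi \<delta> p u)
      = integral {lo..c} (\<lambda>u. f u * integral {lo..hi} (\<lambda>v. sing_kernel \<delta> v u * p v))"
    using c by (intro integral_cong) (auto simp: frac_right_eq[of hi lo hi])
  also have "\<dots> = integral {lo..hi} (\<lambda>v. p v * integral {lo..c} (\<lambda>u. sing_kernel \<delta> v u * f u))"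
    using c by (intro weakly_singular_Fubini[OF weakly_singular_swap[OF w] _ _ f p]) auto
  also have "\<dots> = integral {lo..hi} (\<lambda>v. p v * (frac_left lo \<delta> f v - frac_left c \<delta> f v))"
  proof (rule integral_cong)
    fix v assume v: "v \<in> {lo..hi}"
    have "(\<lambda>u. sing_kernel \<delta> v u * f u) integrable_on {lo..hi}"
      by (rule weakly_singular_integrable[OF w f _ v]) simp
    from Henstock_Kurzweil_Integration.integral_combine[OF _ _ this, of c] c v
    show "p v * integral {lo..c} (\<lambda>u. sing_kernel \<delta> v u * f u)
        = p v * (frac_left lo \<delta> f v - frac_left c \<delta> f v)"
      by (auto simp: frac_left_eq[of _ lo hi])
  qed
  finally show ?thesis .
qed

section \<open>Integration along one coordinate\<close>

lemma coord_upd_nth [simp]: "coord_upd s i r $ j = (if j = i then r else s $ j)"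
  by (simp add: coord_upd_def)

lemma coord_upd_idem [simp]: "coord_upd (coord_upd s i r) i r' = coord_upd s i r'"
  by (simp add: vec_eq_iff)

lemma coord_upd_eq: "coord_upd s i r = s + (r - s $ i) *\<^sub>R axis i 1"
  by (simp add: vec_eq_iff axis_def)

lemma continuous_on_coord_upd [continuous_intros]:
  "continuous_on A f \<Longrightarrow> continuous_on A g \<Longrightarrow> continuous_on A (\<lambda>x. coord_upd (f x) i (g x))"
  unfolding coord_upd_eq by (intro continuous_intros)

lemma coord_upd_in_cbox:
  fixes s :: "real^'n"
  assumes "s \<in> cbox lo hi" "r \<in> {lo $ i..hi $ i}"
  shows "coord_upd s i r \<in> cbox lo hi"
  using assms by (auto simp: mem_box_cart)

lemma emeasure_lborel_box_cart:
  fixes l u :: "real^'n"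
  assumes "\<And>i. l $ i \<le> u $ i"
  shows "emeasure lborel (box l u) = ennreal (\<Prod>i\<in>UNIV. u $ i - l $ i)"
proof -
  have "(\<Prod>b\<in>Basis. (u - l) \<bullet> b) = (\<Prod>i\<in>UNIV. u $ i - l $ i)"
    by (rule prod.reindex_cong[of "\<lambda>i. axis i 1"])
       (auto simp: inj_on_def axis_eq_axis Basis_vec_def inner_axis)
  moreover have "l \<bullet> b \<le> u \<bullet> b" if "b \<in> Basis" for b
    using assms that by (auto simp: Basis_vec_def inner_axis)
  ultimately show ?thesis
    using emeasure_lborel_box[of l u] by simp
qed

lemma measurable_slab_density:
  "(\<lambda>(\<sigma>, s). indicator {s. s $ i \<in> {p<..<q}} s / (q - p)) \<in> borel_measurable (lborel :: (real \<times>
      (real^'n)) measure)"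
proof -
  have "open {z :: real \<times> (real^'n). p < snd z $ i \<and> snd z $ i < q}"
    by (intro open_Collect_conj open_Collect_less continuous_intros)
  then have "(\<lambda>z :: real \<times> (real^'n). indicator {z. p < snd z $ i \<and> snd z $ i < q} z / (q - p))
      \<in> borel_measurable lborel"
    by (intro borel_measurable_divide borel_measurable_indicator borel_measurable_const) auto
  then show ?thesis by (simp add: split_beta indicator_def)
qed

text \<open>Replacing one coordinate by an independent uniform variable preserves Lebesgue measure.\<close>

lemma lborel_coord_upd:
  fixes i :: "'n::finite"
  assumes "p < q"
  shows "(lborel :: (real^'n) measure) = distr
    (density lborel (\<lambda>(\<sigma>, s). ennreal (indicator {s. s $ i \<in> {p<..<q}} s / (q - p)))) borel
    (\<lambda>(\<sigma>, s). coord_upd s i \<sigma>)"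
    (is "_ = distr (density _ ?d) _ ?g")
proof (rule lborel_eqI)
  have g: "?g \<in> borel_measurable borel"
    unfolding split_beta by (intro borel_measurable_continuous_onI continuous_intros)
  have d: "?d \<in> borel_measurable (lborel :: (real \<times> (real^'n)) measure)"
    using measurable_compose[OF measurable_slab_density measurable_ennreal, of i p q]
    by (simp add: split_beta)
  fix l u :: "real^'n"
  assume le: "\<And>b. b \<in> Basis \<Longrightarrow> l \<bullet> b \<le> u \<bullet> b"
  have lu: "l $ j \<le> u $ j" for j
    using le[of "axis j 1"] by (simp add: inner_axis axis_in_Basis_iff)
  \<comment> \<open>Within the slab the preimage of the box is a product: \<sigma> takes over the
    \<open>i\<close>-th side, while \<open>s\<close> keeps the other sides and has its
    \<open>i\<close>-th coordinate between \<open>p\<close> and \<open>q\<close>. The factor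
    \<open>q - p\<close> cancels against the density.\<close>
  let ?B = "box (coord_upd l i p) (coord_upd u i q)"
  have "emeasure (distr (density lborel ?d) borel ?g) (box l u)
      = (\<integral>\<^sup>+z. ?d z * indicator (?g -` box l u) z \<partial>lborel)"
    using g d by (subst emeasure_distr) (auto simp: emeasure_density measurable_sets_borel[OF g])
  also have "\<dots> = (\<integral>\<^sup>+z. ennreal (1 / (q - p)) * indicator ({l $ i<..<u $ i} \<times> ?B) z \<partial>(lborel \<Otimes>\<^sub>M
      lborel))"
    unfolding lborel_prod by (rule nn_integral_cong) (auto simp: indicator_def mem_box_cart split:
        if_splits)
  also have "\<dots> = ennreal (1 / (q - p)) * (emeasure lborel {l $ i<..<u $ i} * emeasure lborel ?B)"
    by (subst nn_integral_cmult_indicator) (auto simp: lborel.emeasure_pair_measure_Times)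
  also have "emeasure lborel ?B = ennreal (\<Prod>j\<in>UNIV. coord_upd u i q $ j - coord_upd l i p $ j)"
    using lu assms by (intro emeasure_lborel_box_cart) auto
  also have "(\<Prod>j\<in>UNIV. coord_upd u i q $ j - coord_upd l i p $ j) = (q - p) * (\<Prod>j\<in>UNIV - {i}. u $ j
      - l $ j)"
    by (subst prod.remove[of _ i]) (auto intro!: prod.cong)
  also have "ennreal (1 / (q - p)) * (emeasure lborel {l $ i<..<u $ i} * ennreal ((q - p) * (\<Prod>j\<in>UNIV
      - {i}. u $ j - l $ j)))
      = ennreal ((u $ i - l $ i) * (\<Prod>j\<in>UNIV - {i}. u $ j - l $ j))"
    using assms lu by (simp add: ennreal_mult'[symmetric] prod_nonneg)
  also have "(u $ i - l $ i) * (\<Prod>j\<in>UNIV - {i}. u $ j - l $ j) = (\<Prod>j\<in>UNIV. u $ j - l $ j)"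
    by (rule prod.remove[symmetric]) auto
  also have "ennreal (\<Prod>j\<in>UNIV. u $ j - l $ j) = ennreal (\<Prod>b\<in>Basis. (u - l) \<bullet> b)"
    using emeasure_lborel_box_cart[OF lu] emeasure_lborel_box[OF le] by simp
  finally show "emeasure (distr (density lborel ?d) borel ?g) (box l u)
      = ennreal (\<Prod>b\<in>Basis. (u - l) \<bullet> b)" .
qed simp

lemma set_integrable_box_continuous:
  fixes f :: "'a::euclidean_space \<Rightarrow> real"
  assumes "continuous_on (cbox a b) f"
  shows "set_integrable lborel (box a b) f"
proof (rule set_integrable_subset)
  show "set_integrable lborel (cbox a b) f"
    unfolding set_integrable_def by (rule borel_integrable_compact[OF compact_cbox assms])
qed (auto simp: box_subset_cbox)

lemma lborel_integral_pair:
  fixes h :: "real \<times> 'b::euclidean_space \<Rightarrow> real"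
  assumes "integrable lborel h"
  shows "(\<integral>z. h z \<partial>lborel) = (\<integral>s. (\<integral>\<sigma>. h (\<sigma>, s) \<partial>lborel) \<partial>lborel)"
  using lborel_pair.integral_snd[of "\<lambda>\<sigma> s. h (\<sigma>, s)"] assms by (simp add: lborel_prod)

text \<open>This is \<open>lborel_coord_upd\<close> with the \<open>i\<close>-th side of the box as
  slab. The inner integral over a coordinate line does not depend on \<open>s $ i\<close>, so
  identities valid on every line transfer to the whole box.\<close>

lemma integral_coord_average:
  fixes f :: "real^'n \<Rightarrow> real" and i :: "'n::finite"
  assumes f: "continuous_on (cbox lo hi) f" and i: "lo $ i < hi $ i"
  shows "integral (cbox lo hi) f
    = integral (cbox lo hi) (\<lambda>s. integral {lo $ i..hi $ i} (\<lambda>\<sigma>. f (coord_upd s i \<sigma>))) / (hi $ i - lo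
        $ i)"
proof -
  let ?p = "lo $ i" and ?q = "hi $ i"
  let ?J = "{?p<..<?q}"
  let ?F = "\<lambda>s. indicator (box lo hi) s *\<^sub>R f s"
  let ?S = "{s :: real^'n. s $ i \<in> ?J}"
  let ?d = "\<lambda>(\<sigma> :: real, s). indicator ?S s / (?q - ?p) :: real" and ?g = "\<lambda>(\<sigma>, s). coord_upd s i \<sigma>"
  have g: "?g \<in> borel_measurable borel"
    unfolding split_beta by (intro borel_measurable_continuous_onI continuous_intros)
  have d: "?d \<in> borel_measurable (lborel :: (real \<times> (real^'n)) measure)"
    by (rule measurable_slab_density)
  have F: "?F \<in> borel_measurable borel"
    using f by (intro borel_measurable_continuous_on_indicator continuous_on_subset[OF f]
        box_subset_cbox) auto
  let ?M = "density lborel (\<lambda>z. ennreal (?d z))"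
  have lborel_eq: "lborel = distr ?M borel ?g"
    using lborel_coord_upd[OF i, of i] by (simp add: split_beta')
  have gF: "(\<lambda>z. ?F (?g z)) \<in> borel_measurable lborel"
    using measurable_compose[OF g F] by simp
  have fi: "set_integrable lborel (box lo hi) f"
    by (rule set_integrable_box_continuous[OF f])
  have ci: "continuous_on (cbox lo hi) (\<lambda>s. integral {?p..?q} (\<lambda>\<sigma>. f (coord_upd s i \<sigma>)))"
    unfolding box_real(2)[symmetric]
    by (rule integral_continuous_on_param)
       (auto simp: split_beta intro!: continuous_on_compose2[OF f] continuous_intros coord_upd_in_cbox)
  \<comment> \<open>Passing to the open box matches the open slab of the density.\<close>
  have "integral (cbox lo hi) f = integral (box lo hi) f"
    by (simp add: integral_open_interval)
  also have "\<dots> = (\<integral>s. ?F s \<partial>lborel)"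
    using set_borel_integral_eq_integral(2)[OF fi] by (simp add: set_lebesgue_integral_def)
  also have "\<dots> = (\<integral>s. ?F s \<partial>(distr ?M borel ?g))"
    by (subst lborel_eq) simp
  also have "\<dots> = (\<integral>z. ?F (?g z) \<partial>?M)"
    using F g by (subst integral_distr) auto
  also have "\<dots> = (\<integral>z. ?d z *\<^sub>R ?F (?g z) \<partial>lborel)"
    using d i gF by (subst integral_density) auto
  also have "\<dots> = (\<integral>s. (\<integral>\<sigma>. ?d (\<sigma>, s) *\<^sub>R ?F (?g (\<sigma>, s)) \<partial>lborel) \<partial>lborel)"
  proof -
    have "integrable (distr ?M borel ?g) ?F"
      using fi lborel_eq unfolding set_integrable_def by metis
    then have "integrable ?M (\<lambda>z. ?F (?g z))"
      using F g by (subst (asm) integrable_distr_eq) auto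
    then have "integrable lborel (\<lambda>z. ?d z *\<^sub>R ?F (?g z))"
      using d i gF by (subst (asm) integrable_density) auto
    then show ?thesis
      by (rule lborel_integral_pair)
  qed
  also have "\<dots> = (\<integral>s. indicator (box lo hi) s *\<^sub>R (integral {?p..?q} (\<lambda>\<sigma>. f (coord_upd s i \<sigma>)) / (?q
      - ?p)) \<partial>lborel)"
  proof (rule Bochner_Integration.integral_cong[OF refl])
    fix s :: "real^'n"
    show "(\<integral>\<sigma>. ?d (\<sigma>, s) *\<^sub>R ?F (?g (\<sigma>, s)) \<partial>lborel)
        = indicator (box lo hi) s *\<^sub>R (integral {?p..?q} (\<lambda>\<sigma>. f (coord_upd s i \<sigma>)) / (?q - ?p))"
    proof (cases "s \<in> box lo hi")
      case True
      have c: "continuous_on {?p..?q} (\<lambda>\<sigma>. f (coord_upd s i \<sigma>))"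
        using True box_subset_cbox[of lo hi]
        by (intro continuous_on_compose2[OF f] continuous_intros) (auto intro!: coord_upd_in_cbox)
      have si: "set_integrable lborel ?J (\<lambda>\<sigma>. f (coord_upd s i \<sigma>))"
        by (rule set_integrable_subset[of _ "{?p..?q}"]) (auto intro!:
            borel_integrable_atLeastAtMost' c)
      have "(\<integral>\<sigma>. ?d (\<sigma>, s) *\<^sub>R ?F (?g (\<sigma>, s)) \<partial>lborel)
          = (\<integral>\<sigma>. indicator ?J \<sigma> *\<^sub>R f (coord_upd s i \<sigma>) / (?q - ?p) \<partial>lborel)"
        using True by (intro Bochner_Integration.integral_cong[OF refl]) (auto simp: indicator_def
            mem_box_cart)
      also have "\<dots> = integral ?J (\<lambda>\<sigma>. f (coord_upd s i \<sigma>)) / (?q - ?p)"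
        using set_borel_integral_eq_integral(2)[OF si] by (simp add: set_lebesgue_integral_def)
      also have "\<dots> = integral {?p..?q} (\<lambda>\<sigma>. f (coord_upd s i \<sigma>)) / (?q - ?p)"
        using integral_open_interval[of ?p ?q "\<lambda>\<sigma>. f (coord_upd s i \<sigma>)"] by simp
      finally show ?thesis using True by simp
    next
      case False
      have "?d (\<sigma>, s) *\<^sub>R ?F (?g (\<sigma>, s)) = 0" for \<sigma>
        using False by (auto simp: indicator_def mem_box_cart split: if_splits)
      then have "(\<integral>\<sigma>. ?d (\<sigma>, s) *\<^sub>R ?F (?g (\<sigma>, s)) \<partial>lborel) = 0"
        by (simp only: Bochner_Integration.integral_zero)
      then show ?thesis using False by (simp only: indicator_simps(2) scaleR_zero_left
          not_False_eq_True)
    qed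
  qed
  also have "\<dots> = integral (box lo hi) (\<lambda>s. integral {?p..?q} (\<lambda>\<sigma>. f (coord_upd s i \<sigma>))) / (?q - ?p)"
  proof -
    have "set_integrable lborel (box lo hi) (\<lambda>s. integral {?p..?q} (\<lambda>\<sigma>. f (coord_upd s i \<sigma>)))"
      by (rule set_integrable_box_continuous[OF ci])
    from set_borel_integral_eq_integral(2)[OF this] show ?thesis
      by (simp add: set_lebesgue_integral_def)
  qed
  also have "\<dots> = integral (cbox lo hi) (\<lambda>s. integral {?p..?q} (\<lambda>\<sigma>. f (coord_upd s i \<sigma>))) / (?q - ?p)"
    by (simp add: integral_open_interval)
  finally show ?thesis .
qed

section \<open>Perturbation of ordinary differential equations\<close>

lemma has_integral_exp_weight:
  fixes K :: real
  assumes "K > 0" "a \<le> t"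
  shows "((\<lambda>\<tau>. exp (K * (\<tau> - a))) has_integral (exp (K * (t - a)) - 1) / K) {a..t}"
proof -
  have "((\<lambda>\<tau>. exp (K * (\<tau> - a))) has_integral exp (K * (t - a)) / K - exp (K * (a - a)) / K) {a..t}"
    using assms
    by (intro fundamental_theorem_of_calculus)
       (auto simp: has_real_derivative_iff_has_vector_derivative[symmetric] intro!:
           derivative_eq_intros)
  then show ?thesis by (simp add: diff_divide_distrib)
qed

text \<open>The choice \<open>K = 2 * C + 1\<close> makes \<open>C / K \<le> 1 / 2\<close>: in the
  supremum norm with weight \<open>exp (- (K * (t - a)))\<close>, integrating a term with Lipschitz
  constant \<open>C\<close> at least halves distances, on an interval of any length. The same
  estimate yields existence of solutions and the growth bound.\<close>

lemma weighted_integral_bound: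
  fixes h :: "real \<Rightarrow> real"
  assumes "continuous_on {a..t} h" "a \<le> t" "0 \<le> C" "0 \<le> m" "0 \<le> D" "K = 2 * C + 1"
    and "\<And>\<tau>. \<tau> \<in> {a..t} \<Longrightarrow> \<bar>h \<tau>\<bar> \<le> C * (exp (K * (\<tau> - a)) * m) + D"
  shows "exp (- (K * (t - a))) * \<bar>integral {a..t} h\<bar> \<le> m / 2 + D * (t - a)"
proof -
  have K: "K > 0" using assms by simp
  have "((\<lambda>\<tau>. C * m * exp (K * (\<tau> - a)) + D) has_integral C * m * ((exp (K * (t - a)) - 1) / K) + (t
      - a) *\<^sub>R D) {a..t}"
    using assms(2) has_integral_const_real[of D a t]
    by (intro has_integral_add has_integral_mult_right has_integral_exp_weight[OF K]) auto
  then have i: "((\<lambda>\<tau>. C * (exp (K * (\<tau> - a)) * m) + D) has_integral C * m * ((exp (K * (t - a)) - 1)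
      / K) + (t - a) * D) {a..t}"
    by (simp add: algebra_simps)
  have "norm (integral {a..t} h) \<le> integral {a..t} (\<lambda>\<tau>. C * (exp (K * (\<tau> - a)) * m) + D)"
    using assms(7) by (intro integral_norm_bound_integral integrable_continuous_real assms(1)
        has_integral_integrable[OF i]) auto
  also have "\<dots> = C * m * ((exp (K * (t - a)) - 1) / K) + (t - a) * D"
    using i by (rule integral_unique)
  also have "\<dots> \<le> C / K * m * exp (K * (t - a)) + (t - a) * D"
    using assms K by (simp add: field_simps mult_nonneg_nonneg)
  also have "\<dots> \<le> 1 / 2 * m * exp (K * (t - a)) + (t - a) * D * exp (K * (t - a))"
  proof (intro add_mono mult_right_mono)
    show "C / K \<le> 1 / 2" using assms K by (simp add: field_simps)
    show "(t - a) * D \<le> (t - a) * D * exp (K * (t - a))"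
      using assms K mult_left_mono[of 1 "exp (K * (t - a))" "(t - a) * D"] by simp
  qed (use assms in auto)
  finally have "exp (- (K * (t - a))) * \<bar>integral {a..t} h\<bar>
      \<le> exp (- (K * (t - a))) * ((m / 2 + (t - a) * D) * exp (K * (t - a)))"
    by (intro mult_left_mono) (auto simp: algebra_simps)
  also have "\<dots> = (m / 2 + (t - a) * D) * (exp (- (K * (t - a))) * exp (K * (t - a)))"
    by (simp only: mult_ac)
  also have "\<dots> = m / 2 + D * (t - a)"
    by (simp add: exp_add[symmetric])
  finally show ?thesis .
qed

text \<open>Picard iteration in the weighted norm, where a single contraction covers the whole
  interval. The fixed point \<open>u\<close> stands for the solution divided by the exponential, and
  \<open>h\<close> puts that factor back.\<close>

theorem global_solution_Lipschitz:
  fixes F :: "real \<Rightarrow> real \<Rightarrow> real"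
  assumes ab: "a \<le> b" and C: "0 \<le> C"
    and cont: "continuous_on ({a..b} \<times> UNIV) (\<lambda>(t, r). F t r)"
    and lip: "\<And>t r r'. t \<in> {a..b} \<Longrightarrow> \<bar>F t r - F t r'\<bar> \<le> C * \<bar>r - r'\<bar>"
  obtains w where "w a = w0"
    "\<And>t. t \<in> {a..b} \<Longrightarrow> (w has_real_derivative F t (w t)) (at t within {a..b})"
proof -
  define K where "K = 2 * C + 1"
  \<comment> \<open>Bounded continuous functions live on the whole line here; composing with the
    retraction \<open>c\<close> extends those on \<open>[a, b]\<close>.\<close>
  define c where "c = (\<lambda>t. max a (min b t))"
  have c: "c t \<in> {a..b}" for t using ab by (auto simp: c_def)
  have cc: "continuous_on UNIV c" unfolding c_def by (intro continuous_intros)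
  define h where "h = (\<lambda>(u :: real \<Rightarrow>\<^sub>C real) \<tau>. F \<tau> (exp (K * (\<tau> - a)) * apply_bcontfun u \<tau>))"
  define G where "G = (\<lambda>u t. exp (- (K * (t - a))) * (w0 + integral {a..t} (h u)))"
  define S where "S = (\<lambda>u. Bcontfun (\<lambda>t. G u (c t)))"
  have ch: "continuous_on {a..b} (h u)" for u
  proof -
    have "continuous_on {a..b} (\<lambda>\<tau>. (\<lambda>(t, r). F t r) (\<tau>, exp (K * (\<tau> - a)) * apply_bcontfun u \<tau>))"
      by (rule continuous_on_compose2[OF cont]) (auto intro!: continuous_intros
          continuous_on_apply_bcontfun)
    then show ?thesis by (simp add: h_def)
  qed
  have cG: "continuous_on {a..b} (G u)" for u
    unfolding G_def by (intro continuous_intros indefinite_integral_continuous_1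
        integrable_continuous_real ch)
  have "(\<lambda>t. G u (c t)) \<in> bcontfun" for u
  proof -
    have "bounded (G u ` {a..b})"
      by (intro compact_imp_bounded compact_continuous_image cG) auto
    then obtain B where B: "\<forall>y\<in>G u ` {a..b}. norm y \<le> B"
      unfolding bounded_iff by blast
    show ?thesis
    proof (rule bcontfun_normI)
      show "continuous_on UNIV (\<lambda>t. G u (c t))"
        by (rule continuous_on_compose2[OF cG cc]) (use c in auto)
      show "norm (G u (c t)) \<le> B" for t using B c by blast
    qed
  qed
  then have S: "apply_bcontfun (S u) t = G u (c t)" for u t
    by (simp add: S_def Bcontfun_inverse)
  have "\<exists>!u. S u = u"
  proof (rule banach_fix_type[of "1 / 2"])
    show "\<forall>u v. dist (S u) (S v) \<le> 1 / 2 * dist u v"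
    proof (intro allI dist_bound)
      fix u v t
      have t: "c t \<in> {a..b}" by (rule c)
      have "dist (S u t) (S v t) = exp (- (K * (c t - a))) * \<bar>integral {a..c t} (h u) - integral
          {a..c t} (h v)\<bar>"
        unfolding S G_def dist_real_def by (simp add: right_diff_distrib[symmetric] abs_mult)
      also have "integral {a..c t} (h u) - integral {a..c t} (h v) = integral {a..c t} (\<lambda>\<tau>. h u \<tau> -
          h v \<tau>)"
        using t by (intro integral_diff[symmetric] integrable_continuous_real
            continuous_on_subset[OF ch]) auto
      also have "exp (- (K * (c t - a))) * \<bar>\<dots>\<bar> \<le> dist u v / 2 + 0 * (c t - a)"
      proof (rule weighted_integral_bound[OF _ _ C _ _ K_def])
        show "continuous_on {a..c t} (\<lambda>\<tau>. h u \<tau> - h v \<tau>)"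
          using t by (intro continuous_on_diff continuous_on_subset[OF ch]) auto
        fix \<tau> assume "\<tau> \<in> {a..c t}"
        then have "\<tau> \<in> {a..b}" using t by auto
        from lip[OF this]
        have "\<bar>h u \<tau> - h v \<tau>\<bar> \<le> C * \<bar>exp (K * (\<tau> - a)) * (apply_bcontfun u \<tau> - apply_bcontfun v \<tau>)\<bar>"
          by (simp add: h_def right_diff_distrib)
        also have "\<dots> \<le> C * (exp (K * (\<tau> - a)) * dist u v)"
          using C dist_bounded[of u \<tau> v] by (intro mult_left_mono) (auto simp: abs_mult dist_real_def)
        finally show "\<bar>h u \<tau> - h v \<tau>\<bar> \<le> C * (exp (K * (\<tau> - a)) * dist u v) + 0" by simp
      qed (use t in auto)
      finally show "dist (S u t) (S v t) \<le> 1 / 2 * dist u v" by simp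
    qed
  qed auto
  then obtain u where u: "S u = u" by blast
  define w where "w = (\<lambda>t. w0 + integral {a..t} (h u))"
  have ut: "exp (K * (t - a)) * apply_bcontfun u t = w t" if "t \<in> {a..b}" for t
  proof -
    have "c t = t" using that by (auto simp: c_def)
    then have "apply_bcontfun u t = exp (- (K * (t - a))) * w t"
      using S[of u t] u by (simp add: G_def w_def)
    then show ?thesis by (simp add: exp_minus)
  qed
  have "(w has_real_derivative F t (w t)) (at t within {a..b})" if t: "t \<in> {a..b}" for t
  proof -
    have "(w has_real_derivative h u t) (at t within {a..b})"
      unfolding w_def using integral_has_real_derivative[OF ch t] by (auto intro!: derivative_eq_intros)
    then show ?thesis using ut[OF t] by (simp add: h_def)
  qed
  then show ?thesis by (intro that[of w]) (auto simp: w_def)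
qed

text \<open>A Gronwall bound: if \<open>m\<close> is the maximum of the weighted
  \<open>\<bar>e\<bar>\<close>, then \<open>weighted_integral_bound\<close> gives
  \<open>m \<le> m / 2 + D * (b - a)\<close>, and absorbing \<open>m / 2\<close> produces the factor
  2.\<close>

lemma derivative_bound_growth:
  fixes e d :: "real \<Rightarrow> real"
  assumes C: "0 \<le> C" and D: "0 \<le> D" and e0: "e a = 0"
    and der: "\<And>t. t \<in> {a..b} \<Longrightarrow> (e has_real_derivative d t) (at t within {a..b})"
    and cd: "continuous_on {a..b} d"
    and le: "\<And>t. t \<in> {a..b} \<Longrightarrow> \<bar>d t\<bar> \<le> C * \<bar>e t\<bar> + D"
    and t: "t \<in> {a..b}"
  shows "\<bar>e t\<bar> \<le> 2 * (b - a) * exp ((2 * C + 1) * (b - a)) * D"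
proof -
  define K where "K = 2 * C + 1"
  have K: "K > 0" using C by (simp add: K_def)
  have ce: "continuous_on {a..b} e"
    using der by (rule DERIV_continuous_on)
  have "continuous_on {a..b} (\<lambda>t. exp (- (K * (t - a))) * \<bar>e t\<bar>)"
    by (intro continuous_intros ce)
  from continuous_attains_sup[OF _ _ this] t obtain t0 where t0: "t0 \<in> {a..b}"
    and mx: "\<And>t. t \<in> {a..b} \<Longrightarrow> exp (- (K * (t - a))) * \<bar>e t\<bar> \<le> exp (- (K * (t0 - a))) * \<bar>e t0\<bar>"
    by fastforce
  define m where "m = exp (- (K * (t0 - a))) * \<bar>e t0\<bar>"
  have em: "\<bar>e t\<bar> \<le> exp (K * (t - a)) * m" if "t \<in> {a..b}" for t
  proof -
    have "exp (K * (t - a)) * (exp (- (K * (t - a))) * \<bar>e t\<bar>) \<le> exp (K * (t - a)) * m"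
      using mx[OF that] unfolding m_def by (rule mult_left_mono) simp
    then show ?thesis by (simp add: mult.assoc[symmetric] exp_add[symmetric])
  qed
  have "(d has_integral e t0 - e a) {a..t0}"
    using t0 by (intro fundamental_theorem_of_calculus)
      (auto simp: has_real_derivative_iff_has_vector_derivative[symmetric] intro!: DERIV_subset[OF der])
  then have et0: "e t0 = integral {a..t0} d" using e0 by (simp add: integral_unique)
  have "m \<le> m / 2 + D * (t0 - a)"
    unfolding m_def et0
  proof (rule weighted_integral_bound[OF _ _ C _ D K_def])
    show "continuous_on {a..t0} d" using t0 by (intro continuous_on_subset[OF cd]) auto
    fix \<tau> assume "\<tau> \<in> {a..t0}"
    then have \<tau>: "\<tau> \<in> {a..b}" using t0 by auto
    have "C * \<bar>e \<tau>\<bar> \<le> C * (exp (K * (\<tau> - a)) * m)" using em[OF \<tau>] C by (rule mult_left_mono)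
    then show "\<bar>d \<tau>\<bar> \<le> C * (exp (K * (\<tau> - a)) * (exp (- (K * (t0 - a))) * \<bar>integral {a..t0} d\<bar>)) + D"
      using le[OF \<tau>] unfolding m_def et0 by linarith
  qed (use t0 in auto)
  also have "D * (t0 - a) \<le> D * (b - a)" using t0 D by (intro mult_left_mono) auto
  finally have m: "m \<le> 2 * (b - a) * D" by (simp add: algebra_simps)
  have "\<bar>e t\<bar> \<le> exp (K * (b - a)) * m"
    using em[OF t] t K by (rule_tac order_trans) (auto intro!: mult_right_mono simp: m_def)
  also have "\<dots> \<le> exp (K * (b - a)) * (2 * (b - a) * D)"
    using m by (intro mult_left_mono) auto
  finally show ?thesis by (simp add: K_def mult_ac)
qed

text \<open>To first order the deviation \<open>w - z\<close> solves
  \<open>e' = A * e + \<epsilon> * B\<close>. With the integrating factor \<mu> the terms in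
  \<open>A\<close> cancel, so the difference estimated in the conclusion has a derivative made of
  the remainder alone. Existence of \<open>w\<close> is part of the claim, because \<open>f\<close>
  is controlled only near \<open>z\<close>.\<close>

theorem perturbed_ode:
  fixes f :: "real \<Rightarrow> real \<Rightarrow> real \<Rightarrow> real"
  assumes z: "\<And>t. t \<in> {a..b} \<Longrightarrow> (z has_real_derivative f 0 t (z t)) (at t within {a..b})"
    and pos: "0 < \<rho>" "0 < \<epsilon>0" "0 \<le> C"
    and cont: "\<And>\<epsilon>. \<bar>\<epsilon>\<bar> \<le> \<epsilon>0 \<Longrightarrow>
      continuous_on {(t, r). t \<in> {a..b} \<and> \<bar>r - z t\<bar> \<le> \<rho>} (\<lambda>(t, r). f \<epsilon> t r)"
    and lip: "\<And>\<epsilon> t r r'. \<bar>\<epsilon>\<bar> \<le> \<epsilon>0 \<Longrightarrow> t \<in> {a..b} \<Longrightarrow> \<bar>r - z t\<bar> \<le> \<rho> \<Longrightarrow> \<bar>r' - z t\<bar> \<le> \<rho> \<Longrightarrow>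
      \<bar>f \<epsilon> t r - f \<epsilon> t r'\<bar> \<le> C * \<bar>r - r'\<bar>"
    and A: "continuous_on {a..b} A" and B: "continuous_on {a..b} B"
    and diff: "\<And>\<eta>. \<eta> > 0 \<Longrightarrow> \<exists>\<delta>>0. \<forall>\<epsilon> t r. \<bar>\<epsilon>\<bar> \<le> \<delta> \<longrightarrow> t \<in> {a..b} \<longrightarrow> \<bar>r - z t\<bar> \<le> \<delta> \<longrightarrow>
      \<bar>f \<epsilon> t r - f 0 t (z t) - \<epsilon> * B t - (r - z t) * A t\<bar> \<le> \<eta> * (\<bar>\<epsilon>\<bar> + \<bar>r - z t\<bar>)"
    and T: "T \<in> {a..b}" and \<eta>: "\<eta> > 0"
  defines "\<mu> \<equiv> \<lambda>t. exp (- integral {a..t} A)"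
  shows "\<exists>\<delta>>0. \<forall>\<epsilon>. \<bar>\<epsilon>\<bar> \<le> \<delta> \<longrightarrow> (\<exists>w. w a = z a \<and>
    (\<forall>t\<in>{a..b}. (w has_real_derivative f \<epsilon> t (w t)) (at t within {a..b})) \<and>
    \<bar>\<mu> T * (w T - z T) - \<epsilon> * integral {a..T} (\<lambda>t. \<mu> t * B t)\<bar> \<le> \<eta> * \<bar>\<epsilon>\<bar>)"
proof -
  let ?I = "{a..b}"
  have ab: "a \<le> b" using T by simp
  have cz: "continuous_on ?I z" using z by (rule DERIV_continuous_on)
  have c\<mu>: "continuous_on ?I \<mu>"
    unfolding \<mu>_def by (intro continuous_intros indefinite_integral_continuous_1
        integrable_continuous_real A)
  have "bounded (A ` ?I)" "bounded (B ` ?I)" "bounded (\<mu> ` ?I)"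
    by (intro compact_imp_bounded compact_continuous_image A B c\<mu> compact_Icc)+
  then obtain Am Bm Mm where Am: "0 < Am" "\<And>t. t \<in> ?I \<Longrightarrow> \<bar>A t\<bar> \<le> Am"
    and Bm: "0 < Bm" "\<And>t. t \<in> ?I \<Longrightarrow> \<bar>B t\<bar> \<le> Bm" and Mm: "0 < Mm" "\<And>t. t \<in> ?I \<Longrightarrow> \<bar>\<mu> t\<bar> \<le> Mm"
    unfolding bounded_pos by auto
  obtain \<delta>1 where \<delta>1: "\<delta>1 > 0" "\<And>\<epsilon> t r. \<bar>\<epsilon>\<bar> \<le> \<delta>1 \<Longrightarrow> t \<in> ?I \<Longrightarrow> \<bar>r - z t\<bar> \<le> \<delta>1 \<Longrightarrow>
      \<bar>f \<epsilon> t r - f 0 t (z t) - \<epsilon> * B t - (r - z t) * A t\<bar> \<le> 1 * (\<bar>\<epsilon>\<bar> + \<bar>r - z t\<bar>)"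
    using diff[of 1] by force
  \<comment> \<open>In this tube both the Lipschitz condition and the first-order estimate are
    available.\<close>
  define \<rho>1 where "\<rho>1 = min \<rho> \<delta>1"
  have \<rho>1: "0 < \<rho>1" "\<rho>1 \<le> \<rho>" "\<rho>1 \<le> \<delta>1" using pos \<delta>1 by (auto simp: \<rho>1_def)
  have growth: "\<bar>f \<epsilon> t r - f 0 t (z t)\<bar> \<le> (Am + 1) * \<bar>r - z t\<bar> + (Bm + 1) * \<bar>\<epsilon>\<bar>"
    if "\<bar>\<epsilon>\<bar> \<le> \<delta>1" "t \<in> ?I" "\<bar>r - z t\<bar> \<le> \<rho>1" for \<epsilon> t r
  proof -
    have "\<bar>\<epsilon> * B t\<bar> \<le> Bm * \<bar>\<epsilon>\<bar>" "\<bar>(r - z t) * A t\<bar> \<le> Am * \<bar>r - z t\<bar>"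
      using Am(2)[OF that(2)] Bm(2)[OF that(2)] by (simp_all add: abs_mult mult.commute[of "\<bar>\<epsilon>\<bar>"]
          mult.commute[of "\<bar>r - z t\<bar>"] mult_right_mono)
    moreover have "\<bar>f \<epsilon> t r - f 0 t (z t) - \<epsilon> * B t - (r - z t) * A t\<bar> \<le> 1 * (\<bar>\<epsilon>\<bar> + \<bar>r - z t\<bar>)"
      using that \<rho>1 by (intro \<delta>1(2)) auto
    ultimately have "\<bar>f \<epsilon> t r - f 0 t (z t)\<bar> \<le> \<bar>\<epsilon>\<bar> + \<bar>r - z t\<bar> + Bm * \<bar>\<epsilon>\<bar> + Am * \<bar>r - z t\<bar>"
      by (smt (verit))
    then show ?thesis by (simp add: algebra_simps)
  qed
  \<comment> \<open>Clamping the deviation makes the right-hand side globally Lipschitz; it has no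
    effect once the solution is known to stay in the tube.\<close>
  define cl where "cl = (\<lambda>y. max (-\<rho>1) (min \<rho>1 y))"
  have cl: "\<bar>cl y\<bar> \<le> \<rho>1" "\<bar>cl y\<bar> \<le> \<bar>y\<bar>" "\<bar>cl y - cl y'\<bar> \<le> \<bar>y - y'\<bar>" "\<bar>y\<bar> \<le> \<rho>1 \<Longrightarrow> cl y = y" for y y'
    using \<rho>1(1) by (auto simp: cl_def)
  \<comment> \<open>The constant of \<open>derivative_bound_growth\<close> for the rate
    \<open>Am + 1\<close> and the forcing \<open>(Bm + 1) * \<bar>\<epsilon>\<bar>\<close>.\<close>
  define Q where "Q = 2 * (b - a) * exp ((2 * (Am + 1) + 1) * (b - a)) * (Bm + 1)"
  have Q: "Q \<ge> 0" using ab Bm by (simp add: Q_def)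
  have main: "\<exists>w. w a = z a \<and> (\<forall>t\<in>?I. (w has_real_derivative f \<epsilon> t (w t)) (at t within ?I))
      \<and> (\<forall>t\<in>?I. \<bar>w t - z t\<bar> \<le> Q * \<bar>\<epsilon>\<bar>)"
    if e: "\<bar>\<epsilon>\<bar> \<le> \<epsilon>0" "\<bar>\<epsilon>\<bar> \<le> \<delta>1" "Q * \<bar>\<epsilon>\<bar> \<le> \<rho>1" for \<epsilon>
  proof -
    define F where "F = (\<lambda>t r. f \<epsilon> t (z t + cl (r - z t)))"
    have cF: "continuous_on (?I \<times> UNIV) (\<lambda>(t, r). F t r)"
    proof -
      have "continuous_on (?I \<times> UNIV) (\<lambda>p. (\<lambda>(t, r). f \<epsilon> t r) (fst p, z (fst p) + cl (snd p - z (fst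
          p))))"
      proof (rule continuous_on_compose2[OF cont[OF e(1)]])
        have "continuous_on (?I \<times> (UNIV :: real set)) (\<lambda>p. z (fst p))"
          by (rule continuous_on_compose2[OF cz]) (auto intro!: continuous_intros)
        then show "continuous_on (?I \<times> UNIV) (\<lambda>p. (fst p, z (fst p) + cl (snd p - z (fst p))))"
          unfolding cl_def by (intro continuous_intros)
        have "\<bar>cl y\<bar> \<le> \<rho>" for y using cl(1)[of y] \<rho>1 by linarith
        then show "(\<lambda>p. (fst p, z (fst p) + cl (snd p - z (fst p)))) ` (?I \<times> UNIV)
            \<subseteq> {(t, r). t \<in> ?I \<and> \<bar>r - z t\<bar> \<le> \<rho>}"
          by auto
      qed
      then show ?thesis by (simp add: F_def split_beta)
    qed
    have lF: "\<bar>F t r - F t r'\<bar> \<le> C * \<bar>r - r'\<bar>" if "t \<in> ?I" for t r r'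
    proof -
      have "\<bar>F t r - F t r'\<bar> \<le> C * \<bar>(z t + cl (r - z t)) - (z t + cl (r' - z t))\<bar>"
        unfolding F_def using cl(1)[of "r - z t"] cl(1)[of "r' - z t"] \<rho>1 by (intro lip[OF e(1)
            that]) auto
      also have "\<dots> \<le> C * \<bar>r - r'\<bar>"
        using cl(3)[of "r - z t" "r' - z t"] pos(3) by (intro mult_left_mono) auto
      finally show ?thesis .
    qed
    obtain w where w: "w a = z a" "\<And>t. t \<in> ?I \<Longrightarrow> (w has_real_derivative F t (w t)) (at t within ?I)"
      using global_solution_Lipschitz[OF ab pos(3) cF lF, of "z a"] by blast
    have cw: "continuous_on ?I w" using w(2) by (rule DERIV_continuous_on)
    have cz0: "continuous_on ?I (\<lambda>t. f 0 t (z t))"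
    proof -
      have "continuous_on ?I (\<lambda>t. (\<lambda>(t, r). f 0 t r) (t, z t))"
        by (rule continuous_on_compose2[OF cont[of 0]]) (use pos cz in \<open>auto intro!: continuous_intros\<close>)
      then show ?thesis by simp
    qed
    have cFw: "continuous_on ?I (\<lambda>t. F t (w t))"
    proof -
      have "continuous_on ?I (\<lambda>t. (\<lambda>(t, r). F t r) (t, w t))"
        by (rule continuous_on_compose2[OF cF]) (use cw in \<open>auto intro!: continuous_intros\<close>)
      then show ?thesis by simp
    qed
    have est: "\<bar>w t - z t\<bar> \<le> Q * \<bar>\<epsilon>\<bar>" if "t \<in> ?I" for t
    proof -
      have "\<bar>w t - z t\<bar> \<le> 2 * (b - a) * exp ((2 * (Am + 1) + 1) * (b - a)) * ((Bm + 1) * \<bar>\<epsilon>\<bar>)"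
      proof (rule derivative_bound_growth[where e = "\<lambda>t. w t - z t" and d = "\<lambda>t. F t (w t) - f 0 t
          (z t)"])
        show "continuous_on ?I (\<lambda>t. F t (w t) - f 0 t (z t))"
          by (intro continuous_intros cFw cz0)
        fix t assume t: "t \<in> ?I"
        show "((\<lambda>t. w t - z t) has_real_derivative F t (w t) - f 0 t (z t)) (at t within ?I)"
          by (intro DERIV_diff w(2) z t)
        have "\<bar>F t (w t) - f 0 t (z t)\<bar> \<le> (Am + 1) * \<bar>cl (w t - z t)\<bar> + (Bm + 1) * \<bar>\<epsilon>\<bar>"
          unfolding F_def using growth[OF e(2) t, of "z t + cl (w t - z t)"] cl(1)[of "w t - z t"]
              by simp
        also have "\<dots> \<le> (Am + 1) * \<bar>w t - z t\<bar> + (Bm + 1) * \<bar>\<epsilon>\<bar>"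
          using cl(2) Am(1) by (intro add_right_mono mult_left_mono) auto
        finally show "\<bar>F t (w t) - f 0 t (z t)\<bar> \<le> (Am + 1) * \<bar>w t - z t\<bar> + (Bm + 1) * \<bar>\<epsilon>\<bar>" .
      qed (use Am Bm w that in auto)
      then show ?thesis by (simp add: Q_def mult_ac)
    qed
    have "F t (w t) = f \<epsilon> t (w t)" if "t \<in> ?I" for t
      using cl(4)[of "w t - z t"] est[OF that] e(3) by (simp add: F_def)
    then show ?thesis using w est by (intro exI[of _ w]) auto
  qed
  \<comment> \<open>Along \<open>w\<close> the remainder is at most
    \<open>\<eta>' * (1 + Q) * \<bar>\<epsilon>\<bar>\<close>; it is multiplied by \<mu> and
    integrated over a length of at most \<open>b - a\<close>. The added 1 keeps the denominator
    positive.\<close>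
  define \<eta>' where "\<eta>' = \<eta> / (Mm * (1 + Q) * (b - a) + 1)"
  have dpos: "0 < Mm * (1 + Q) * (b - a) + 1" using Mm Q ab by (intro add_nonneg_pos
      mult_nonneg_nonneg) auto
  have \<eta>': "\<eta>' > 0" using \<eta> dpos by (simp add: \<eta>'_def)
  obtain \<delta>2 where \<delta>2: "\<delta>2 > 0" "\<And>\<epsilon> t r. \<bar>\<epsilon>\<bar> \<le> \<delta>2 \<Longrightarrow> t \<in> ?I \<Longrightarrow> \<bar>r - z t\<bar> \<le> \<delta>2 \<Longrightarrow>
      \<bar>f \<epsilon> t r - f 0 t (z t) - \<epsilon> * B t - (r - z t) * A t\<bar> \<le> \<eta>' * (\<bar>\<epsilon>\<bar> + \<bar>r - z t\<bar>)"
    using diff[OF \<eta>'] by force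
  \<comment> \<open>The quotients by \<open>Q + 1\<close> keep the deviation
    \<open>Q * \<bar>\<epsilon>\<bar>\<close> inside the tube and inside the range of the sharper
    estimate.\<close>
  define \<delta> where "\<delta> = Min {\<epsilon>0, \<delta>1, \<delta>2, \<rho>1 / (Q + 1), \<delta>2 / (Q + 1)}"
  have \<delta>: "\<delta> > 0" using pos \<delta>1 \<delta>2 \<rho>1 Q by (simp add: \<delta>_def)
  show ?thesis
  proof (intro exI[of _ \<delta>] conjI \<delta> allI impI)
    fix \<epsilon> assume e: "\<bar>\<epsilon>\<bar> \<le> \<delta>"
    have le: "\<bar>\<epsilon>\<bar> \<le> \<epsilon>0" "\<bar>\<epsilon>\<bar> \<le> \<delta>1" "\<bar>\<epsilon>\<bar> \<le> \<delta>2" "\<bar>\<epsilon>\<bar> \<le> \<rho>1 / (Q + 1)" "\<bar>\<epsilon>\<bar> \<le> \<delta>2 / (Q + 1)"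
      using e by (auto simp: \<delta>_def)
    have "(Q + 1) * \<bar>\<epsilon>\<bar> \<le> \<rho>1" "(Q + 1) * \<bar>\<epsilon>\<bar> \<le> \<delta>2"
      using le(4,5) Q by (simp_all add: field_simps)
    then have Qe: "Q * \<bar>\<epsilon>\<bar> \<le> \<rho>1" "Q * \<bar>\<epsilon>\<bar> \<le> \<delta>2"
      by (simp_all add: algebra_simps)
    from main[OF le(1,2) Qe(1)] obtain w where w: "w a = z a"
      "\<And>t. t \<in> ?I \<Longrightarrow> (w has_real_derivative f \<epsilon> t (w t)) (at t within ?I)"
      "\<And>t. t \<in> ?I \<Longrightarrow> \<bar>w t - z t\<bar> \<le> Q * \<bar>\<epsilon>\<bar>" by blast
    define g where "g = (\<lambda>t. \<mu> t * (w t - z t) - \<epsilon> * integral {a..t} (\<lambda>t. \<mu> t * B t))"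
    define g' where "g' = (\<lambda>t. \<mu> t * (f \<epsilon> t (w t) - f 0 t (z t) - \<epsilon> * B t - (w t - z t) * A t))"
    have gd: "(g has_real_derivative g' t) (at t within ?I)" if t: "t \<in> ?I" for t
    proof -
      have d\<mu>: "(\<mu> has_real_derivative - (\<mu> t * A t)) (at t within ?I)"
        unfolding \<mu>_def using integral_has_real_derivative[OF A t] by (auto intro!:
            derivative_eq_intros)
      have "continuous_on ?I (\<lambda>t. \<mu> t * B t)" by (intro continuous_intros c\<mu> B)
      from integral_has_real_derivative[OF this t] d\<mu> w(2)[OF t] z[OF t] show ?thesis
        unfolding g_def g'_def by (auto intro!: derivative_eq_intros simp: algebra_simps)
    qed
    have gb: "norm (g' t) \<le> Mm * (\<eta>' * ((1 + Q) * \<bar>\<epsilon>\<bar>))" if t: "t \<in> ?I" for t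
    proof -
      have "\<bar>f \<epsilon> t (w t) - f 0 t (z t) - \<epsilon> * B t - (w t - z t) * A t\<bar> \<le> \<eta>' * (\<bar>\<epsilon>\<bar> + \<bar>w t - z t\<bar>)"
        using w(3)[OF t] Qe(2) by (intro \<delta>2(2) le(3) t) auto
      also have "\<dots> \<le> \<eta>' * ((1 + Q) * \<bar>\<epsilon>\<bar>)"
        using w(3)[OF t] \<eta>' by (intro mult_left_mono) (auto simp: algebra_simps)
      finally show ?thesis
        using Mm(2)[OF t] Mm(1) unfolding g'_def by (simp add: abs_mult mult_mono)
    qed
    have "norm (g T - g a) \<le> Mm * (\<eta>' * ((1 + Q) * \<bar>\<epsilon>\<bar>)) * norm (T - a)"
      using T ab by (intro field_differentiable_bound[of ?I g g'] gd gb) auto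
    also have "g a = 0" by (simp add: g_def w(1))
    also have "Mm * (\<eta>' * ((1 + Q) * \<bar>\<epsilon>\<bar>)) * norm (T - a) \<le> Mm * (\<eta>' * ((1 + Q) * \<bar>\<epsilon>\<bar>)) * (b - a)"
      using T Mm \<eta>' Q by (intro mult_left_mono mult_nonneg_nonneg) auto
    also have "\<dots> = \<eta>' * (Mm * (1 + Q) * (b - a)) * \<bar>\<epsilon>\<bar>" by (simp add: mult_ac)
    also have "\<dots> \<le> \<eta>' * (Mm * (1 + Q) * (b - a) + 1) * \<bar>\<epsilon>\<bar>"
      using \<eta>' by (intro mult_right_mono mult_left_mono) auto
    also have "\<dots> = \<eta> * \<bar>\<epsilon>\<bar>" using dpos by (simp add: \<eta>'_def)
    finally have "\<bar>\<mu> T * (w T - z T) - \<epsilon> * integral {a..T} (\<lambda>t. \<mu> t * B t)\<bar> \<le> \<eta> * \<bar>\<epsilon>\<bar>"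
      by (simp add: g_def)
    then show "\<exists>w. w a = z a \<and> (\<forall>t\<in>?I. (w has_real_derivative f \<epsilon> t (w t)) (at t within ?I)) \<and>
        \<bar>\<mu> T * (w T - z T) - \<epsilon> * integral {a..T} (\<lambda>t. \<mu> t * B t)\<bar> \<le> \<eta> * \<bar>\<epsilon>\<bar>"
      using w by blast
  qed
qed

section \<open>Adjoints of the combined operators\<close>

text \<open>\<open>comb_int\<close> is the combined Caputo derivative as an operator on the derivative of a function,
  \<open>dual_int\<close> its formal adjoint with respect to integration over \<open>[lo, c]\<close>.\<close>

definition comb_int :: "real \<Rightarrow> real \<Rightarrow> real \<times> real \<Rightarrow> (real \<Rightarrow> real \<Rightarrow> real) \<Rightarrow>
    (real \<Rightarrow> real \<Rightarrow> real) \<Rightarrow> (real \<Rightarrow> real) \<Rightarrow> real \<Rightarrow> real" where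
  "comb_int lo hi \<gamma> \<alpha> \<beta> g u = fst \<gamma> * frac_left lo \<alpha> g u - snd \<gamma> * frac_right hi \<beta> g u"

definition dual_int :: "real \<Rightarrow> real \<Rightarrow> real \<times> real \<Rightarrow> (real \<Rightarrow> real \<Rightarrow> real) \<Rightarrow>
    (real \<Rightarrow> real \<Rightarrow> real) \<Rightarrow> (real \<Rightarrow> real) \<Rightarrow> real \<Rightarrow> real" where
  "dual_int lo c \<gamma> \<alpha> \<beta> f v =
     fst \<gamma> * frac_right c \<alpha> f v - snd \<gamma> * (frac_left lo \<beta> f v - frac_left c \<beta> f v)"

lemma frac_left_cong:
  "(\<And>v. v \<in> {c..u} \<Longrightarrow> f v = g v) \<Longrightarrow> frac_left c \<delta> f u = frac_left c \<delta> g u"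
  unfolding frac_left_def by (rule integral_cong) simp

lemma frac_right_cong:
  "(\<And>v. v \<in> {u..c} \<Longrightarrow> f v = g v) \<Longrightarrow> frac_right c \<delta> f u = frac_right c \<delta> g u"
  unfolding frac_right_def by (rule integral_cong) simp

lemma comb_int_cong:
  assumes "u \<in> {lo..hi}" "\<And>v. v \<in> {lo..hi} \<Longrightarrow> f v = g v"
  shows "comb_int lo hi \<gamma> \<alpha> \<beta> f u = comb_int lo hi \<gamma> \<alpha> \<beta> g u"
proof -
  have "frac_left lo \<alpha> f u = frac_left lo \<alpha> g u" "frac_right hi \<beta> f u = frac_right hi \<beta> g u"
    using assms by (auto intro!: frac_left_cong frac_right_cong)
  then show ?thesis by (simp add: comb_int_def)
qed

lemma comb_int_linear:
  assumes "admissible_order lo hi \<alpha>" "admissible_order lo hi \<beta>" "u \<in> {lo..hi}"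
    and "continuous_on {lo..hi} f" "continuous_on {lo..hi} g"
  shows "comb_int lo hi \<gamma> \<alpha> \<beta> (\<lambda>v. f v + \<epsilon> * g v) u
    = comb_int lo hi \<gamma> \<alpha> \<beta> f u + \<epsilon> * comb_int lo hi \<gamma> \<alpha> \<beta> g u"
proof -
  have lo: "lo \<in> {lo..hi}" "hi \<in> {lo..hi}" using assms(3) by auto
  have "frac_left lo \<alpha> (\<lambda>v. f v + \<epsilon> * g v) u = frac_left lo \<alpha> f u + \<epsilon> * frac_left lo \<alpha> g u"
    using integral_add[OF frac_left_integrable[OF assms(1,4) lo(1) assms(3)]
        integrable_cmul[OF frac_left_integrable[OF assms(1,5) lo(1) assms(3)], of \<epsilon>]]
    by (simp add: frac_left_def distrib_left mult.left_commute)
  moreover have "frac_right hi \<beta> (\<lambda>v. f v + \<epsilon> * g v) u = frac_right hi \<beta> f u + \<epsilon> * frac_right hi \<beta> g u"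
    using integral_add[OF frac_right_integrable[OF assms(2,4) lo(2) assms(3)]
        integrable_cmul[OF frac_right_integrable[OF assms(2,5) lo(2) assms(3)], of \<epsilon>]]
    by (simp add: frac_right_def distrib_left mult.left_commute)
  ultimately show ?thesis by (simp add: comb_int_def algebra_simps)
qed

lemma continuous_on_comb_int:
  fixes f :: "real \<Rightarrow> 'b::topological_space \<Rightarrow> real"
  assumes "admissible_order lo hi \<alpha>" "admissible_order lo hi \<beta>" "lo \<le> hi" "compact Y"
    and "continuous_on ({lo..hi} \<times> Y) (\<lambda>(v, y). f v y)"
  shows "continuous_on ({lo..hi} \<times> Y) (\<lambda>(u, y). comb_int lo hi \<gamma> \<alpha> \<beta> (\<lambda>v. f v y) u)"
proof -
  have "continuous_on ({lo..hi} \<times> Y) (\<lambda>p. frac_left lo \<alpha> (\<lambda>v. f v (snd p)) (fst p))"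
      "continuous_on ({lo..hi} \<times> Y) (\<lambda>p. frac_right hi \<beta> (\<lambda>v. f v (snd p)) (fst p))"
    using continuous_on_frac_left[OF assms(1) _ assms(4,5), of lo] assms(3)
      continuous_on_frac_right[OF assms(2) _ assms(4,5), of hi] by (simp_all add: split_beta)
  then show ?thesis
    unfolding comb_int_def split_beta by (intro continuous_on_diff continuous_on_mult
        continuous_on_const)
qed

lemma continuous_on_dual_int:
  fixes f :: "real \<Rightarrow> 'b::topological_space \<Rightarrow> real"
  assumes "admissible_order lo hi \<alpha>" "admissible_order lo hi \<beta>" "c \<in> {lo..hi}" "compact Y"
    and "continuous_on ({lo..hi} \<times> Y) (\<lambda>(v, y). f v y)"
  shows "continuous_on ({lo..hi} \<times> Y) (\<lambda>(u, y). dual_int lo c \<gamma> \<alpha> \<beta> (\<lambda>v. f v y) u)"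
proof -
  have "continuous_on ({lo..hi} \<times> Y) (\<lambda>p. frac_left lo \<beta> (\<lambda>v. f v (snd p)) (fst p))"
      "continuous_on ({lo..hi} \<times> Y) (\<lambda>p. frac_left c \<beta> (\<lambda>v. f v (snd p)) (fst p))"
      "continuous_on ({lo..hi} \<times> Y) (\<lambda>p. frac_right c \<alpha> (\<lambda>v. f v (snd p)) (fst p))"
    using continuous_on_frac_left[OF assms(2) _ assms(4,5), of lo] assms(3)
      continuous_on_frac_left[OF assms(2) assms(3-5)]
      continuous_on_frac_right[OF assms(1) assms(3-5)] by (simp_all add: split_beta)
  then show ?thesis
    unfolding dual_int_def split_beta by (intro continuous_on_diff continuous_on_mult
        continuous_on_const)
qed

lemma continuous_on_frac_left_1:
  assumes "admissible_order lo hi \<delta>" "c \<in> {lo..hi}" "continuous_on {lo..hi} f"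
  shows "continuous_on {lo..hi} (frac_left c \<delta> f)"
proof -
  have "continuous_on {lo..hi} (\<lambda>u. integral {c..hi} (\<lambda>v. sing_kernel \<delta> u v * f v))"
    using assms by (intro continuous_on_weakly_singular_1 weakly_singular_sing_kernel) auto
  then show ?thesis
    by (rule continuous_on_eq) (simp add: frac_left_eq[OF assms(2)])
qed

lemma continuous_on_frac_right_1:
  assumes "admissible_order lo hi \<delta>" "c \<in> {lo..hi}" "continuous_on {lo..hi} f"
  shows "continuous_on {lo..hi} (frac_right c \<delta> f)"
proof -
  have "continuous_on {lo..hi} (\<lambda>u. integral {lo..c} (\<lambda>v. sing_kernel \<delta> v u * f v))"
    using assms
    by (intro continuous_on_weakly_singular_1[OF weakly_singular_swap[OF
        weakly_singular_sing_kernel]]) auto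
  then show ?thesis
    by (rule continuous_on_eq) (simp add: frac_right_eq[OF assms(2)])
qed

lemma comb_int_by_parts:
  assumes ord: "admissible_order lo hi \<alpha>" "admissible_order lo hi \<beta>" and c: "c \<in> {lo..hi}"
    and f: "continuous_on {lo..hi} f" and p: "continuous_on {lo..hi} p"
  shows "integral {lo..c} (\<lambda>u. f u * comb_int lo hi \<gamma> \<alpha> \<beta> p u)
    = integral {lo..hi} (\<lambda>v. p v * dual_int lo c \<gamma> \<alpha> \<beta> f v)"
proof -
  have lohi: "lo \<le> hi" "lo \<in> {lo..hi}" "hi \<in> {lo..hi}" using c by auto
  have sub: "{lo..c} \<subseteq> {lo..hi}" using c by auto
  have i1: "(\<lambda>u. fst \<gamma> * (f u * frac_left lo \<alpha> p u)) integrable_on {lo..c}"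
      "(\<lambda>u. snd \<gamma> * (f u * frac_right hi \<beta> p u)) integrable_on {lo..c}"
    by (intro integrable_continuous_real continuous_on_subset[OF _ sub] continuous_on_mult
        continuous_on_const
          f continuous_on_frac_left_1[OF ord(1) lohi(2) p] continuous_on_frac_right_1[OF ord(2)
              lohi(3) p])+
  have i2: "(\<lambda>v. fst \<gamma> * (p v * frac_right c \<alpha> f v)) integrable_on {lo..hi}"
      "(\<lambda>v. snd \<gamma> * (p v * (frac_left lo \<beta> f v - frac_left c \<beta> f v))) integrable_on {lo..hi}"
    by (intro integrable_continuous_real continuous_on_mult continuous_on_const continuous_on_diff
          p continuous_on_frac_left_1[OF ord(2) lohi(2) f] continuous_on_frac_left_1[OF ord(2) c f]
          continuous_on_frac_right_1[OF ord(1) c f])+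
  have "integral {lo..c} (\<lambda>u. f u * comb_int lo hi \<gamma> \<alpha> \<beta> p u)
      = integral {lo..c} (\<lambda>u. fst \<gamma> * (f u * frac_left lo \<alpha> p u) - snd \<gamma> * (f u * frac_right hi \<beta> p u))"
    by (simp add: comb_int_def algebra_simps)
  also have "\<dots> = fst \<gamma> * integral {lo..c} (\<lambda>u. f u * frac_left lo \<alpha> p u)
      - snd \<gamma> * integral {lo..c} (\<lambda>u. f u * frac_right hi \<beta> p u)"
    using integral_diff[OF i1] by simp
  also have "\<dots> = fst \<gamma> * integral {lo..hi} (\<lambda>v. p v * frac_right c \<alpha> f v)
      - snd \<gamma> * integral {lo..hi} (\<lambda>v. p v * (frac_left lo \<beta> f v - frac_left c \<beta> f v))"
    by (simp only: frac_left_by_parts[OF ord(1) c f p] frac_right_by_parts[OF ord(2) c f p])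
  also have "\<dots> = integral {lo..hi} (\<lambda>v. fst \<gamma> * (p v * frac_right c \<alpha> f v)
      - snd \<gamma> * (p v * (frac_left lo \<beta> f v - frac_left c \<beta> f v)))"
    using integral_diff[OF i2] by simp
  also have "\<dots> = integral {lo..hi} (\<lambda>v. p v * dual_int lo c \<gamma> \<alpha> \<beta> f v)"
    by (simp add: dual_int_def algebra_simps)
  finally show ?thesis .
qed

section \<open>Gradients along curves, and Caputo derivatives of functions with a given
  derivative\<close>

lemma has_real_derivative_along:
  fixes f :: "'a::real_inner \<Rightarrow> real"
  assumes "\<And>p. p \<in> S \<Longrightarrow> (f has_derivative (\<lambda>v. v \<bullet> G p)) (at p within S)"
    and "(g has_vector_derivative e) (at \<sigma> within I)" "g ` I \<subseteq> S" "\<sigma> \<in> I"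
  shows "((\<lambda>\<sigma>. f (g \<sigma>)) has_real_derivative e \<bullet> G (g \<sigma>)) (at \<sigma> within I)"
proof -
  have "((\<lambda>\<sigma>. f (g \<sigma>)) has_derivative (\<lambda>y. (y *\<^sub>R e) \<bullet> G (g \<sigma>))) (at \<sigma> within I)"
    by (rule has_derivative_in_compose2[OF assms(1,3,4) assms(2)[unfolded has_vector_derivative_def]])
  then show ?thesis
    by (simp add: has_field_derivative_def mult_commute_abs)
qed

text \<open>The gradient vector is recovered by evaluating the derivative on the basis; unlike the
  operator-valued derivative it splits into components that the one-dimensional operators can act
  on.\<close>

lemma C1_on_gradient:
  fixes f :: "'a::euclidean_space \<Rightarrow> real"
  assumes "C1_on S f"
  obtains G where "continuous_on S G" "\<And>p. p \<in> S \<Longrightarrow> (f has_derivative (\<lambda>v. v \<bullet> G p)) (at p within S)"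
proof -
  from assms obtain f' where f': "\<And>p. p \<in> S \<Longrightarrow> (f has_derivative blinfun_apply (f' p)) (at p within S)"
    and c: "continuous_on S f'" unfolding C1_on_def by blast
  define G where "G = (\<lambda>p. \<Sum>b\<in>Basis. blinfun_apply (f' p) b *\<^sub>R b)"
  have "blinfun_apply (f' p) = (\<lambda>v. v \<bullet> G p)" for p
  proof
    fix v
    have "blinfun_apply (f' p) v = blinfun_apply (f' p) (\<Sum>b\<in>Basis. (v \<bullet> b) *\<^sub>R b)"
      by (simp add: euclidean_representation)
    also have "\<dots> = v \<bullet> G p"
      by (simp add: G_def blinfun.sum_right blinfun.scaleR_right inner_sum_right mult.commute)
    finally show "blinfun_apply (f' p) v = v \<bullet> G p" .
  qed
  moreover have "continuous_on S G"
    unfolding G_def by (intro continuous_intros c)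
  ultimately show ?thesis using f' that by metis
qed

lemma C1_onI_gradient:
  fixes f :: "'a::euclidean_space \<Rightarrow> real"
  assumes "continuous_on S G" "\<And>p. p \<in> S \<Longrightarrow> (f has_derivative (\<lambda>v. v \<bullet> G p)) (at p within S)"
  shows "C1_on S f"
  unfolding C1_on_def
proof (intro exI[of _ "\<lambda>p. blinfun_inner_left (G p)"] conjI ballI)
  show "continuous_on S (\<lambda>p. blinfun_inner_left (G p))"
    by (rule bounded_linear.continuous_on[OF bounded_linear_blinfun_inner_left assms(1)])
  show "(f has_derivative blinfun_apply (blinfun_inner_left (G p))) (at p within S)" if "p \<in> S" for p
    using assms(2)[OF that] by (rule has_derivative_eq_rhs) (simp add: fun_eq_iff)
qed

lemma deriv_on_eq:
  assumes "lo < hi" "u \<in> {lo..hi}" "(f has_real_derivative d) (at u within {lo..hi})"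
  shows "deriv_on lo hi f u = d"
  unfolding deriv_on_def
  using vector_derivative_within_cbox[OF assms(1), of u f d] assms(2,3)
  by (simp only: has_real_derivative_iff_has_vector_derivative box_real)

lemma combined_caputo_eq:
  assumes "lo < hi" "u \<in> {lo..hi}" "\<And>v. v \<in> {lo..hi} \<Longrightarrow> (f has_real_derivative d v) (at v within
      {lo..hi})"
  shows "combined_caputo lo hi \<gamma> \<alpha> \<beta> f u = comb_int lo hi \<gamma> \<alpha> \<beta> d u"
proof -
  have "combined_caputo lo hi \<gamma> \<alpha> \<beta> f u = comb_int lo hi \<gamma> \<alpha> \<beta> (deriv_on lo hi f) u"
    by (simp add: combined_caputo_def caputo_left_def caputo_right_def comb_int_def)
  also have "\<dots> = comb_int lo hi \<gamma> \<alpha> \<beta> d u"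
    using assms by (intro comb_int_cong deriv_on_eq) auto
  finally show ?thesis .
qed

lemma combined_caputo_existsI:
  assumes "lo < hi" "u \<in> {lo..hi}" "\<And>v. v \<in> {lo..hi} \<Longrightarrow> (f has_real_derivative d v) (at v within
      {lo..hi})"
    and "continuous_on {lo..hi} d" "admissible_order lo hi \<alpha>" "admissible_order lo hi \<beta>"
  shows "combined_caputo_exists lo hi \<gamma> \<alpha> \<beta> f u"
proof -
  have d: "deriv_on lo hi f v = d v" if "v \<in> {lo..hi}" for v
    using assms(1,3) that by (intro deriv_on_eq) auto
  have "(\<lambda>\<tau>. frac_kernel \<alpha> u \<tau> * deriv_on lo hi f \<tau>) integrable_on {lo..u}"
    using frac_left_integrable[OF assms(5,4), of lo u] assms(1,2)
    by (rule_tac integrable_eq) (auto simp: d)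
  moreover have "(\<lambda>\<tau>. frac_kernel \<beta> \<tau> u * deriv_on lo hi f \<tau>) integrable_on {u..hi}"
    using frac_right_integrable[OF assms(6,4), of hi u] assms(1,2)
    by (rule_tac integrable_eq) (auto simp: d)
  ultimately show ?thesis by (simp add: combined_caputo_exists_def)
qed

section \<open>First variation of a parametrised Herglotz equation\<close>

text \<open>The mean value theorem on the segment from \<open>(0, 0)\<close> to
  \<open>(\<epsilon>, \<rho>)\<close>, with the linear part subtracted; the differences of partial
  derivatives that remain are small uniformly in \<open>p\<close>, by uniform continuity on
  \<open>P\<close> times a square.\<close>

lemma uniform_remainder:
  fixes \<phi> \<phi>\<epsilon> \<phi>\<rho> :: "'p::metric_space \<Rightarrow> real \<Rightarrow> real \<Rightarrow> real"
  assumes P: "compact P"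
    and der: "\<And>p \<epsilon> \<rho>. p \<in> P \<Longrightarrow> ((\<lambda>(\<epsilon>, \<rho>). \<phi> p \<epsilon> \<rho>) has_derivative
      (\<lambda>(d\<epsilon>, d\<rho>). d\<epsilon> * \<phi>\<epsilon> p \<epsilon> \<rho> + d\<rho> * \<phi>\<rho> p \<epsilon> \<rho>)) (at (\<epsilon>, \<rho>))"
    and c\<epsilon>: "continuous_on (P \<times> UNIV) (\<lambda>(p, \<epsilon>, \<rho>). \<phi>\<epsilon> p \<epsilon> \<rho>)"
    and c\<rho>: "continuous_on (P \<times> UNIV) (\<lambda>(p, \<epsilon>, \<rho>). \<phi>\<rho> p \<epsilon> \<rho>)"
    and \<eta>: "\<eta> > 0"
  shows "\<exists>\<delta>>0. \<forall>p\<in>P. \<forall>\<epsilon> \<rho>. \<bar>\<epsilon>\<bar> \<le> \<delta> \<longrightarrow> \<bar>\<rho>\<bar> \<le> \<delta> \<longrightarrow>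
    \<bar>\<phi> p \<epsilon> \<rho> - \<phi> p 0 0 - \<epsilon> * \<phi>\<epsilon> p 0 0 - \<rho> * \<phi>\<rho> p 0 0\<bar> \<le> \<eta> * (\<bar>\<epsilon>\<bar> + \<bar>\<rho>\<bar>)"
proof -
  let ?K = "P \<times> cbox (-1, -1) (1, 1 :: real)"
  have K: "compact ?K" by (intro compact_Times P compact_cbox)
  have sub: "?K \<subseteq> P \<times> UNIV" by auto
  have unif: "\<exists>d>0. \<forall>p\<in>P. \<forall>\<epsilon> \<rho>. \<bar>\<epsilon>\<bar> \<le> d \<longrightarrow> \<bar>\<rho>\<bar> \<le> d \<longrightarrow> \<bar>\<psi> p \<epsilon> \<rho> - \<psi> p 0 0\<bar> \<le> \<eta>"
    if c: "continuous_on (P \<times> UNIV) (\<lambda>(p, \<epsilon>, \<rho>). \<psi> p \<epsilon> \<rho>)" for \<psi> :: "'p \<Rightarrow> real \<Rightarrow> real \<Rightarrow> real"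
  proof -
    have "uniformly_continuous_on ?K (\<lambda>(p, \<epsilon>, \<rho>). \<psi> p \<epsilon> \<rho>)"
      by (rule compact_uniformly_continuous[OF continuous_on_subset[OF c sub] K])
    then obtain d where d: "d > 0" "\<And>x y. x \<in> ?K \<Longrightarrow> y \<in> ?K \<Longrightarrow> dist y x < d \<Longrightarrow>
        dist ((\<lambda>(p, \<epsilon>, \<rho>). \<psi> p \<epsilon> \<rho>) y) ((\<lambda>(p, \<epsilon>, \<rho>). \<psi> p \<epsilon> \<rho>) x) < \<eta>"
      using \<eta> unfolding uniformly_continuous_on_def by metis
    \<comment> \<open>The bound 1 keeps the point in the compact square; \<open>d / 3\<close> makes
      the sum of the two entries less than \<open>d\<close>.\<close>
    show ?thesis
    proof (intro exI[of _ "min 1 (d / 3)"] conjI ballI allI impI)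
      fix p \<epsilon> \<rho> assume p: "p \<in> P" and e: "\<bar>\<epsilon>\<bar> \<le> min 1 (d / 3)" "\<bar>\<rho>\<bar> \<le> min 1 (d / 3)"
      have "dist (p, \<epsilon>, \<rho>) (p, 0, 0) = norm (\<epsilon>, \<rho>)" by (simp add: dist_Pair_Pair norm_Pair)
      also have "\<dots> \<le> \<bar>\<epsilon>\<bar> + \<bar>\<rho>\<bar>" using norm_Pair_le[of \<epsilon> \<rho>] by simp
      also have "\<dots> < d" using e d(1) by simp
      finally have "dist (p, \<epsilon>, \<rho>) (p, 0, 0) < d" .
      then show "\<bar>\<psi> p \<epsilon> \<rho> - \<psi> p 0 0\<bar> \<le> \<eta>"
        using d(2)[of "(p, 0, 0)" "(p, \<epsilon>, \<rho>)"] p e by (auto simp: dist_real_def cbox_Pair_eq abs_le_iff)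
    qed (use d in auto)
  qed
  obtain d1 where d1: "d1 > 0" "\<And>p \<epsilon> \<rho>. p \<in> P \<Longrightarrow> \<bar>\<epsilon>\<bar> \<le> d1 \<Longrightarrow> \<bar>\<rho>\<bar> \<le> d1 \<Longrightarrow> \<bar>\<phi>\<epsilon> p \<epsilon> \<rho> - \<phi>\<epsilon> p 0 0\<bar> \<le> \<eta>"
    using unif[OF c\<epsilon>] by blast
  obtain d2 where d2: "d2 > 0" "\<And>p \<epsilon> \<rho>. p \<in> P \<Longrightarrow> \<bar>\<epsilon>\<bar> \<le> d2 \<Longrightarrow> \<bar>\<rho>\<bar> \<le> d2 \<Longrightarrow> \<bar>\<phi>\<rho> p \<epsilon> \<rho> - \<phi>\<rho> p 0 0\<bar> \<le> \<eta>"
    using unif[OF c\<rho>] by blast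
  show ?thesis
  proof (intro exI[of _ "min d1 d2"] conjI ballI allI impI)
    fix p \<epsilon> \<rho> assume p: "p \<in> P" and e: "\<bar>\<epsilon>\<bar> \<le> min d1 d2" "\<bar>\<rho>\<bar> \<le> min d1 d2"
    define g where "g = (\<lambda>\<theta>. \<phi> p (\<theta> * \<epsilon>) (\<theta> * \<rho>) - \<theta> * (\<epsilon> * \<phi>\<epsilon> p 0 0 + \<rho> * \<phi>\<rho> p 0 0))"
    define g' where "g' = (\<lambda>\<theta>. \<epsilon> * (\<phi>\<epsilon> p (\<theta> * \<epsilon>) (\<theta> * \<rho>) - \<phi>\<epsilon> p 0 0) + \<rho> * (\<phi>\<rho> p (\<theta> * \<epsilon>) (\<theta> * \<rho>) -
        \<phi>\<rho> p 0 0))"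
    have gd: "(g has_real_derivative g' \<theta>) (at \<theta> within {0..1})" for \<theta>
    proof -
      have "((\<lambda>\<theta>. (\<theta> * \<epsilon>, \<theta> * \<rho>)) has_derivative (\<lambda>y. (y * \<epsilon>, y * \<rho>))) (at \<theta> within {0..1})"
        by (auto intro!: derivative_eq_intros)
      from has_derivative_compose[OF this der[OF p]]
      have "((\<lambda>\<theta>. \<phi> p (\<theta> * \<epsilon>) (\<theta> * \<rho>)) has_derivative
          (\<lambda>y. y * \<epsilon> * \<phi>\<epsilon> p (\<theta> * \<epsilon>) (\<theta> * \<rho>) + y * \<rho> * \<phi>\<rho> p (\<theta> * \<epsilon>) (\<theta> * \<rho>))) (at \<theta> within {0..1})"
        by simp
      then have "((\<lambda>\<theta>. \<phi> p (\<theta> * \<epsilon>) (\<theta> * \<rho>)) has_real_derivative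
          \<epsilon> * \<phi>\<epsilon> p (\<theta> * \<epsilon>) (\<theta> * \<rho>) + \<rho> * \<phi>\<rho> p (\<theta> * \<epsilon>) (\<theta> * \<rho>)) (at \<theta> within {0..1})"
        unfolding has_field_derivative_def by (rule has_derivative_eq_rhs) (simp add: fun_eq_iff
            algebra_simps)
      then show ?thesis
        unfolding g_def g'_def by (auto intro!: derivative_eq_intros simp: algebra_simps)
    qed
    have gb: "norm (g' \<theta>) \<le> \<eta> * (\<bar>\<epsilon>\<bar> + \<bar>\<rho>\<bar>)" if \<theta>: "\<theta> \<in> {0..1}" for \<theta>
    proof -
      have "\<bar>\<theta> * \<epsilon>\<bar> \<le> 1 * \<bar>\<epsilon>\<bar>" "\<bar>\<theta> * \<rho>\<bar> \<le> 1 * \<bar>\<rho>\<bar>"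
        using \<theta> unfolding abs_mult by (intro mult_right_mono; simp)+
      then have "\<bar>\<phi>\<epsilon> p (\<theta> * \<epsilon>) (\<theta> * \<rho>) - \<phi>\<epsilon> p 0 0\<bar> \<le> \<eta>" "\<bar>\<phi>\<rho> p (\<theta> * \<epsilon>) (\<theta> * \<rho>) - \<phi>\<rho> p 0 0\<bar> \<le> \<eta>"
        using e by (intro d1(2) d2(2) p; linarith)+
      then have "\<bar>\<epsilon>\<bar> * \<bar>\<phi>\<epsilon> p (\<theta> * \<epsilon>) (\<theta> * \<rho>) - \<phi>\<epsilon> p 0 0\<bar> + \<bar>\<rho>\<bar> * \<bar>\<phi>\<rho> p (\<theta> * \<epsilon>) (\<theta> * \<rho>) - \<phi>\<rho> p 0 0\<bar>
          \<le> \<bar>\<epsilon>\<bar> * \<eta> + \<bar>\<rho>\<bar> * \<eta>"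
        by (intro add_mono mult_left_mono) auto
      then show ?thesis
        unfolding g'_def real_norm_def
        by (intro order_trans[OF abs_triangle_ineq]) (simp add: abs_mult distrib_left
            mult.commute[of \<eta>])
    qed
    have "norm (g 1 - g 0) \<le> \<eta> * (\<bar>\<epsilon>\<bar> + \<bar>\<rho>\<bar>) * norm (1 - 0 :: real)"
      by (intro field_differentiable_bound[of "{0..1}" g g'] gd gb) auto
    then show "\<bar>\<phi> p \<epsilon> \<rho> - \<phi> p 0 0 - \<epsilon> * \<phi>\<epsilon> p 0 0 - \<rho> * \<phi>\<rho> p 0 0\<bar> \<le> \<eta> * (\<bar>\<epsilon>\<bar> + \<bar>\<rho>\<bar>)"
      by (simp add: g_def algebra_simps)
  qed (use d1 d2 in auto)
qed


text \<open>The third argument of \<open>\<phi>\<close> is the deviation \<open>r - z t\<close>, so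
  the trajectory becomes the line \<open>\<rho> = 0\<close> and estimates on a fixed compact set
  apply. The factor \<open>\<sigma>\<close> covers minimizers and maximizers. A nonzero integral
  would let a small \<epsilon> of the right sign move \<open>w T\<close> past
  \<open>z T\<close>.\<close>

theorem first_variation:
  fixes \<phi> \<phi>\<epsilon> \<phi>\<rho> :: "real \<times> 'v::euclidean_space \<Rightarrow> real \<Rightarrow> real \<Rightarrow> real"
    and z :: "real \<Rightarrow> real" and lo hi :: 'v
  defines "f \<equiv> \<lambda>\<epsilon> t r. integral (cbox lo hi) (\<lambda>s. \<phi> (t, s) \<epsilon> (r - z t))"
  assumes der: "\<And>p \<epsilon> \<rho>. p \<in> {a..b} \<times> cbox lo hi \<Longrightarrow> ((\<lambda>(\<epsilon>, \<rho>). \<phi> p \<epsilon> \<rho>) has_derivative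
      (\<lambda>(d\<epsilon>, d\<rho>). d\<epsilon> * \<phi>\<epsilon> p \<epsilon> \<rho> + d\<rho> * \<phi>\<rho> p \<epsilon> \<rho>)) (at (\<epsilon>, \<rho>))"
    and c\<phi>: "continuous_on (({a..b} \<times> cbox lo hi) \<times> UNIV) (\<lambda>(p, \<epsilon>, \<rho>). \<phi> p \<epsilon> \<rho>)"
    and c\<epsilon>: "continuous_on (({a..b} \<times> cbox lo hi) \<times> UNIV) (\<lambda>(p, \<epsilon>, \<rho>). \<phi>\<epsilon> p \<epsilon> \<rho>)"
    and c\<rho>: "continuous_on (({a..b} \<times> cbox lo hi) \<times> UNIV) (\<lambda>(p, \<epsilon>, \<rho>). \<phi>\<rho> p \<epsilon> \<rho>)"
    and z: "\<And>t. t \<in> {a..b} \<Longrightarrow> (z has_real_derivative f 0 t (z t)) (at t within {a..b})"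
    and T: "T \<in> {a..b}" and \<delta>: "\<delta> > 0"
    and \<sigma>: "\<sigma> \<noteq> 0"
    and ext: "\<And>\<epsilon> w. \<bar>\<epsilon>\<bar> < \<delta> \<Longrightarrow> w a = z a \<Longrightarrow>
      (\<And>t. t \<in> {a..b} \<Longrightarrow> (w has_real_derivative f \<epsilon> t (w t)) (at t within {a..b})) \<Longrightarrow> \<sigma> * z T \<le> \<sigma> * w T"
  shows "integral {a..T} (\<lambda>t. exp (- integral {a..t} (\<lambda>\<tau>. integral (cbox lo hi) (\<lambda>s. \<phi>\<rho> (\<tau>, s) 0 0)))
    * integral (cbox lo hi) (\<lambda>s. \<phi>\<epsilon> (t, s) 0 0)) = 0" (is "?I = 0")
proof -
  let ?\<Omega> = "cbox lo hi" and ?P = "{a..b} \<times> cbox lo hi"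
  define A where "A = (\<lambda>t. integral ?\<Omega> (\<lambda>s. \<phi>\<rho> (t, s) 0 0))"
  define B where "B = (\<lambda>t. integral ?\<Omega> (\<lambda>s. \<phi>\<epsilon> (t, s) 0 0))"
  define \<mu> where "\<mu> = (\<lambda>t. exp (- integral {a..t} A))"
  have P: "compact ?P" by (intro compact_Times) auto
  have cz: "continuous_on {a..b} z" using z by (rule DERIV_continuous_on)
  have slice: "continuous_on (S \<times> ?\<Omega>) (\<lambda>(y, s). \<psi> (u y, s) (e y) (r y))"
    if "continuous_on (?P \<times> UNIV) (\<lambda>(p, \<epsilon>, \<rho>). \<psi> p \<epsilon> \<rho>)" "continuous_on S u" "u ` S \<subseteq> {a..b}"
      "continuous_on S e" "continuous_on S r"
    for \<psi> :: "real \<times> 'v \<Rightarrow> real \<Rightarrow> real \<Rightarrow> real" and S :: "'y::topological_space set" and u e r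
  proof -
    have "continuous_on (S \<times> ?\<Omega>) (\<lambda>q. u (fst q))" "continuous_on (S \<times> ?\<Omega>) (\<lambda>q. e (fst q))"
        "continuous_on (S \<times> ?\<Omega>) (\<lambda>q. r (fst q))"
      using that(2,4,5) by (auto intro!: continuous_on_compose2[of S _ _ fst] continuous_intros)
    then have "continuous_on (S \<times> ?\<Omega>) (\<lambda>q. (\<lambda>(p, \<epsilon>, \<rho>). \<psi> p \<epsilon> \<rho>) ((u (fst q), snd q), e (fst q), r
        (fst q)))"
      using that(3) by (intro continuous_on_compose2[OF that(1)] continuous_intros) auto
    then show ?thesis by (simp add: split_beta)
  qed
  have fix1: "continuous_on ?\<Omega> (\<lambda>s. \<psi> (t, s) \<epsilon> \<rho>)"
    if "continuous_on (?P \<times> UNIV) (\<lambda>(p, \<epsilon>, \<rho>). \<psi> p \<epsilon> \<rho>)" "t \<in> {a..b}"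
    for \<psi> :: "real \<times> 'v \<Rightarrow> real \<Rightarrow> real \<Rightarrow> real" and t \<epsilon> \<rho>
  proof -
    have "continuous_on ?\<Omega> (\<lambda>s. (\<lambda>(p, \<epsilon>, \<rho>). \<psi> p \<epsilon> \<rho>) ((t, s), \<epsilon>, \<rho>))"
      using that(2) by (intro continuous_on_compose2[OF that(1)] continuous_intros) auto
    then show ?thesis by simp
  qed
  have A: "continuous_on {a..b} A" and B: "continuous_on {a..b} B"
    unfolding A_def B_def
    by (intro integral_continuous_on_param slice[OF c\<rho>] slice[OF c\<epsilon>] continuous_on_id
        continuous_on_const; simp)+
  have "continuous_on (?P \<times> cbox (-1, -1) (1, 1 :: real)) (\<lambda>(p, \<epsilon>, \<rho>). \<phi>\<rho> p \<epsilon> \<rho>)"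
    by (rule continuous_on_subset[OF c\<rho>]) auto
  then have "bounded ((\<lambda>(p, \<epsilon>, \<rho>). \<phi>\<rho> p \<epsilon> \<rho>) ` (?P \<times> cbox (-1, -1) (1, 1 :: real)))"
    by (intro compact_imp_bounded compact_continuous_image compact_Times P) auto
  then obtain M where M: "M > 0" "\<And>p \<epsilon> \<rho>. p \<in> ?P \<Longrightarrow> \<bar>\<epsilon>\<bar> \<le> 1 \<Longrightarrow> \<bar>\<rho>\<bar> \<le> 1 \<Longrightarrow> \<bar>\<phi>\<rho> p \<epsilon> \<rho>\<bar> \<le> M"
    unfolding bounded_pos by (auto simp: cbox_Pair_eq abs_le_iff)
  have dif: "\<exists>d>0. \<forall>\<epsilon> t r. \<bar>\<epsilon>\<bar> \<le> d \<longrightarrow> t \<in> {a..b} \<longrightarrow> \<bar>r - z t\<bar> \<le> d \<longrightarrow>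
      \<bar>f \<epsilon> t r - f 0 t (z t) - \<epsilon> * B t - (r - z t) * A t\<bar> \<le> \<eta> * (\<bar>\<epsilon>\<bar> + \<bar>r - z t\<bar>)"
    if "\<eta> > 0" for \<eta>
  proof -
    define \<eta>' where "\<eta>' = \<eta> / (measure lborel ?\<Omega> + 1)"
    have cp: "measure lborel ?\<Omega> + 1 > 0" by (simp add: add_nonneg_pos)
    have \<eta>': "\<eta>' > 0" using that cp by (simp add: \<eta>'_def)
    obtain d where d: "d > 0" "\<And>p \<epsilon> \<rho>. p \<in> ?P \<Longrightarrow> \<bar>\<epsilon>\<bar> \<le> d \<Longrightarrow> \<bar>\<rho>\<bar> \<le> d \<Longrightarrow>
        \<bar>\<phi> p \<epsilon> \<rho> - \<phi> p 0 0 - \<epsilon> * \<phi>\<epsilon> p 0 0 - \<rho> * \<phi>\<rho> p 0 0\<bar> \<le> \<eta>' * (\<bar>\<epsilon>\<bar> + \<bar>\<rho>\<bar>)"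
      using uniform_remainder[OF P der c\<epsilon> c\<rho> \<eta>'] by blast
    show ?thesis
    proof (intro exI[of _ d] conjI d(1) allI impI)
      fix \<epsilon> t r assume e: "\<bar>\<epsilon>\<bar> \<le> d" and t: "t \<in> {a..b}" and r: "\<bar>r - z t\<bar> \<le> d"
      have hi: "((\<lambda>s. \<phi> (t, s) \<epsilon> (r - z t) - \<phi> (t, s) 0 0 - \<epsilon> * \<phi>\<epsilon> (t, s) 0 0 - (r - z t) * \<phi>\<rho> (t,
          s) 0 0)
          has_integral (f \<epsilon> t r - f 0 t (z t) - \<epsilon> * B t - (r - z t) * A t)) ?\<Omega>"
        unfolding f_def A_def B_def diff_self using fix1[OF c\<phi> t] fix1[OF c\<epsilon> t] fix1[OF c\<rho> t]
        by (intro has_integral_diff has_integral_mult_right integrable_integral integrable_continuous)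
      have "norm (f \<epsilon> t r - f 0 t (z t) - \<epsilon> * B t - (r - z t) * A t)
          \<le> \<eta>' * (\<bar>\<epsilon>\<bar> + \<bar>r - z t\<bar>) * measure lborel ?\<Omega>"
        using \<eta>' by (intro has_integral_bound[OF _ hi]) (auto intro!: d(2) e r t)
      also have "\<dots> \<le> \<eta>' * (\<bar>\<epsilon>\<bar> + \<bar>r - z t\<bar>) * (measure lborel ?\<Omega> + 1)"
        using \<eta>' by (intro mult_left_mono) auto
      also have "\<dots> = \<eta> * (\<bar>\<epsilon>\<bar> + \<bar>r - z t\<bar>)"
        using cp by (simp add: \<eta>'_def)
      finally show "\<bar>f \<epsilon> t r - f 0 t (z t) - \<epsilon> * B t - (r - z t) * A t\<bar> \<le> \<eta> * (\<bar>\<epsilon>\<bar> + \<bar>r - z t\<bar>)"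
        by simp
    qed
  qed
  have lip: "\<bar>f \<epsilon> t r - f \<epsilon> t r'\<bar> \<le> M * measure lborel ?\<Omega> * \<bar>r - r'\<bar>"
    if e: "\<bar>\<epsilon>\<bar> \<le> 1" and t: "t \<in> {a..b}" and r: "\<bar>r - z t\<bar> \<le> 1" "\<bar>r' - z t\<bar> \<le> 1" for \<epsilon> t r r'
  proof -
    have hi: "((\<lambda>s. \<phi> (t, s) \<epsilon> (r - z t) - \<phi> (t, s) \<epsilon> (r' - z t)) has_integral (f \<epsilon> t r - f \<epsilon> t r')) ?\<Omega>"
      unfolding f_def using fix1[OF c\<phi> t] by (intro has_integral_diff integrable_integral
          integrable_continuous)
    have "norm (f \<epsilon> t r - f \<epsilon> t r') \<le> M * \<bar>r - r'\<bar> * measure lborel ?\<Omega>"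
    proof (rule has_integral_bound[OF _ hi])
      fix s assume s: "s \<in> ?\<Omega>"
      then have p: "(t, s) \<in> ?P" using t by simp
      have gd: "((\<lambda>\<rho>. \<phi> (t, s) \<epsilon> \<rho>) has_real_derivative \<phi>\<rho> (t, s) \<epsilon> \<rho>) (at \<rho> within {-1..1})" for \<rho>
      proof -
        have "((\<lambda>\<rho>. (\<epsilon>, \<rho>)) has_derivative (\<lambda>y. (0, y))) (at \<rho> within {-1..1})"
          by (auto intro!: derivative_eq_intros)
        from has_derivative_compose[OF this der[OF p]] show ?thesis
          unfolding has_field_derivative_def by (rule_tac has_derivative_eq_rhs) (auto simp: fun_eq_iff)
      qed
      have "norm (\<phi> (t, s) \<epsilon> (r - z t) - \<phi> (t, s) \<epsilon> (r' - z t)) \<le> M * norm ((r - z t) - (r' - z t))"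
      proof (rule field_differentiable_bound[OF _ gd])
        show "norm (\<phi>\<rho> (t, s) \<epsilon> \<rho>) \<le> M" if "\<rho> \<in> {-1..1}" for \<rho>
          using M(2)[OF p e, of \<rho>] that by (simp add: abs_le_iff)
      qed (use r in \<open>auto simp: abs_le_iff\<close>)
      then show "norm (\<phi> (t, s) \<epsilon> (r - z t) - \<phi> (t, s) \<epsilon> (r' - z t)) \<le> M * \<bar>r - r'\<bar>"
        by simp
    qed (use M in auto)
    then show ?thesis by (simp add: mult_ac)
  qed
  have cont: "continuous_on {(t, r). t \<in> {a..b} \<and> \<bar>r - z t\<bar> \<le> 1} (\<lambda>(t, r). f \<epsilon> t r)" for \<epsilon>
  proof -
    let ?S = "{(t, r). t \<in> {a..b} \<and> \<bar>r - z t\<bar> \<le> 1}"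
    have "continuous_on ?S (\<lambda>y. z (fst y))"
      by (rule continuous_on_compose2[OF cz]) (auto intro!: continuous_intros)
    then have "continuous_on ?S (\<lambda>y. integral ?\<Omega> (\<lambda>s. \<phi> (fst y, s) \<epsilon> (snd y - z (fst y))))"
      by (intro integral_continuous_on_param slice[OF c\<phi>] continuous_intros) auto
    then show ?thesis by (simp add: f_def split_beta)
  qed
  show ?thesis
  proof (rule ccontr)
    assume nz: "?I \<noteq> 0"
    define J where "J = integral {a..T} (\<lambda>t. \<mu> t * B t)"
    have J: "J \<noteq> 0" using nz by (simp add: J_def \<mu>_def A_def B_def)
    \<comment> \<open>With half of \<open>\<bar>J\<bar>\<close> as precision the remainder is too
      small to compensate the first-order term \<open>\<epsilon> * J\<close>.\<close>
    have "\<exists>d>0. \<forall>\<epsilon>. \<bar>\<epsilon>\<bar> \<le> d \<longrightarrow> (\<exists>w. w a = z a \<and>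
      (\<forall>t\<in>{a..b}. (w has_real_derivative f \<epsilon> t (w t)) (at t within {a..b})) \<and>
      \<bar>\<mu> T * (w T - z T) - \<epsilon> * J\<bar> \<le> \<bar>J\<bar> / 2 * \<bar>\<epsilon>\<bar>)"
      unfolding \<mu>_def J_def
      by (rule perturbed_ode[OF z zero_less_one zero_less_one _ cont lip A B dif T])
         (use M J in \<open>auto simp: J_def \<mu>_def\<close>)
    then obtain d where d: "d > 0" "\<And>\<epsilon>. \<bar>\<epsilon>\<bar> \<le> d \<Longrightarrow> (\<exists>w. w a = z a \<and>
      (\<forall>t\<in>{a..b}. (w has_real_derivative f \<epsilon> t (w t)) (at t within {a..b})) \<and>
      \<bar>\<mu> T * (w T - z T) - \<epsilon> * J\<bar> \<le> \<bar>J\<bar> / 2 * \<bar>\<epsilon>\<bar>)" by blast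
    define e where "e = min d (\<delta> / 2)"
    have e: "0 < e" "e \<le> d" "e < \<delta>" using d \<delta> by (auto simp: e_def)
    have \<mu>T: "\<mu> T > 0" by (simp add: \<mu>_def)
    \<comment> \<open>The sign that makes \<open>\<sigma> * (k * J)\<close> negative.\<close>
    define k where "k = - (e * sgn (\<sigma> * J))"
    have k: "\<bar>k\<bar> = e" and \<sigma>kJ: "\<sigma> * (k * J) = - (e * \<bar>\<sigma> * J\<bar>)"
      using \<sigma> J e by (auto simp: k_def abs_mult abs_sgn_eq sgn_mult abs_sgn mult_ac)
    obtain w where w: "w a = z a" "\<And>t. t \<in> {a..b} \<Longrightarrow> (w has_real_derivative f k t (w t)) (at t within
        {a..b})"
      "\<bar>\<mu> T * (w T - z T) - k * J\<bar> \<le> \<bar>J\<bar> / 2 * e"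
      using d(2)[of k] k e by auto
    have "0 \<le> \<mu> T * (\<sigma> * (w T - z T))"
      using ext[OF _ w(1,2)] k e \<mu>T by (rule_tac mult_nonneg_nonneg) (simp_all add: right_diff_distrib)
    also have "\<dots> = \<sigma> * (k * J) + \<sigma> * (\<mu> T * (w T - z T) - k * J)" by (simp add: algebra_simps)
    also have "\<dots> \<le> - (e * \<bar>\<sigma> * J\<bar>) + \<bar>\<sigma>\<bar> * (\<bar>J\<bar> / 2 * e)"
      unfolding \<sigma>kJ using mult_left_mono[OF w(3) abs_ge_zero[of \<sigma>]]
      by (intro add_left_mono) (simp add: abs_mult[symmetric])
    also have "\<dots> < 0" using e \<sigma> J by (simp add: abs_mult mult_ac)
    finally show False by simp
  qed
qed

section \<open>Bump functions\<close>

text \<open>Only a C^1 bump is required: the square of a positive part is continuously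
  differentiable, and the squared norm avoids the kink of the norm at the centre.\<close>

definition bump :: "'a::euclidean_space \<Rightarrow> real \<Rightarrow> 'a \<Rightarrow> real" where
  "bump p0 r p = (max 0 (r\<^sup>2 - (norm (p - p0))\<^sup>2))\<^sup>2"

definition bump_grad :: "'a::euclidean_space \<Rightarrow> real \<Rightarrow> 'a \<Rightarrow> 'a" where
  "bump_grad p0 r p = (- 4 * max 0 (r\<^sup>2 - (norm (p - p0))\<^sup>2)) *\<^sub>R (p - p0)"

lemma DERIV_max_0_square:
  fixes y :: real
  shows "((\<lambda>y. (max 0 y)\<^sup>2) has_real_derivative 2 * max 0 y) (at y)"
proof (cases y "0 :: real" rule: linorder_cases)
  case less
  have "((\<lambda>y. 0) has_real_derivative 2 * max 0 y) (at y)" using less by simp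
  then show ?thesis
    by (rule has_field_derivative_transform_within_open[of _ _ _ "{..<0}"]) (use less in auto)
next
  case greater
  have "((\<lambda>y. y\<^sup>2) has_real_derivative 2 * max 0 y) (at y)"
    using greater by (auto intro!: derivative_eq_intros)
  then show ?thesis
    by (rule has_field_derivative_transform_within_open[of _ _ _ "{0<..}"]) (use greater in auto)
next
  case equal
  have "((\<lambda>h. (max 0 h)\<^sup>2 / h) \<longlongrightarrow> 0) (at (0 :: real))"
  proof (rule Lim_null_comparison)
    show "\<forall>\<^sub>F h in at (0 :: real). norm ((max 0 h)\<^sup>2 / h) \<le> \<bar>h\<bar>"
      by (rule always_eventually) (auto simp: power2_eq_square max_def)
    show "((\<lambda>h. \<bar>h\<bar>) \<longlongrightarrow> 0) (at (0 :: real))"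
      by (rule tendsto_rabs_zero) (rule tendsto_ident_at)
  qed
  then show ?thesis by (simp add: equal DERIV_def)
qed

lemma bump_has_derivative: "(bump p0 r has_derivative (\<lambda>v. v \<bullet> bump_grad p0 r p)) (at p within S)"
proof -
  have 1: "((\<lambda>p. r\<^sup>2 - (norm (p - p0))\<^sup>2) has_derivative (\<lambda>v. - 2 * (v \<bullet> (p - p0)))) (at p within S)"
    unfolding power2_norm_eq_inner by (auto intro!: derivative_eq_intros simp: inner_commute)
  have "((\<lambda>p. (max 0 (r\<^sup>2 - (norm (p - p0))\<^sup>2))\<^sup>2) has_derivative
      (\<lambda>v. 2 * max 0 (r\<^sup>2 - (norm (p - p0))\<^sup>2) * (- 2 * (v \<bullet> (p - p0))))) (at p within S)"
    using has_derivative_compose[OF 1 DERIV_max_0_square[unfolded has_field_derivative_def]] by simp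
  then show ?thesis
    unfolding bump_def[abs_def] bump_grad_def by (rule has_derivative_eq_rhs) (auto simp: fun_eq_iff
        algebra_simps)
qed

lemma continuous_on_bump: "continuous_on S (bump p0 r)" "continuous_on S (bump_grad p0 r)"
  unfolding bump_def[abs_def] bump_grad_def[abs_def] by (intro continuous_intros)+

lemma bump_nonneg: "0 \<le> bump p0 r p"
  by (simp add: bump_def)

lemma bump_center: "0 < r \<Longrightarrow> 0 < bump p0 r p0"
  by (simp add: bump_def)

lemma bump_outside:
  assumes "p \<notin> ball p0 r" "0 \<le> r"
  shows "bump p0 r p = 0" "bump_grad p0 r p = 0"
proof -
  have "r \<le> norm (p - p0)" using assms by (simp add: dist_norm norm_minus_commute)
  then have "r\<^sup>2 \<le> (norm (p - p0))\<^sup>2" using assms(2) by (rule power_mono)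
  then show "bump p0 r p = 0" "bump_grad p0 r p = 0" by (simp_all add: bump_def bump_grad_def)
qed

text \<open>\<open>E\<close> may be singular at the boundary of \<open>U\<close>. But
  \<open>U\<close> and the complement of \<open>K\<close> are open and together cover the space, and
  on the latter the product is 0.\<close>

lemma continuous_on_bump_mult:
  fixes E :: "'a::euclidean_space \<Rightarrow> real"
  assumes "open U" "continuous_on U E" "ball p0 r \<subseteq> K" "closed K" "K \<subseteq> U" "0 \<le> r"
  shows "continuous_on S (\<lambda>p. bump p0 r p * E p)"
proof -
  have "continuous_on (U \<union> - K) (\<lambda>p. bump p0 r p * E p)"
  proof (rule continuous_on_open_Un)
    show "continuous_on U (\<lambda>p. bump p0 r p * E p)"
      by (intro continuous_on_mult continuous_on_bump assms)
    show "continuous_on (- K) (\<lambda>p. bump p0 r p * E p)"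
    proof (rule continuous_on_eq[OF continuous_on_const[of _ 0]])
      fix p assume "p \<in> - K"
      then have "bump p0 r p = 0" using assms(3,6) by (intro bump_outside) auto
      then show "0 = bump p0 r p * E p" by simp
    qed
  qed (use assms in auto)
  moreover have "S \<subseteq> U \<union> - K" using assms(5) by blast
  ultimately show ?thesis by (rule continuous_on_subset)
qed

text \<open>Only bumps supported in a compact box inside the open one are tested, since
  \<open>E\<close> is known to be continuous only there. Near a point with
  \<open>E p \<noteq> 0\<close> the product \<open>E p * E q\<close> is positive, so one argument
  treats both signs.\<close>

lemma fundamental_lemma_bump:
  fixes E :: "'a::euclidean_space \<Rightarrow> real"
  assumes E: "continuous_on (box a b) E" and p: "p \<in> box a b"
    and zero: "\<And>p0 r c d. 0 < r \<Longrightarrow> ball p0 r \<subseteq> cbox c d \<Longrightarrow> cbox c d \<subseteq> box a b \<Longrightarrow>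
      integral (cbox a b) (\<lambda>p. bump p0 r p * E p) = 0"
  shows "E p = 0"
proof (rule ccontr)
  assume nz: "E p \<noteq> 0"
  let ?V = "box a b \<inter> (\<lambda>q. E p * E q) -` {0<..}"
  have "open ?V"
    by (rule continuous_open_preimage) (intro continuous_intros E open_box open_greaterThan)+
  moreover have "p \<in> ?V" using p nz by (simp add: zero_less_mult_iff) linarith
  ultimately obtain c d where cd: "cbox c d \<subseteq> ?V" "p \<in> box c d"
    by (rule open_contains_cbox) (rule that)
  obtain r where r: "r > 0" "ball p r \<subseteq> box c d"
    using cd(2) open_box open_contains_ball by blast
  have rc: "ball p r \<subseteq> cbox c d" using r(2) box_subset_cbox by blast
  have ab: "cbox c d \<subseteq> box a b" using cd(1) by blast
  have cont: "continuous_on (cbox a b) (\<lambda>q. bump p r q * E q)"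
    by (rule continuous_on_bump_mult[OF open_box E rc closed_cbox ab]) (use r in simp)
  have hi: "((\<lambda>q. E p * (bump p r q * E q)) has_integral E p * 0) (cbox a b)"
    unfolding zero[OF r(1) rc ab, symmetric]
    by (intro has_integral_mult_right integrable_integral integrable_continuous cont)
  have "E p * (bump p r p * E p) = 0"
  proof (rule has_integral_0_cbox_imp_0[OF _ _ hi[unfolded mult_zero_right]])
    show "continuous_on (cbox a b) (\<lambda>q. E p * (bump p r q * E q))"
      by (intro continuous_on_mult continuous_on_const cont)
    show "0 \<le> E p * (bump p r q * E q)" for q
    proof (cases "q \<in> ball p r")
      case True
      then have "0 < E p * E q" using rc cd(1) by blast
      then have "0 \<le> bump p r q * (E p * E q)" by (rule mult_nonneg_nonneg[OF bump_nonneg less_imp_le])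
      then show ?thesis by (simp only: mult.left_commute)
    next
      case False
      then have "bump p r q = 0" using r(1) by (intro bump_outside) auto
      then show ?thesis by simp
    qed
    show "box a b \<noteq> {}" using p by auto
    show "p \<in> cbox a b" using p box_subset_cbox[of a b] by auto
  qed
  then show False using nz bump_center[OF r(1), of p] by simp
qed

text \<open>Off the box, where \<open>g\<close> need not be differentiable, the product with the bump is locally zero.\<close>

lemma bump_by_parts_along_curve:
  fixes \<gamma> :: "real \<Rightarrow> 'a::euclidean_space"
  assumes r: "0 < r" and bq: "ball p0 r \<subseteq> cbox q1 q2" and ab: "a \<le> b"
    and ends: "\<gamma> a \<notin> cbox q1 q2" "\<gamma> b \<notin> cbox q1 q2"
    and \<gamma>: "\<And>\<sigma>. (\<gamma> has_vector_derivative e) (at \<sigma>)"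
    and der: "\<And>\<sigma>. \<gamma> \<sigma> \<in> cbox q1 q2 \<Longrightarrow> ((\<lambda>\<sigma>. g (\<gamma> \<sigma>)) has_real_derivative - D (\<gamma> \<sigma>)) (at \<sigma>)"
  shows "integral {a..b} (\<lambda>\<sigma>. (e \<bullet> bump_grad p0 r (\<gamma> \<sigma>)) * g (\<gamma> \<sigma>) - bump p0 r (\<gamma> \<sigma>) * D (\<gamma> \<sigma>)) = 0"
proof -
  let ?F = "\<lambda>\<sigma>. (e \<bullet> bump_grad p0 r (\<gamma> \<sigma>)) * g (\<gamma> \<sigma>) - bump p0 r (\<gamma> \<sigma>) * D (\<gamma> \<sigma>)"
  let ?B = "\<lambda>\<sigma>. bump p0 r (\<gamma> \<sigma>) * g (\<gamma> \<sigma>)"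
  have out: "bump p0 r p = 0" "bump_grad p0 r p = 0" if "p \<notin> cbox q1 q2" for p
    using that bq r by (auto intro!: bump_outside)
  have "(?B has_real_derivative ?F \<sigma>) (at \<sigma>)" for \<sigma>
  proof (cases "\<gamma> \<sigma> \<in> cbox q1 q2")
    case True
    have "((\<lambda>\<sigma>. bump p0 r (\<gamma> \<sigma>)) has_real_derivative e \<bullet> bump_grad p0 r (\<gamma> \<sigma>)) (at \<sigma>)"
      using has_derivative_compose[OF \<gamma>[unfolded has_vector_derivative_def] bump_has_derivative[of
          p0 r]]
      by (simp add: has_field_derivative_def mult_commute_abs)
    from DERIV_mult[OF this der[OF True]] show ?thesis by (simp add: algebra_simps)
  next
    case False
    have "continuous_on UNIV \<gamma>"
      by (simp add: continuous_on_eq_continuous_at has_vector_derivative_continuous[OF \<gamma>])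
    then have "open (\<gamma> -` (- cbox q1 q2))" by (intro open_vimage) (auto simp: closed_cbox)
    then have "(?B has_real_derivative 0) (at \<sigma>)"
      by (intro has_field_derivative_transform_within_open[OF DERIV_const[of 0]]) (use False out in
          auto)
    then show ?thesis by (simp add: out[OF False])
  qed
  then have "(?F has_integral ?B b - ?B a) {a..b}"
    using ab by (intro fundamental_theorem_of_calculus)
      (auto simp: has_real_derivative_iff_has_vector_derivative[symmetric] intro:
          has_field_derivative_at_within)
  then show ?thesis by (simp add: out[OF ends(1)] out[OF ends(2)] integral_unique)
qed

section \<open>Gradients and Caputo derivatives\<close>

locale herglotz_problem =
  fixes H :: "('n::finite) herglotz"
  assumes lt_t: "lo_t H < hi_t H" and lt_s: "\<And>i. lo_s H $ i < hi_s H $ i"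
    and ord_t: "admissible_order (lo_t H) (hi_t H) (ord_l_t H)"
      "admissible_order (lo_t H) (hi_t H) (ord_r_t H)"
    and ord_s: "\<And>i. admissible_order (lo_s H $ i) (hi_s H $ i) (ord_l_s H i)"
      "\<And>i. admissible_order (lo_s H $ i) (hi_s H $ i) (ord_r_s H i)"
    and C1_Lag: "C1_on (dom_L H) (Lag H)"
begin

abbreviation "\<Omega> \<equiv> cbox (lo_s H) (hi_s H)"
abbreviation "It \<equiv> {lo_t H..hi_t H}"
abbreviation "P \<equiv> dom_P H"

abbreviation "op_t \<equiv> comb_int (lo_t H) (hi_t H) (weight_t H) (ord_l_t H) (ord_r_t H)"
abbreviation "op_s i \<equiv>
  comb_int (lo_s H $ i) (hi_s H $ i) (weight_s H i) (ord_l_s H i) (ord_r_s H i)"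

definition gradient :: "('n pt \<Rightarrow> real) \<Rightarrow> ('n pt \<Rightarrow> 'n pt) \<Rightarrow> bool" where
  "gradient f G \<longleftrightarrow> continuous_on P G \<and>
     (\<forall>p\<in>P. (f has_derivative (\<lambda>v. v \<bullet> G p)) (at p within P))"

lemma P_eq: "P = It \<times> \<Omega>" "P = cbox (lo_t H, lo_s H) (hi_t H, hi_s H)"
  by (simp_all add: dom_P_def cbox_Pair_eq)

lemma compact_P: "compact P"
  by (simp add: P_eq(2) compact_cbox)

lemma gradient_continuous:
  assumes "gradient f G"
  shows "continuous_on P f" "continuous_on P (\<lambda>p. fst (G p))" "continuous_on P (\<lambda>p. snd (G p) $ i)"
proof -
  from assms have G: "continuous_on P G" "\<And>p. p \<in> P \<Longrightarrow> (f has_derivative (\<lambda>v. v \<bullet> G p)) (at p within P)"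
    unfolding gradient_def by blast+
  show "continuous_on P f" by (rule has_derivative_continuous_on[OF G(2)])
  show "continuous_on P (\<lambda>p. fst (G p))" "continuous_on P (\<lambda>p. snd (G p) $ i)"
    by (intro continuous_intros G(1))+
qed

lemma slice_t_derivative:
  assumes "gradient f G" "s \<in> \<Omega>" "\<tau> \<in> It"
  shows "(slice_t f s has_real_derivative fst (G (\<tau>, s))) (at \<tau> within It)"
proof -
  have "((\<lambda>\<tau>. (\<tau>, s)) has_vector_derivative (1, 0)) (at \<tau> within It)"
    by (auto intro!: derivative_eq_intros simp: has_vector_derivative_def)
  from has_real_derivative_along[OF _ this, of P f G] have
    "((\<lambda>\<tau>. f (\<tau>, s)) has_real_derivative (1, 0) \<bullet> G (\<tau>, s)) (at \<tau> within It)"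
    using assms unfolding gradient_def by (auto simp: P_eq(1))
  then show ?thesis by (simp add: slice_t_def inner_prod_def)
qed

lemma slice_s_derivative:
  assumes "gradient f G" "(t, s) \<in> P" "\<sigma> \<in> {lo_s H $ i..hi_s H $ i}"
  shows "(slice_s i f t s has_real_derivative snd (G (t, coord_upd s i \<sigma>)) $ i)
    (at \<sigma> within {lo_s H $ i..hi_s H $ i})"
proof -
  have "((\<lambda>\<sigma>. (t, coord_upd s i \<sigma>)) has_vector_derivative (0, axis i 1)) (at \<sigma> within {lo_s H $
      i..hi_s H $ i})"
    unfolding coord_upd_eq by (auto intro!: derivative_eq_intros simp: has_vector_derivative_def)
  moreover have "(\<lambda>\<sigma>. (t, coord_upd s i \<sigma>)) ` {lo_s H $ i..hi_s H $ i} \<subseteq> P"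
    using assms(2) coord_upd_in_cbox[of s "lo_s H" "hi_s H"] by (auto simp: P_eq(1))
  moreover have "(f has_derivative (\<lambda>v. v \<bullet> G p)) (at p within P)" if "p \<in> P" for p
    using assms(1) that unfolding gradient_def by blast
  ultimately have "((\<lambda>\<sigma>. f (t, coord_upd s i \<sigma>)) has_real_derivative (0, axis i 1) \<bullet> G (t, coord_upd
      s i \<sigma>))
      (at \<sigma> within {lo_s H $ i..hi_s H $ i})"
    using assms(3) by (intro has_real_derivative_along)
  then show ?thesis by (simp add: slice_s_def inner_prod_def inner_axis')
qed

lemma continuous_slice_t:
  assumes "continuous_on P f" "s \<in> \<Omega>"
  shows "continuous_on It (\<lambda>\<tau>. f (\<tau>, s))"
  by (rule continuous_on_compose2[OF assms(1)]) (use assms(2) in \<open>auto simp: P_eq(1) intro!: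
      continuous_intros\<close>)

lemma continuous_slice_s:
  assumes "continuous_on P f" "(t, s) \<in> P"
  shows "continuous_on {lo_s H $ i..hi_s H $ i} (\<lambda>\<sigma>. f (t, coord_upd s i \<sigma>))"
  by (rule continuous_on_compose2[OF assms(1)])
     (use assms(2) in \<open>auto simp: P_eq(1) coord_upd_in_cbox intro!: continuous_intros\<close>)

lemma caputo_t_eq:
  assumes "gradient f G" "(t, s) \<in> P"
  shows "caputo_t H f (t, s) = op_t (\<lambda>\<tau>. fst (G (\<tau>, s))) t"
  unfolding caputo_t_def prod.case
  by (rule combined_caputo_eq[OF lt_t _ slice_t_derivative[OF assms(1)]]) (use assms(2) in \<open>auto
      simp: P_eq(1)\<close>)

lemma caputo_s_eq:
  assumes "gradient f G" "(t, s) \<in> P"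
  shows "caputo_s H i f (t, s) = op_s i (\<lambda>\<sigma>. snd (G (t, coord_upd s i \<sigma>)) $ i) (s $ i)"
proof -
  have "s $ i \<in> {lo_s H $ i..hi_s H $ i}" using assms(2) by (auto simp: P_eq(1) mem_box_cart)
  then show ?thesis
    unfolding caputo_s_def prod.case
    by (rule combined_caputo_eq[OF lt_s _ slice_s_derivative[OF assms]])
qed

text \<open>The whole point \<open>y\<close> serves as parameter, although the value does not depend
  on its \<open>i\<close>-th coordinate. Thus the compact parameter space is \<open>P\<close>
  itself, and \<open>continuous_on_at_coord\<close> then evaluates at the point's own
  coordinate.\<close>

lemma continuous_on_coord_slice:
  fixes g :: "'n pt \<Rightarrow> real"
  assumes "continuous_on P g"
  shows "continuous_on ({lo_s H $ i..hi_s H $ i} \<times> P) (\<lambda>(\<sigma>, y). g (fst y, coord_upd (snd y) i \<sigma>))"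
  unfolding split_beta
  by (rule continuous_on_compose2[OF assms]) (auto simp: P_eq(1) coord_upd_in_cbox intro!:
      continuous_intros)

lemma continuous_on_at_coord:
  fixes g :: "real \<Rightarrow> 'n pt \<Rightarrow> real"
  assumes "continuous_on ({lo_s H $ i..hi_s H $ i} \<times> P) (\<lambda>(u, y). g u y)"
  shows "continuous_on P (\<lambda>p. g (snd p $ i) p)"
proof -
  have "continuous_on P (\<lambda>p. (\<lambda>(u, y). g u y) (snd p $ i, p))"
    by (rule continuous_on_compose2[OF assms]) (auto simp: P_eq(1) mem_box_cart intro!:
        continuous_intros)
  then show ?thesis by simp
qed

text \<open>Weakly singular integrals of continuous partial derivatives exist and are continuous, so
  every C^1 perturbation of \<open>x\<close> automatically meets the Caputo conditions in
  \<open>admissible\<close>.\<close>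

lemma caputo_regularI:
  assumes G: "gradient f G"
  shows "caputo_regular H f"
proof -
  have t: "continuous_on P (caputo_t H f)"
  proof -
    have "continuous_on (It \<times> \<Omega>) (\<lambda>(u, s). op_t (\<lambda>v. fst (G (v, s))) u)"
      using gradient_continuous(2)[OF G] lt_t
      by (intro continuous_on_comb_int ord_t) (auto simp: P_eq(1) split_beta)
    then show ?thesis
      unfolding P_eq(1) by (rule continuous_on_eq) (auto simp: caputo_t_eq[OF G] P_eq(1))
  qed
  have s: "continuous_on P (caputo_s H i f)" for i
  proof -
    have "continuous_on ({lo_s H $ i..hi_s H $ i} \<times> P)
        (\<lambda>(u, y). op_s i (\<lambda>v. snd (G (fst y, coord_upd (snd y) i v)) $ i) u)"
      using lt_s[of i]
      by (intro continuous_on_comb_int ord_s compact_P continuous_on_coord_slice[OF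
          gradient_continuous(3)[OF G]]) auto
    from continuous_on_at_coord[OF this] show ?thesis
      by (rule continuous_on_eq) (auto simp: caputo_s_eq[OF G])
  qed
  have "combined_caputo_exists (lo_t H) (hi_t H) (weight_t H) (ord_l_t H) (ord_r_t H) (slice_t f s) t"
    if "(t, s) \<in> P" for t s
    using that lt_t by (intro combined_caputo_existsI[OF _ _ slice_t_derivative[OF G]]
        continuous_slice_t[OF gradient_continuous(2)[OF G]] ord_t) (auto simp: P_eq(1))
  moreover have "combined_caputo_exists (lo_s H $ i) (hi_s H $ i) (weight_s H i) (ord_l_s H i)
      (ord_r_s H i)
      (slice_s i f t s) (s $ i)" if "(t, s) \<in> P" for i t s
    using that lt_s by (intro combined_caputo_existsI[OF _ _ slice_s_derivative[OF G]]
        continuous_slice_s[OF gradient_continuous(3)[OF G]] ord_s) (auto simp: P_eq(1) mem_box_cart)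
  ultimately show ?thesis
    using t s unfolding caputo_regular_def by auto
qed

lemma gradient_linear:
  assumes "gradient f F" "gradient g G"
  shows "gradient (\<lambda>p. f p + \<epsilon> * g p) (\<lambda>p. F p + \<epsilon> *\<^sub>R G p)"
  unfolding gradient_def
proof (intro conjI ballI)
  show "continuous_on P (\<lambda>p. F p + \<epsilon> *\<^sub>R G p)"
    using assms unfolding gradient_def by (intro continuous_intros) auto
  fix p assume "p \<in> P"
  then have "(f has_derivative (\<lambda>v. v \<bullet> F p)) (at p within P)" "(g has_derivative (\<lambda>v. v \<bullet> G p)) (at
      p within P)"
    using assms unfolding gradient_def by auto
  from has_derivative_add[OF this(1) has_derivative_mult_right[OF this(2), of \<epsilon>]]
  show "((\<lambda>p. f p + \<epsilon> * g p) has_derivative (\<lambda>v. v \<bullet> (F p + \<epsilon> *\<^sub>R G p))) (at p within P)"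
    by (simp add: inner_add_right)
qed

lemma caputo_t_linear:
  assumes "gradient f F" "gradient g G" "p \<in> P"
  shows "caputo_t H (\<lambda>p. f p + \<epsilon> * g p) p = caputo_t H f p + \<epsilon> * caputo_t H g p"
proof -
  obtain t s where p: "p = (t, s)" "t \<in> It" "s \<in> \<Omega>" using assms(3) by (auto simp: P_eq(1))
  show ?thesis
    using comb_int_linear[OF ord_t p(2) continuous_slice_t[OF gradient_continuous(2)[OF assms(1)] p(3)]
        continuous_slice_t[OF gradient_continuous(2)[OF assms(2)] p(3)]] assms(3)
    by (simp add: p(1) caputo_t_eq[OF gradient_linear[OF assms(1,2)]] caputo_t_eq[OF assms(1)]
        caputo_t_eq[OF assms(2)])
qed

lemma caputo_s_linear:
  assumes "gradient f F" "gradient g G" "p \<in> P"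
  shows "caputo_s H i (\<lambda>p. f p + \<epsilon> * g p) p = caputo_s H i f p + \<epsilon> * caputo_s H i g p"
proof -
  obtain t s where p: "p = (t, s)" by fastforce
  have s: "s $ i \<in> {lo_s H $ i..hi_s H $ i}" using assms(3) p by (auto simp: P_eq(1) mem_box_cart)
  show ?thesis
    using comb_int_linear[OF ord_s s continuous_slice_s[OF gradient_continuous(3)[OF assms(1)]
        assms(3)[unfolded p]]
        continuous_slice_s[OF gradient_continuous(3)[OF assms(2)] assms(3)[unfolded p]]] assms(3)
    by (simp add: p(1) caputo_s_eq[OF gradient_linear[OF assms(1,2)]] caputo_s_eq[OF assms(1)]
        caputo_s_eq[OF assms(2)])
qed

section \<open>Partial derivatives of the Lagrangian\<close>

definition Lag_gradient :: "('n lag_arg \<Rightarrow> 'n lag_arg) \<Rightarrow> bool" where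
  "Lag_gradient GL \<longleftrightarrow> continuous_on (dom_L H) GL \<and>
     (\<forall>q\<in>dom_L H. (Lag H has_derivative (\<lambda>v. v \<bullet> GL q)) (at q within dom_L H) \<and>
       (\<forall>dx dv dw dr. (0, 0, dx, dv, dw, dr) \<bullet> GL q
         = dx * pd_x (Lag H) q + dv * pd_v (Lag H) q + (\<Sum>i\<in>UNIV. dw $ i * pd_w i (Lag H) q) + dr *
             pd_z (Lag H) q))"

text \<open>In the directions \<open>(0, 0, dx, dv, dw, dr)\<close> the domain
  \<open>dom_L H\<close> contains whole lines, so the derivative within the domain restricts to
  two-sided derivatives there and agrees with the partial derivatives defined by
  \<open>deriv\<close>.\<close>

lemma ex_Lag_gradient: "\<exists>GL. Lag_gradient GL"
proof -
  obtain GL where GL: "continuous_on (dom_L H) GL"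
    "\<And>q. q \<in> dom_L H \<Longrightarrow> (Lag H has_derivative (\<lambda>v. v \<bullet> GL q)) (at q within dom_L H)"
    using C1_on_gradient[OF C1_Lag] by blast
  have line: "((\<lambda>h. Lag H (q + (h - c) *\<^sub>R (0, 0, e))) has_real_derivative (0, 0, e) \<bullet> GL q) (at c)"
    if q: "q \<in> dom_L H" for q e c
  proof -
    have "((\<lambda>h. q + (h - c) *\<^sub>R (0, 0, e)) has_vector_derivative (0, 0, e)) (at c within UNIV)"
      by (auto intro!: derivative_eq_intros simp: has_vector_derivative_def)
    from has_real_derivative_along[OF GL(2) this] q show ?thesis
      by (fastforce simp: dom_L_def)
  qed
  have pd: "pd_x (Lag H) q = (0, 0, 1, 0, 0, 0) \<bullet> GL q" "pd_v (Lag H) q = (0, 0, 0, 1, 0, 0) \<bullet> GL q"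
    "pd_w i (Lag H) q = (0, 0, 0, 0, axis i 1, 0) \<bullet> GL q" "pd_z (Lag H) q = (0, 0, 0, 0, 0, 1) \<bullet> GL q"
    if q: "q \<in> dom_L H" for q i
  proof -
    obtain t s x v w r where qq: "q = (t, s, x, v, w, r)" using prod_cases6 by blast
    show "pd_x (Lag H) q = (0, 0, 1, 0, 0, 0) \<bullet> GL q"
      using DERIV_imp_deriv[OF line[OF q, of x "(1, 0, 0, 0)"]] by (simp add: qq pd_x_def)
    show "pd_v (Lag H) q = (0, 0, 0, 1, 0, 0) \<bullet> GL q"
      using DERIV_imp_deriv[OF line[OF q, of v "(0, 1, 0, 0)"]] by (simp add: qq pd_v_def)
    show "pd_w i (Lag H) q = (0, 0, 0, 0, axis i 1, 0) \<bullet> GL q"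
      using DERIV_imp_deriv[OF line[OF q, of "w $ i" "(0, 0, axis i 1, 0)"]]
      by (simp add: qq pd_w_def coord_upd_eq)
    show "pd_z (Lag H) q = (0, 0, 0, 0, 0, 1) \<bullet> GL q"
      using DERIV_imp_deriv[OF line[OF q, of r "(0, 0, 0, 1)"]] by (simp add: qq pd_z_def)
  qed
  have "(0, 0, dx, dv, dw, dr) \<bullet> GL q
       = dx * pd_x (Lag H) q + dv * pd_v (Lag H) q + (\<Sum>i\<in>UNIV. dw $ i * pd_w i (Lag H) q) + dr *
           pd_z (Lag H) q"
    if q: "q \<in> dom_L H" for q dx dv dw dr
  proof -
    obtain gt gs gx gv gw gr where g: "GL q = (gt, gs, gx, gv, gw, gr)" using prod_cases6 by blast
    show ?thesis
      by (simp add: pd[OF q] g inner_axis' inner_vec_def[of dw gw] mult.commute)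
  qed
  with GL show ?thesis unfolding Lag_gradient_def by blast
qed

lemma continuous_on_pd:
  "continuous_on (dom_L H) (pd_x (Lag H))" "continuous_on (dom_L H) (pd_v (Lag H))"
  "continuous_on (dom_L H) (pd_w i (Lag H))" "continuous_on (dom_L H) (pd_z (Lag H))"
proof -
  obtain GL where "Lag_gradient GL" using ex_Lag_gradient by blast
  then have GL: "continuous_on (dom_L H) GL"
    "\<And>q dx dv dw dr. q \<in> dom_L H \<Longrightarrow> (0, 0, dx, dv, dw, dr) \<bullet> GL q
       = dx * pd_x (Lag H) q + dv * pd_v (Lag H) q + (\<Sum>i\<in>UNIV. dw $ i * pd_w i (Lag H) q) + dr *
           pd_z (Lag H) q"
    unfolding Lag_gradient_def by blast+
  have c: "continuous_on (dom_L H) (\<lambda>q. e \<bullet> GL q)" for e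
    by (intro continuous_intros GL)
  show "continuous_on (dom_L H) (pd_x (Lag H))"
    by (rule continuous_on_eq[OF c[of "(0, 0, 1, 0, 0, 0)"]]) (simp add: GL(2))
  show "continuous_on (dom_L H) (pd_v (Lag H))"
    by (rule continuous_on_eq[OF c[of "(0, 0, 0, 1, 0, 0)"]]) (simp add: GL(2))
  show "continuous_on (dom_L H) (pd_w i (Lag H))"
    by (rule continuous_on_eq[OF c[of "(0, 0, 0, 0, axis i 1, 0)"]])
       (simp add: GL(2) axis_def if_distrib if_distribR cong: if_cong)
  show "continuous_on (dom_L H) (pd_z (Lag H))"
    by (rule continuous_on_eq[OF c[of "(0, 0, 0, 0, 0, 1)"]]) (simp add: GL(2))
qed

end

section \<open>First variation at an extremal\<close>

locale herglotz_extremal = herglotz_problem H for H :: "('n::finite) herglotz" +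
  fixes x :: "'n pt \<Rightarrow> real" and z :: "real \<Rightarrow> real" and T :: real
  assumes ext: "extremizer H x z T"
begin

abbreviation "\<mu> \<equiv> multiplier H x z"
abbreviation "lag \<equiv> lag_at H x z"

lemma adm: "admissible H x z" and T: "lo_t H < T" "T \<le> hi_t H"
  using ext by (auto simp: extremizer_def)

text \<open>The sign \<open>\<sigma>\<close> is 1 for a minimizer and -1 for a maximizer; it merges
  the two cases from here on.\<close>

lemma extremizer_signed:
  obtains \<epsilon> \<sigma> :: real where "\<epsilon> > 0" "\<sigma> \<noteq> 0"
    "\<And>y w \<tau>. admissible H y w \<Longrightarrow> \<tau> \<in> {lo_t H<..hi_t H} \<Longrightarrow> C1_close H \<epsilon> x y \<Longrightarrow> \<bar>\<tau> - T\<bar> < \<epsilon>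
      \<Longrightarrow> \<sigma> * z T \<le> \<sigma> * w \<tau>"
proof -
  from ext obtain \<epsilon> where \<epsilon>: "\<epsilon> > 0" and "(\<forall>y w \<tau>. admissible H y w \<and> \<tau> \<in> {lo_t H<..hi_t H} \<and>
      C1_close H \<epsilon> x y \<and> \<bar>\<tau> - T\<bar> < \<epsilon>
      \<longrightarrow> z T \<le> w \<tau>) \<or> (\<forall>y w \<tau>. admissible H y w \<and> \<tau> \<in> {lo_t H<..hi_t H} \<and> C1_close H \<epsilon> x y \<and> \<bar>\<tau> - T\<bar> < \<epsilon>
      \<longrightarrow> w \<tau> \<le> z T)"
    unfolding extremizer_def by blast
  then show ?thesis
  proof (elim disjE)
    assume "\<forall>y w \<tau>. admissible H y w \<and> \<tau> \<in> {lo_t H<..hi_t H} \<and> C1_close H \<epsilon> x y \<and> \<bar>\<tau> - T\<bar> < \<epsilon> \<longrightarrow> z T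
        \<le> w \<tau>"
    then show ?thesis by (intro that[OF \<epsilon>, of 1]) auto
  next
    assume "\<forall>y w \<tau>. admissible H y w \<and> \<tau> \<in> {lo_t H<..hi_t H} \<and> C1_close H \<epsilon> x y \<and> \<bar>\<tau> - T\<bar> < \<epsilon> \<longrightarrow> w \<tau>
        \<le> z T"
    then show ?thesis by (intro that[OF \<epsilon>, of "-1"]) auto
  qed
qed

lemma gradient_x: obtains G where "gradient x G"
proof -
  have "C1_on P x" using adm by (simp add: admissible_def)
  from C1_on_gradient[OF this] show ?thesis
    using that unfolding gradient_def by metis
qed

lemma z_derivative:
  "t \<in> It \<Longrightarrow> (z has_real_derivative integral \<Omega> (\<lambda>s. Lag H (lag (t, s)))) (at t within It)"
  using adm by (simp add: admissible_def)

lemma continuous_z: "continuous_on It z"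
  using z_derivative by (rule DERIV_continuous_on)

lemma lag_in_dom: "p \<in> P \<Longrightarrow> lag p \<in> dom_L H"
  by (auto simp: lag_at_def dom_L_def P_eq(1))

lemma continuous_lag: "continuous_on P lag"
proof -
  obtain G where "gradient x G" by (rule gradient_x)
  then have "continuous_on P x" by (rule gradient_continuous)
  moreover have "continuous_on P (caputo_t H x)" "continuous_on P (caputo_s H i x)" for i
    using adm by (auto simp: admissible_def caputo_regular_def)
  moreover have "continuous_on P (\<lambda>p. z (fst p))"
    by (rule continuous_on_compose2[OF continuous_z]) (auto simp: P_eq(1) intro!: continuous_intros)
  ultimately show ?thesis
    unfolding lag_at_def[abs_def] by (intro continuous_intros)
qed

lemma continuous_pd_lag:
  "continuous_on P (\<lambda>p. pd_x (Lag H) (lag p))" "continuous_on P (\<lambda>p. pd_v (Lag H) (lag p))"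
  "continuous_on P (\<lambda>p. pd_w i (Lag H) (lag p))" "continuous_on P (\<lambda>p. pd_z (Lag H) (lag p))"
  by (rule continuous_on_compose2[OF continuous_on_pd(1) continuous_lag]
        continuous_on_compose2[OF continuous_on_pd(2) continuous_lag]
        continuous_on_compose2[OF continuous_on_pd(3) continuous_lag]
        continuous_on_compose2[OF continuous_on_pd(4) continuous_lag]; use lag_in_dom in blast)+

lemma continuous_integral_\<Omega>:
  assumes "continuous_on P (f :: 'n pt \<Rightarrow> real)"
  shows "continuous_on It (\<lambda>t. integral \<Omega> (\<lambda>s. f (t, s)))"
  using assms by (intro integral_continuous_on_param) (simp add: P_eq(1) case_prod_eta)

lemma continuous_\<mu>: "continuous_on It \<mu>"
  unfolding multiplier_def[abs_def]
  by (intro continuous_intros indefinite_integral_continuous_1 integrable_continuous_real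
        continuous_integral_\<Omega>[OF continuous_pd_lag(4)])

lemma continuous_\<mu>_P: "continuous_on P (\<lambda>p. \<mu> (fst p))"
  by (rule continuous_on_compose2[OF continuous_\<mu>]) (auto simp: P_eq(1) intro!: continuous_intros)

lemma continuous_weighted:
  "continuous_on P (weighted_pd_v H x z)" "continuous_on P (weighted_pd_w H x z i)"
  unfolding weighted_pd_v_def[abs_def] weighted_pd_w_def[abs_def]
  by (intro continuous_on_mult continuous_\<mu>_P continuous_pd_lag)+

section \<open>Admissible perturbations and the vanishing first variation\<close>

definition test_function :: "('n pt \<Rightarrow> real) \<Rightarrow> ('n pt \<Rightarrow> 'n pt) \<Rightarrow> bool" where
  "test_function h G \<longleftrightarrow> gradient h G \<and> (\<forall>p\<in>frontier P. h p = 0)"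

text \<open>\<open>C1_close\<close> refers to \<open>frechet_derivative\<close>, which is a choice;
  derivatives within a nondegenerate box are unique, and this identifies the choice with the known
  gradient.\<close>

lemma frechet_derivative_P:
  assumes "gradient h G" "p \<in> P"
  shows "frechet_derivative h (at p within P) = (\<lambda>v. v \<bullet> G p)"
proof -
  have d: "(h has_derivative (\<lambda>v. v \<bullet> G p)) (at p within P)"
    using assms unfolding gradient_def by blast
  then have "(h has_derivative frechet_derivative h (at p within P)) (at p within P)"
    using frechet_derivative_works differentiable_def by blast
  with d show ?thesis
    using assms(2) lt_t lt_s unfolding P_eq(2)
    by (intro frechet_derivative_unique_within_closed_interval[of "(lo_t H, lo_s H)" "(hi_t H, hi_s
        H)"])
       (auto simp: Basis_prod_def Basis_vec_def inner_axis)
qed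

lemma test_C1_close:
  assumes h: "test_function h G" and "\<epsilon>0 > 0"
  obtains \<delta> where "\<delta> > 0" "\<And>\<epsilon>. \<bar>\<epsilon>\<bar> < \<delta> \<Longrightarrow> C1_close H \<epsilon>0 x (\<lambda>p. x p + \<epsilon> * h p)"
proof -
  have G: "gradient h G" using h by (simp add: test_function_def)
  have "bounded (h ` P)" "bounded (G ` P)"
    using G gradient_continuous(1)[OF G] compact_P unfolding gradient_def
    by (auto intro!: compact_imp_bounded compact_continuous_image)
  then obtain M N where M: "M > 0" "\<And>p. p \<in> P \<Longrightarrow> \<bar>h p\<bar> \<le> M" and N: "N > 0" "\<And>p. p \<in> P \<Longrightarrow> norm (G p) \<le> N"
    unfolding bounded_pos by auto
  show ?thesis
  proof (rule that[of "\<epsilon>0 / (M + N)"])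
    show "\<epsilon>0 / (M + N) > 0" using M N assms(2) by simp
    fix \<epsilon> assume e: "\<bar>\<epsilon>\<bar> < \<epsilon>0 / (M + N)"
    then have e': "\<bar>\<epsilon>\<bar> * (M + N) < \<epsilon>0" using M N by (simp add: pos_less_divide_eq)
    have "\<bar>\<epsilon>\<bar> * M \<le> \<bar>\<epsilon>\<bar> * (M + N)" "\<bar>\<epsilon>\<bar> * N \<le> \<bar>\<epsilon>\<bar> * (M + N)"
      using M N by (intro mult_left_mono; simp)+
    with e' have eM: "\<bar>\<epsilon>\<bar> * M < \<epsilon>0" "\<bar>\<epsilon>\<bar> * N < \<epsilon>0" by linarith+
    have g: "gradient (\<lambda>q. \<epsilon> * h q) (\<lambda>q. \<epsilon> *\<^sub>R G q)"
      using gradient_linear[of "\<lambda>_. 0" "\<lambda>_. 0" h G \<epsilon>] G by (simp add: gradient_def)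
    show "C1_close H \<epsilon>0 x (\<lambda>p. x p + \<epsilon> * h p)"
      unfolding C1_close_def
    proof (intro ballI conjI)
      fix p assume p: "p \<in> P"
      have "\<bar>\<epsilon>\<bar> * \<bar>h p\<bar> \<le> \<bar>\<epsilon>\<bar> * M" using M(2)[OF p] by (intro mult_left_mono) auto
      then show "\<bar>x p + \<epsilon> * h p - x p\<bar> < \<epsilon>0" using eM by (simp add: abs_mult)
      have "onorm (\<lambda>v. v \<bullet> (\<epsilon> *\<^sub>R G p)) \<le> \<bar>\<epsilon>\<bar> * norm (G p)"
      proof (rule onorm_le)
        fix v show "norm (v \<bullet> (\<epsilon> *\<^sub>R G p)) \<le> \<bar>\<epsilon>\<bar> * norm (G p) * norm v"
          using Cauchy_Schwarz_ineq2[of v "\<epsilon> *\<^sub>R G p"] by (simp add: mult_ac)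
      qed
      also have "\<dots> \<le> \<bar>\<epsilon>\<bar> * N" using N(2)[OF p] by (intro mult_left_mono) auto
      finally have "onorm (\<lambda>v. v \<bullet> (\<epsilon> *\<^sub>R G p)) < \<epsilon>0" using eM by linarith
      then show "onorm (frechet_derivative (\<lambda>q. x q + \<epsilon> * h q - x q) (at p within P)) < \<epsilon>0"
        by (simp add: frechet_derivative_P[OF g p])
    qed
  qed
qed

text \<open>The variation of the integrand through \<open>x\<close> and its Caputo derivatives; the
  response of \<open>z\<close> is accounted for by the multiplier.\<close>

definition lin :: "('n pt \<Rightarrow> real) \<Rightarrow> 'n pt \<Rightarrow> real" where
  "lin h p = h p * pd_x (Lag H) (lag p) + caputo_t H h p * pd_v (Lag H) (lag p)
    + (\<Sum>i\<in>UNIV. caputo_s H i h p * pd_w i (Lag H) (lag p))"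

text \<open>This is \<open>first_variation\<close> for the family \<open>x + \<epsilon> * h\<close>.
  As the Caputo operators are linear, the argument of the Lagrangian moves along a straight line in
  direction \<open>dir\<close>, and the deviation of \<open>z\<close> adds a multiple of the last
  unit vector \<open>e\<close>.\<close>

lemma variation_zero:
  assumes h: "test_function h G"
  shows "integral {lo_t H..T} (\<lambda>t. \<mu> t * integral \<Omega> (\<lambda>s. lin h (t, s))) = 0"
proof -
  obtain GL where "Lag_gradient GL" using ex_Lag_gradient by blast
  then have GL: "continuous_on (dom_L H) GL"
    "\<And>q. q \<in> dom_L H \<Longrightarrow> (Lag H has_derivative (\<lambda>v. v \<bullet> GL q)) (at q within dom_L H)"
    "\<And>q dx dv dw dr. q \<in> dom_L H \<Longrightarrow> (0, 0, dx, dv, dw, dr) \<bullet> GL q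
       = dx * pd_x (Lag H) q + dv * pd_v (Lag H) q + (\<Sum>i\<in>UNIV. dw $ i * pd_w i (Lag H) q) + dr *
           pd_z (Lag H) q"
    unfolding Lag_gradient_def by blast+
  have G: "gradient h G" and h0: "\<And>p. p \<in> frontier P \<Longrightarrow> h p = 0"
    using h by (auto simp: test_function_def)
  obtain Gx where Gx: "gradient x Gx" by (rule gradient_x)
  have reg: "continuous_on P (caputo_t H h)" "\<And>i. continuous_on P (caputo_s H i h)"
    using caputo_regularI[OF G] by (auto simp: caputo_regular_def)
  define dir :: "'n pt \<Rightarrow> 'n lag_arg" where
    "dir = (\<lambda>p. (0, 0, h p, caputo_t H h p, (\<chi> i. caputo_s H i h p), 0))"
  define e :: "'n lag_arg" where "e = (0, 0, 0, 0, 0, 1)"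
  define \<Lambda> where "\<Lambda> = (\<lambda>p \<epsilon> \<rho>. lag p + \<epsilon> *\<^sub>R dir p + \<rho> *\<^sub>R e)"
  have \<Lambda>_dom: "\<Lambda> p \<epsilon> \<rho> \<in> dom_L H" if "p \<in> P" for p \<epsilon> \<rho>
    using lag_in_dom[OF that] by (auto simp: \<Lambda>_def dir_def e_def dom_L_def)
  have cdir: "continuous_on P dir"
    unfolding dir_def by (intro continuous_intros reg gradient_continuous(1)[OF G])
  have c\<Lambda>: "continuous_on (P \<times> UNIV) (\<lambda>(p, \<epsilon>, \<rho>). \<Lambda> p \<epsilon> \<rho>)"
  proof -
    have "continuous_on (P \<times> (UNIV :: (real \<times> real) set)) (\<lambda>q. lag (fst q))"
      by (rule continuous_on_compose2[OF continuous_lag]) (auto intro!: continuous_intros)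
    moreover have "continuous_on (P \<times> (UNIV :: (real \<times> real) set)) (\<lambda>q. dir (fst q))"
      by (rule continuous_on_compose2[OF cdir]) (auto intro!: continuous_intros)
    ultimately show ?thesis
      unfolding \<Lambda>_def split_beta by (intro continuous_intros)
  qed
  have cGL: "continuous_on (P \<times> UNIV) (\<lambda>(p, \<epsilon>, \<rho>). GL (\<Lambda> p \<epsilon> \<rho>))"
    using continuous_on_compose2[OF GL(1) c\<Lambda>] \<Lambda>_dom by (force simp: split_beta)
  have cL: "continuous_on (P \<times> UNIV) (\<lambda>(p, \<epsilon>, \<rho>). Lag H (\<Lambda> p \<epsilon> \<rho>))"
    using continuous_on_compose2[OF has_derivative_continuous_on[OF GL(2)] c\<Lambda>] \<Lambda>_dom by (force simp:
        split_beta)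
  define \<phi>\<epsilon> where "\<phi>\<epsilon> = (\<lambda>p \<epsilon> \<rho>. dir p \<bullet> GL (\<Lambda> p \<epsilon> \<rho>))"
  define \<phi>\<rho> where "\<phi>\<rho> = (\<lambda>p \<epsilon> \<rho>. e \<bullet> GL (\<Lambda> p \<epsilon> \<rho>))"
  have c\<phi>: "continuous_on (P \<times> UNIV) (\<lambda>(p, \<epsilon>, \<rho>). \<phi>\<epsilon> p \<epsilon> \<rho>)" "continuous_on (P \<times> UNIV) (\<lambda>(p, \<epsilon>, \<rho>).
      \<phi>\<rho> p \<epsilon> \<rho>)"
  proof -
    have "continuous_on (P \<times> (UNIV :: (real \<times> real) set)) (\<lambda>q. dir (fst q))"
      by (rule continuous_on_compose2[OF cdir]) (auto intro!: continuous_intros)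
    with cGL show "continuous_on (P \<times> UNIV) (\<lambda>(p, \<epsilon>, \<rho>). \<phi>\<epsilon> p \<epsilon> \<rho>)"
      unfolding \<phi>\<epsilon>_def split_beta by (intro continuous_on_inner)
    from cGL show "continuous_on (P \<times> UNIV) (\<lambda>(p, \<epsilon>, \<rho>). \<phi>\<rho> p \<epsilon> \<rho>)"
      unfolding \<phi>\<rho>_def split_beta by (intro continuous_on_inner continuous_on_const)
  qed
  have der: "((\<lambda>(\<epsilon>, \<rho>). Lag H (\<Lambda> p \<epsilon> \<rho>)) has_derivative
      (\<lambda>(d\<epsilon>, d\<rho>). d\<epsilon> * \<phi>\<epsilon> p \<epsilon> \<rho> + d\<rho> * \<phi>\<rho> p \<epsilon> \<rho>)) (at (\<epsilon>, \<rho>))" if p: "p \<in> P" for p \<epsilon> \<rho>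
  proof -
    have 1: "((\<lambda>y. \<Lambda> p (fst y) (snd y)) has_derivative (\<lambda>y. fst y *\<^sub>R dir p + snd y *\<^sub>R e)) (at (\<epsilon>,
        \<rho>) within UNIV)"
      unfolding \<Lambda>_def by (auto intro!: derivative_eq_intros)
    have "((\<lambda>y. Lag H (\<Lambda> p (fst y) (snd y))) has_derivative
        (\<lambda>y. (fst y *\<^sub>R dir p + snd y *\<^sub>R e) \<bullet> GL (\<Lambda> p (fst (\<epsilon>, \<rho>)) (snd (\<epsilon>, \<rho>))))) (at (\<epsilon>, \<rho>)
            within UNIV)"
      by (rule has_derivative_in_compose2[OF GL(2) _ _ 1]) (use \<Lambda>_dom[OF p] in auto)
    then show ?thesis
      by (simp add: split_beta' \<phi>\<epsilon>_def \<phi>\<rho>_def inner_add_left)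
  qed
  define f where "f = (\<lambda>\<epsilon> t r. integral \<Omega> (\<lambda>s. Lag H (\<Lambda> (t, s) \<epsilon> (r - z t))))"
  have z': "(z has_real_derivative f 0 t (z t)) (at t within It)" if "t \<in> It" for t
    using z_derivative[OF that] by (simp add: f_def \<Lambda>_def)
  obtain \<epsilon>0 \<sigma> :: real where \<epsilon>0: "\<epsilon>0 > 0" and \<sigma>: "\<sigma> \<noteq> 0"
    and ex: "\<And>y w \<tau>. admissible H y w \<Longrightarrow> \<tau> \<in> {lo_t H<..hi_t H} \<Longrightarrow> C1_close H \<epsilon>0 x y \<Longrightarrow> \<bar>\<tau> - T\<bar> < \<epsilon>0
      \<Longrightarrow> \<sigma> * z T \<le> \<sigma> * w \<tau>"
    by (rule extremizer_signed) (rule that)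
  obtain \<delta> where \<delta>: "\<delta> > 0" "\<And>\<epsilon>. \<bar>\<epsilon>\<bar> < \<delta> \<Longrightarrow> C1_close H \<epsilon>0 x (\<lambda>p. x p + \<epsilon> * h p)"
    using test_C1_close[OF h \<epsilon>0] by blast
  \<comment> \<open>Every solution of the perturbed equation belongs to an admissible competitor:
    the boundary values are kept because \<open>h\<close> vanishes on the frontier, and the initial
    value because \<open>w\<close> starts where \<open>z\<close> does.\<close>
  have adm_w: "admissible H (\<lambda>p. x p + \<epsilon> * h p) w"
    if w: "w (lo_t H) = z (lo_t H)" "\<And>t. t \<in> It \<Longrightarrow> (w has_real_derivative f \<epsilon> t (w t)) (at t within
        It)" for \<epsilon> w
  proof -
    let ?y = "\<lambda>p. x p + \<epsilon> * h p"
    have gy: "gradient ?y (\<lambda>p. Gx p + \<epsilon> *\<^sub>R G p)" by (rule gradient_linear[OF Gx G])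
    have "lag_at H ?y w (t, s) = \<Lambda> (t, s) \<epsilon> (w t - z t)" if "t \<in> It" "s \<in> \<Omega>" for t s
    proof -
      have p: "(t, s) \<in> P" using that by (simp add: P_eq(1))
      show ?thesis
        using caputo_t_linear[OF Gx G p, of \<epsilon>] caputo_s_linear[OF Gx G p, of _ \<epsilon>]
        by (simp add: lag_at_def \<Lambda>_def dir_def e_def vec_eq_iff)
    qed
    then have "f \<epsilon> t (w t) = integral \<Omega> (\<lambda>s. Lag H (lag_at H ?y w (t, s)))" if "t \<in> It" for t
      unfolding f_def using that by (intro integral_cong) simp
    moreover have "C1_on P ?y"
      using gy unfolding gradient_def by (intro C1_onI_gradient) auto
    moreover have "\<forall>p\<in>frontier P. ?y p = bdry H p"
      using adm h0 by (simp add: admissible_def)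
    moreover have "w (lo_t H) = z_init H"
      using w(1) adm by (simp add: admissible_def)
    ultimately show ?thesis
      using w(2) caputo_regularI[OF gy] unfolding admissible_def by simp
  qed
  have ex': "\<sigma> * z T \<le> \<sigma> * w T" if "\<bar>\<epsilon>\<bar> < \<delta>" "w (lo_t H) = z (lo_t H)"
      "\<And>t. t \<in> It \<Longrightarrow> (w has_real_derivative f \<epsilon> t (w t)) (at t within It)" for \<epsilon> w
    using that T \<epsilon>0 \<delta>(2) by (intro ex[of "\<lambda>p. x p + \<epsilon> * h p"] adm_w) auto
  have Tmem: "T \<in> It" using T by simp
  have res: "integral {lo_t H..T} (\<lambda>t. exp (- integral {lo_t H..t} (\<lambda>\<tau>. integral \<Omega> (\<lambda>s. \<phi>\<rho> (\<tau>, s) 0 0)))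
      * integral \<Omega> (\<lambda>s. \<phi>\<epsilon> (t, s) 0 0)) = 0"
  proof (rule first_variation[where \<phi> = "\<lambda>p \<epsilon> \<rho>. Lag H (\<Lambda> p \<epsilon> \<rho>)",
        OF der[unfolded P_eq(1)] cL[unfolded P_eq(1)] c\<phi>(1)[unfolded P_eq(1)]
          c\<phi>(2)[unfolded P_eq(1)] z'[unfolded f_def] Tmem \<delta>(1) \<sigma>])
    fix \<epsilon> w
    assume "\<bar>\<epsilon>\<bar> < \<delta>" "w (lo_t H) = z (lo_t H)" and w: "\<And>t. t \<in> It \<Longrightarrow> (w has_real_derivative
        integral \<Omega> (\<lambda>s. Lag H (\<Lambda> (t, s) \<epsilon> (w t - z t)))) (at t within It)"
    then show "\<sigma> * z T \<le> \<sigma> * w T" by (rule ex'[unfolded f_def])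
  qed
  have \<Lambda>0: "\<Lambda> p 0 0 = lag p" for p by (simp add: \<Lambda>_def)
  have "\<phi>\<rho> p 0 0 = pd_z (Lag H) (lag p)" if "p \<in> P" for p
    using GL(3)[OF lag_in_dom[OF that], of 0 0 0 1] by (simp add: \<phi>\<rho>_def \<Lambda>0 e_def)
  then have A: "integral \<Omega> (\<lambda>s. \<phi>\<rho> (\<tau>, s) 0 0) = integral \<Omega> (\<lambda>s. pd_z (Lag H) (lag (\<tau>, s)))" if "\<tau> \<in>
      It" for \<tau>
    using that by (intro integral_cong) (simp add: P_eq(1))
  have 1: "exp (- integral {lo_t H..t} (\<lambda>\<tau>. integral \<Omega> (\<lambda>s. \<phi>\<rho> (\<tau>, s) 0 0))) = \<mu> t" if "t \<in> {lo_t
      H..T}" for t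
    unfolding multiplier_def
    by (subst integral_cong[OF A]) (use that T in auto)
  have "\<phi>\<epsilon> p 0 0 = lin h p" if "p \<in> P" for p
    using GL(3)[OF lag_in_dom[OF that]] by (simp add: \<phi>\<epsilon>_def \<Lambda>0 dir_def lin_def)
  then have 2: "integral \<Omega> (\<lambda>s. \<phi>\<epsilon> (t, s) 0 0) = integral \<Omega> (\<lambda>s. lin h (t, s))" if "t \<in> {lo_t H..T}"
      for t
    using that T by (intro integral_cong) (simp add: P_eq(1))
  have "integral {lo_t H..T} (\<lambda>t. exp (- integral {lo_t H..t} (\<lambda>\<tau>. integral \<Omega> (\<lambda>s. \<phi>\<rho> (\<tau>, s) 0 0)))
      * integral \<Omega> (\<lambda>s. \<phi>\<epsilon> (t, s) 0 0)) = integral {lo_t H..T} (\<lambda>t. \<mu> t * integral \<Omega> (\<lambda>s. lin h (t,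
          s)))"
    using 1 2 by (intro integral_cong) simp
  with res show ?thesis by simp
qed

end

section \<open>Weak form\<close>

context herglotz_extremal
begin

abbreviation "Fv \<equiv> weighted_pd_v H x z"
abbreviation "Fw i \<equiv> weighted_pd_w H x z i"

text \<open>Based at \<open>T\<close>, where the time integration of the variation stops, yet used
  on all of \<open>P\<close>: the right Caputo operator at a time before \<open>T\<close> also sees
  \<open>h\<close> after \<open>T\<close>.\<close>

definition Gt :: "'n pt \<Rightarrow> real" where
  "Gt p = dual_int (lo_t H) T (weight_t H) (ord_l_t H) (ord_r_t H) (slice_t Fv (snd p)) (fst p)"

text \<open>With \<open>hi_s H $ i\<close> as the base point, the subtracted left integral inside
  \<open>dual_int\<close> vanishes on the whole edge, which leaves the usual adjoint.\<close>

definition Gs :: "'n \<Rightarrow> 'n pt \<Rightarrow> real" where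
  "Gs i p = dual_int (lo_s H $ i) (hi_s H $ i) (weight_s H i) (ord_l_s H i) (ord_r_s H i)
     (slice_s i (Fw i) (fst p) (snd p)) (snd p $ i)"

lemma T_mem: "T \<in> It"
  using T by simp

lemma continuous_G: "continuous_on P Gt" "continuous_on P (Gs i)"
proof -
  have "continuous_on (It \<times> \<Omega>) (\<lambda>(u, s). dual_int (lo_t H) T (weight_t H) (ord_l_t H) (ord_r_t H)
      (\<lambda>v. Fv (v, s)) u)"
    using continuous_weighted(1)
    by (intro continuous_on_dual_int ord_t T_mem compact_cbox) (simp add: P_eq(1) case_prod_eta)
  then show "continuous_on P Gt"
    by (simp add: P_eq(1) Gt_def[abs_def] slice_t_def split_beta')
  have "continuous_on ({lo_s H $ i..hi_s H $ i} \<times> P) (\<lambda>(u, y). dual_int (lo_s H $ i) (hi_s H $ i)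
      (weight_s H i) (ord_l_s H i) (ord_r_s H i) (\<lambda>v. Fw i (fst y, coord_upd (snd y) i v)) u)"
    using lt_s[of i]
    by (intro continuous_on_dual_int ord_s compact_P continuous_on_coord_slice continuous_weighted) auto
  from continuous_on_at_coord[OF this] show "continuous_on P (Gs i)"
    by (simp add: Gs_def[abs_def] slice_s_def)
qed

lemma continuous_section_\<Omega>:
  assumes "continuous_on P (f :: 'n pt \<Rightarrow> real)" "t \<in> It"
  shows "continuous_on \<Omega> (\<lambda>s. f (t, s))"
  by (rule continuous_on_compose2[OF assms(1)]) (use assms(2) in \<open>auto simp: P_eq(1) intro!:
      continuous_intros\<close>)

lemma integrable_section:
  "continuous_on P (f :: 'n pt \<Rightarrow> real) \<Longrightarrow> t \<in> It \<Longrightarrow> (\<lambda>s. f (t, s)) integrable_on \<Omega>"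
  by (intro integrable_continuous continuous_section_\<Omega>)

text \<open>\<open>integral_coord_average\<close> passes to the lines in direction \<open>i\<close>,
  where the one-dimensional adjoint identity holds, and then back to the box.\<close>

lemma spatial_by_parts:
  assumes G: "gradient h G" and t: "t \<in> It"
  shows "integral \<Omega> (\<lambda>s. Fw i (t, s) * caputo_s H i h (t, s)) = integral \<Omega> (\<lambda>s. snd (G (t, s)) $ i *
      Gs i (t, s))"
proof -
  let ?l = "lo_s H $ i" and ?h = "hi_s H $ i"
  have reg: "continuous_on P (caputo_s H i h)"
    using caputo_regularI[OF G] by (simp add: caputo_regular_def)
  have "integral \<Omega> (\<lambda>s. Fw i (t, s) * caputo_s H i h (t, s))
      = integral \<Omega> (\<lambda>s. integral {?l..?h} (\<lambda>\<sigma>. Fw i (t, coord_upd s i \<sigma>) * caputo_s H i h (t,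
          coord_upd s i \<sigma>))) / (?h - ?l)"
    by (rule integral_coord_average[OF continuous_section_\<Omega>[OF continuous_on_mult[OF
        continuous_weighted(2) reg] t] lt_s])
  also have "\<dots> = integral \<Omega> (\<lambda>s. integral {?l..?h} (\<lambda>\<sigma>. snd (G (t, coord_upd s i \<sigma>)) $ i * Gs i (t,
      coord_upd s i \<sigma>))) / (?h - ?l)"
  proof (intro arg_cong2[where f = "(/)"] refl, rule integral_cong)
    fix s assume s: "s \<in> \<Omega>"
    have p: "(t, s) \<in> P" using t s by (simp add: P_eq(1))
    have "integral {?l..?h} (\<lambda>\<sigma>. Fw i (t, coord_upd s i \<sigma>) * caputo_s H i h (t, coord_upd s i \<sigma>))
        = integral {?l..?h} (\<lambda>\<sigma>. Fw i (t, coord_upd s i \<sigma>) * op_s i (\<lambda>\<sigma>. snd (G (t, coord_upd s i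
            \<sigma>)) $ i) \<sigma>)"
    proof (rule integral_cong)
      fix \<sigma> assume "\<sigma> \<in> {?l..?h}"
      then have "(t, coord_upd s i \<sigma>) \<in> P" using p by (simp add: P_eq(1) coord_upd_in_cbox)
      from caputo_s_eq[OF G this, of i]
      show "Fw i (t, coord_upd s i \<sigma>) * caputo_s H i h (t, coord_upd s i \<sigma>)
          = Fw i (t, coord_upd s i \<sigma>) * op_s i (\<lambda>\<sigma>. snd (G (t, coord_upd s i \<sigma>)) $ i) \<sigma>" by simp
    qed
    also have "\<dots> = integral {?l..?h} (\<lambda>\<sigma>. snd (G (t, coord_upd s i \<sigma>)) $ i *
        dual_int ?l ?h (weight_s H i) (ord_l_s H i) (ord_r_s H i) (\<lambda>\<sigma>. Fw i (t, coord_upd s i \<sigma>)) \<sigma>)"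
      using lt_s[of i]
      by (intro comb_int_by_parts ord_s continuous_slice_s[OF continuous_weighted(2) p]
          continuous_slice_s[OF gradient_continuous(3)[OF G] p]) auto
    also have "\<dots> = integral {?l..?h} (\<lambda>\<sigma>. snd (G (t, coord_upd s i \<sigma>)) $ i * Gs i (t, coord_upd s i \<sigma>))"
      by (simp add: Gs_def slice_s_def)
    finally show "integral {?l..?h} (\<lambda>\<sigma>. Fw i (t, coord_upd s i \<sigma>) * caputo_s H i h (t, coord_upd s
        i \<sigma>))
        = integral {?l..?h} (\<lambda>\<sigma>. snd (G (t, coord_upd s i \<sigma>)) $ i * Gs i (t, coord_upd s i \<sigma>))" .
  qed
  also have "\<dots> = integral \<Omega> (\<lambda>s. snd (G (t, s)) $ i * Gs i (t, s))"
    by (rule integral_coord_average[OF continuous_section_\<Omega>[OF continuous_on_mult[OF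
            gradient_continuous(3)[OF G] continuous_G(2)] t] lt_s, symmetric])
  finally show ?thesis .
qed

lemma integral_swap_P:
  assumes f: "continuous_on P (f :: 'n pt \<Rightarrow> real)" and c: "{c..d} \<subseteq> It"
  shows "integral {c..d} (\<lambda>t. integral \<Omega> (\<lambda>s. f (t, s))) = integral \<Omega> (\<lambda>s. integral {c..d} (\<lambda>t. f
      (t, s)))"
proof -
  have "continuous_on (cbox (c, lo_s H) (d, hi_s H)) (\<lambda>(t, s). f (t, s))"
    unfolding case_prod_eta by (rule continuous_on_subset[OF f]) (use c in \<open>auto simp: P_eq(1)
        cbox_Pair_eq\<close>)
  from integral_swap_continuous[OF this] show ?thesis by simp
qed

text \<open>The left side stops at \<open>T\<close> while the right one runs over all times, because
  \<open>comb_int_by_parts\<close> cuts off the factor \<open>Fv\<close> and not the derivative of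
  \<open>h\<close>.\<close>

lemma temporal_by_parts:
  assumes G: "gradient h G"
  shows "integral {lo_t H..T} (\<lambda>t. integral \<Omega> (\<lambda>s. Fv (t, s) * caputo_t H h (t, s)))
    = integral \<Omega> (\<lambda>s. integral It (\<lambda>\<tau>. fst (G (\<tau>, s)) * Gt (\<tau>, s)))"
proof -
  have reg: "continuous_on P (caputo_t H h)"
    using caputo_regularI[OF G] by (simp add: caputo_regular_def)
  have "integral {lo_t H..T} (\<lambda>t. integral \<Omega> (\<lambda>s. Fv (t, s) * caputo_t H h (t, s)))
      = integral \<Omega> (\<lambda>s. integral {lo_t H..T} (\<lambda>t. Fv (t, s) * caputo_t H h (t, s)))"
    using T by (intro integral_swap_P[OF continuous_on_mult[OF continuous_weighted(1) reg]]) auto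
  also have "\<dots> = integral \<Omega> (\<lambda>s. integral It (\<lambda>\<tau>. fst (G (\<tau>, s)) * Gt (\<tau>, s)))"
  proof (rule integral_cong)
    fix s assume s: "s \<in> \<Omega>"
    have "integral {lo_t H..T} (\<lambda>t. Fv (t, s) * caputo_t H h (t, s))
        = integral {lo_t H..T} (\<lambda>t. Fv (t, s) * op_t (\<lambda>\<tau>. fst (G (\<tau>, s))) t)"
      using s T by (intro integral_cong) (simp add: caputo_t_eq[OF G] P_eq(1))
    also have "\<dots> = integral It (\<lambda>\<tau>. fst (G (\<tau>, s)) *
        dual_int (lo_t H) T (weight_t H) (ord_l_t H) (ord_r_t H) (\<lambda>\<tau>. Fv (\<tau>, s)) \<tau>)"
      by (intro comb_int_by_parts ord_t T_mem continuous_slice_t[OF continuous_weighted(1) s]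
          continuous_slice_t[OF gradient_continuous(2)[OF G] s])
    finally show "integral {lo_t H..T} (\<lambda>t. Fv (t, s) * caputo_t H h (t, s))
        = integral It (\<lambda>\<tau>. fst (G (\<tau>, s)) * Gt (\<tau>, s))"
      by (simp add: Gt_def slice_t_def)
  qed
  finally show ?thesis .
qed

text \<open>Time and space behave differently: the terms with spatial derivatives are integrated up
  to \<open>T\<close>, the one with the time derivative over all times. The latter carries all the
  information about times after \<open>T\<close>.\<close>

theorem weak_form:
  assumes h: "test_function h G"
  shows "integral {lo_t H..T} (\<lambda>t. integral \<Omega> (\<lambda>s. \<mu> t * pd_x (Lag H) (lag (t, s)) * h (t, s)
      + (\<Sum>i\<in>UNIV. snd (G (t, s)) $ i * Gs i (t, s))))
    + integral \<Omega> (\<lambda>s. integral It (\<lambda>\<tau>. fst (G (\<tau>, s)) * Gt (\<tau>, s))) = 0"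
proof -
  have G: "gradient h G" using h by (simp add: test_function_def)
  have sub: "{lo_t H..T} \<subseteq> It" using T by auto
  have reg: "continuous_on P (caputo_t H h)" "\<And>i. continuous_on P (caputo_s H i h)"
    using caputo_regularI[OF G] by (auto simp: caputo_regular_def)
  define A where "A = (\<lambda>p. \<mu> (fst p) * pd_x (Lag H) (lag p) * h p)"
  have cA: "continuous_on P A"
    unfolding A_def by (intro continuous_on_mult continuous_\<mu>_P continuous_pd_lag
        gradient_continuous(1)[OF G])
  have cV: "continuous_on P (\<lambda>p. Fv p * caputo_t H h p)"
    by (intro continuous_on_mult continuous_weighted reg)
  have cW: "continuous_on P (\<lambda>p. Fw i p * caputo_s H i h p)" for i
    by (intro continuous_on_mult continuous_weighted reg)
  have cS: "continuous_on P (\<lambda>p. snd (G p) $ i * Gs i p)" for i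
    by (intro continuous_on_mult gradient_continuous(3)[OF G] continuous_G)
  have step: "\<mu> t * integral \<Omega> (\<lambda>s. lin h (t, s))
    = integral \<Omega> (\<lambda>s. A (t, s) + (\<Sum>i\<in>UNIV. snd (G (t, s)) $ i * Gs i (t, s)))
      + integral \<Omega> (\<lambda>s. Fv (t, s) * caputo_t H h (t, s))" if "t \<in> {lo_t H..T}" for t
  proof -
    have t: "t \<in> It" using that T by auto
    have "\<mu> t * integral \<Omega> (\<lambda>s. lin h (t, s))
      = integral \<Omega> (\<lambda>s. \<mu> t * (lin h (t, s)))"
      by simp
    also have "\<dots> = integral \<Omega> (\<lambda>s. (A (t, s) + Fv (t, s) * caputo_t H h (t, s))
        + (\<Sum>i\<in>UNIV. Fw i (t, s) * caputo_s H i h (t, s)))"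
      by (simp add: A_def lin_def weighted_pd_v_def weighted_pd_w_def distrib_left sum_distrib_left
          mult_ac)
    also have "\<dots> = integral \<Omega> (\<lambda>s. A (t, s)) + integral \<Omega> (\<lambda>s. Fv (t, s) * caputo_t H h (t, s))
        + (\<Sum>i\<in>UNIV. integral \<Omega> (\<lambda>s. Fw i (t, s) * caputo_s H i h (t, s)))"
      by (simp only: integral_add[OF integrable_add[OF integrable_section[OF cA t]
          integrable_section[OF cV t]]
            integrable_sum[OF finite integrable_section[OF cW t]]]
          integral_add[OF integrable_section[OF cA t] integrable_section[OF cV t]] integral_sum[OF
              finite integrable_section[OF cW t]])
    also have "\<dots> = integral \<Omega> (\<lambda>s. A (t, s)) + integral \<Omega> (\<lambda>s. Fv (t, s) * caputo_t H h (t, s))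
        + (\<Sum>i\<in>UNIV. integral \<Omega> (\<lambda>s. snd (G (t, s)) $ i * Gs i (t, s)))"
      by (simp add: spatial_by_parts[OF G t])
    also have "\<dots> = integral \<Omega> (\<lambda>s. A (t, s) + (\<Sum>i\<in>UNIV. snd (G (t, s)) $ i * Gs i (t, s)))
        + integral \<Omega> (\<lambda>s. Fv (t, s) * caputo_t H h (t, s))"
      by (simp add: integral_add[OF integrable_section[OF cA t] integrable_sum[OF finite
          integrable_section[OF cS t]]]
          integral_sum[OF finite integrable_section[OF cS t]])
    finally show ?thesis .
  qed
  have i: "(\<lambda>t. integral \<Omega> (\<lambda>s. A (t, s) + (\<Sum>i\<in>UNIV. snd (G (t, s)) $ i * Gs i (t, s))))
      integrable_on {lo_t H..T}"
      "(\<lambda>t. integral \<Omega> (\<lambda>s. Fv (t, s) * caputo_t H h (t, s))) integrable_on {lo_t H..T}"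
    using continuous_integral_\<Omega>[OF continuous_on_add[OF cA continuous_on_sum[OF cS]]]
        continuous_integral_\<Omega>[OF cV]
    by (auto intro!: integrable_continuous_real continuous_on_subset[OF _ sub])
  have "0 = integral {lo_t H..T} (\<lambda>t. \<mu> t * integral \<Omega> (\<lambda>s. lin h (t, s)))"
    using variation_zero[OF h] by simp
  also have "\<dots> = integral {lo_t H..T} (\<lambda>t. integral \<Omega> (\<lambda>s. A (t, s) + (\<Sum>i\<in>UNIV. snd (G (t, s)) $ i *
      Gs i (t, s)))
      + integral \<Omega> (\<lambda>s. Fv (t, s) * caputo_t H h (t, s)))"
    by (rule integral_cong) (rule step)
  also have "\<dots> = integral {lo_t H..T} (\<lambda>t. integral \<Omega> (\<lambda>s. A (t, s) + (\<Sum>i\<in>UNIV. snd (G (t, s)) $ i *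
      Gs i (t, s))))
      + integral {lo_t H..T} (\<lambda>t. integral \<Omega> (\<lambda>s. Fv (t, s) * caputo_t H h (t, s)))"
    by (rule integral_add[OF i])
  finally show ?thesis
    unfolding temporal_by_parts[OF G] by (simp add: A_def)
qed

end

section \<open>Euler--Lagrange equation before \<open>T\<close>\<close>

lemma frac_left_before: "u \<le> c \<Longrightarrow> frac_left c \<delta> f u = 0"
  by (cases "u = c") (simp_all add: frac_left_def)

lemma frac_right_after: "c \<le> u \<Longrightarrow> frac_right c \<delta> f u = 0"
  by (cases "u = c") (simp_all add: frac_right_def)

text \<open>Before \<open>c\<close> the left integral from \<open>c\<close> is 0, so the derivative
  of \<open>dual_int\<close> is minus the dual derivative. A summand of weight 0 is treated
  separately, as its fractional integral need not be differentiable.\<close>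

lemma dual_int_derivative:
  assumes t: "lo < t" "t < c" and ex: "dual_RL_exists lo c (prod.swap \<gamma>) \<beta> \<alpha> f t"
  shows "(dual_int lo c \<gamma> \<alpha> \<beta> f has_real_derivative - dual_RL lo c (prod.swap \<gamma>) \<beta> \<alpha> f t) (at t)"
proof -
  have at: "at t within {lo..c} = at t" using t by (rule at_within_Icc_at)
  have l: "((\<lambda>v. snd \<gamma> * frac_left lo \<beta> f v) has_real_derivative snd \<gamma> * RL_left lo c \<beta> f t) (at t)"
  proof (cases "snd \<gamma> = 0")
    case False
    then have "frac_left lo \<beta> f differentiable (at t within {lo..c})"
      using ex by (simp add: dual_RL_exists_def)
    then have "(frac_left lo \<beta> f has_real_derivative RL_left lo c \<beta> f t) (at t)"
      unfolding RL_left_def vector_derivative_works has_real_derivative_iff_has_vector_derivative at .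
    then show ?thesis by (rule DERIV_cmult)
  qed simp
  have r: "((\<lambda>v. fst \<gamma> * frac_right c \<alpha> f v) has_real_derivative - (fst \<gamma> * RL_right lo c \<alpha> f t))
      (at t)"
  proof (cases "fst \<gamma> = 0")
    case False
    then have "frac_right c \<alpha> f differentiable (at t within {lo..c})"
      using ex by (simp add: dual_RL_exists_def)
    then have "(frac_right c \<alpha> f has_real_derivative - RL_right lo c \<alpha> f t) (at t)"
      unfolding RL_right_def vector_derivative_works has_real_derivative_iff_has_vector_derivative
          at minus_minus .
    then show ?thesis using DERIV_cmult[of _ "- RL_right lo c \<alpha> f t" _ _ "fst \<gamma>"] by simp
  qed simp
  have "((\<lambda>v. fst \<gamma> * frac_right c \<alpha> f v - snd \<gamma> * frac_left lo \<beta> f v) has_real_derivative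
      - dual_RL lo c (prod.swap \<gamma>) \<beta> \<alpha> f t) (at t)"
    using DERIV_diff[OF r l] by (simp add: dual_RL_def algebra_simps)
  then show ?thesis
    by (rule has_field_derivative_transform_within_open[of _ _ _ "{..<c}"])
       (use t in \<open>auto simp: dual_int_def frac_left_before\<close>)
qed

lemma box_Pair_eq: "box (a, c) (b, d) = box a b \<times> box c d"
  by (metis cbox_Pair_eq interior_Times interior_cbox)

context herglotz_extremal
begin

abbreviation "Dt \<equiv> dual_t H T Fv"
abbreviation "Ds i \<equiv> dual_s H i (Fw i)"
abbreviation "PT \<equiv> cbox (lo_t H, lo_s H) (T, hi_s H)"
abbreviation "U \<equiv> box (lo_t H, lo_s H) (T, hi_s H)"

lemma P_T_subset: "PT \<subseteq> P" "U \<subseteq> P"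
  using T box_subset_cbox[of "(lo_t H, lo_s H)" "(T, hi_s H)"] unfolding P_eq(1) cbox_Pair_eq by auto

lemma U_eq: "U = {lo_t H<..<T} \<times> box (lo_s H) (hi_s H)"
  by (simp add: box_Pair_eq)

lemma G_t_derivative:
  assumes "dual_regular H x z T R" "U \<subseteq> R" "(\<tau>, s) \<in> U"
  shows "((\<lambda>\<tau>. Gt (\<tau>, s)) has_real_derivative - Dt (\<tau>, s)) (at \<tau>)"
proof -
  have "dual_RL_exists (lo_t H) T (prod.swap (weight_t H)) (ord_r_t H) (ord_l_t H) (slice_t Fv s) \<tau>"
    using assms unfolding dual_regular_def by blast
  from dual_int_derivative[OF _ _ this] show ?thesis
    using assms(3) by (simp add: U_eq Gt_def dual_t_def)
qed

lemma G_s_derivative: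
  assumes "dual_regular H x z T R" "U \<subseteq> R" "(t, coord_upd s i \<sigma>) \<in> U"
  shows "((\<lambda>\<sigma>. Gs i (t, coord_upd s i \<sigma>)) has_real_derivative - Ds i (t, coord_upd s i \<sigma>)) (at \<sigma>)"
proof -
  \<comment> \<open>The line through a point in direction \<open>i\<close> does not depend on the
    \<open>i\<close>-th coordinate of that point.\<close>
  have sl: "slice_s i f t (coord_upd s i \<sigma>') = slice_s i f t s" for f \<sigma>'
    by (simp add: slice_s_def)
  have "dual_RL_exists (lo_s H $ i) (hi_s H $ i) (prod.swap (weight_s H i)) (ord_r_s H i) (ord_l_s H i)
      (slice_s i (Fw i) t (coord_upd s i \<sigma>)) (coord_upd s i \<sigma> $ i)"
    using assms unfolding dual_regular_def by blast
  then have ex: "dual_RL_exists (lo_s H $ i) (hi_s H $ i) (prod.swap (weight_s H i)) (ord_r_s H i)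
      (ord_l_s H i)
      (slice_s i (Fw i) t s) \<sigma>" by (simp add: sl)
  have "lo_s H $ i < \<sigma>" "\<sigma> < hi_s H $ i"
    using assms(3) by (auto simp: U_eq mem_box_cart split: if_splits)
  from dual_int_derivative[OF this ex] show ?thesis
    by (simp add: Gs_def dual_s_def sl)
qed

lemma bump_test_function:
  assumes "ball p0 r \<subseteq> U" "0 < r"
  shows "test_function (bump p0 r) (bump_grad p0 r)"
  unfolding test_function_def gradient_def
proof (intro conjI ballI continuous_on_bump bump_has_derivative)
  fix p assume "p \<in> frontier P"
  moreover have "U \<subseteq> interior P" by (rule interior_maximal[OF P_T_subset(2) open_box])
  ultimately have "p \<notin> ball p0 r" using assms(1) by (auto simp: frontier_def)
  then show "bump p0 r p = 0" using assms(2) by (intro bump_outside) auto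
qed

text \<open>The weak form pairs derivatives of the bump with the adjoints. On the support of the
  bump the adjoints are differentiable along coordinate lines, so integrating by parts on each line
  moves the derivatives back and leaves the bump times the left side of the equation.\<close>

theorem Euler_Lagrange_open:
  assumes reg: "dual_regular H x z T R" and R: "U \<subseteq> R" and p: "p \<in> U"
  shows "pd_x (Lag H) (lag p) * \<mu> (fst p) + Dt p + (\<Sum>i\<in>UNIV. Ds i p) = 0"
proof (rule fundamental_lemma_bump[OF _ p])
  have cD: "continuous_on U Dt" "continuous_on U (Ds i)" for i
    using reg R unfolding dual_regular_def by (auto intro: continuous_on_subset)
  have cE: "continuous_on U (\<lambda>p. pd_x (Lag H) (lag p) * \<mu> (fst p))"
    by (rule continuous_on_subset[OF continuous_on_mult[OF continuous_pd_lag(1) continuous_\<mu>_P]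
        P_T_subset(2)])
  show "continuous_on U (\<lambda>p. pd_x (Lag H) (lag p) * \<mu> (fst p) + Dt p + (\<Sum>i\<in>UNIV. Ds i p))"
    by (intro continuous_on_add continuous_on_sum cD cE)
  fix p0 :: "'n pt" and r :: real and q1 q2 :: "'n pt"
  assume r: "0 < r" and bq: "ball p0 r \<subseteq> cbox q1 q2" and qU: "cbox q1 q2 \<subseteq> U"
  let ?h = "bump p0 r" and ?G = "bump_grad p0 r"
  have bU: "ball p0 r \<subseteq> U" using bq qU by blast
  have h: "test_function ?h ?G" by (rule bump_test_function[OF bU r])
  then have G: "gradient ?h ?G" by (simp add: test_function_def)
  have out: "?h p = 0" "?G p = 0" if "p \<notin> cbox q1 q2" for p
    using that bq r by (auto intro!: bump_outside)
  \<comment> \<open>Nothing is known about the dual derivatives off \<open>U\<close>; multiplication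
    by the bump makes them continuous everywhere.\<close>
  have chD: "continuous_on S (\<lambda>p. ?h p * D p)" if "continuous_on U D" for D S
    by (rule continuous_on_bump_mult[OF open_box that bq closed_cbox qU]) (use r in simp)
  \<comment> \<open>The bump vanishes near and after \<open>T\<close>, so the integral over all
    times reduces to one over \<open>[lo_t H, T]\<close>, where the dual derivative lives.\<close>
  have t_part: "integral It (\<lambda>\<tau>. fst (?G (\<tau>, s)) * Gt (\<tau>, s)) = integral {lo_t H..T} (\<lambda>\<tau>. ?h (\<tau>, s)
      * Dt (\<tau>, s))"
    if s: "s \<in> \<Omega>" for s
  proof -
    have i1: "(\<lambda>\<tau>. fst (?G (\<tau>, s)) * Gt (\<tau>, s)) integrable_on It"
      by (intro integrable_continuous_real continuous_slice_t[OF _ s] continuous_on_mult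
          gradient_continuous(2)[OF G] continuous_G)
    have c2: "continuous_on S (\<lambda>\<tau>. ?h (\<tau>, s) * Dt (\<tau>, s))" for S
      by (rule continuous_on_compose2[OF chD[OF cD(1), of UNIV]]) (auto intro!: continuous_intros)
    have "integral It (\<lambda>\<tau>. ((1, 0) \<bullet> ?G (\<tau>, s)) * Gt (\<tau>, s) - ?h (\<tau>, s) * Dt (\<tau>, s)) = 0"
    proof (rule bump_by_parts_along_curve[OF r bq])
      show "((\<lambda>\<tau>. (\<tau>, s)) has_vector_derivative (1, 0)) (at \<tau>)" for \<tau>
        by (auto intro!: derivative_eq_intros simp: has_vector_derivative_def)
      show "((\<lambda>\<tau>. Gt (\<tau>, s)) has_real_derivative - Dt (\<tau>, s)) (at \<tau>)" if "(\<tau>, s) \<in> cbox q1 q2" for \<tau>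
        using G_t_derivative[OF reg R] that qU by blast
      show "(lo_t H, s) \<notin> cbox q1 q2" "(hi_t H, s) \<notin> cbox q1 q2"
        using qU T by (auto simp: U_eq)
    qed (use lt_t in simp)
    then have "integral It (\<lambda>\<tau>. fst (?G (\<tau>, s)) * Gt (\<tau>, s)) = integral It (\<lambda>\<tau>. ?h (\<tau>, s) * Dt (\<tau>, s))"
      by (simp add: inner_prod_def integral_diff[OF i1 integrable_continuous_real[OF c2]])
    also have "((\<lambda>\<tau>. ?h (\<tau>, s) * Dt (\<tau>, s)) has_integral integral {lo_t H..T} (\<lambda>\<tau>. ?h (\<tau>, s) * Dt
        (\<tau>, s))) It"
    proof (rule has_integral_on_superset[OF integrable_integral[OF integrable_continuous_real[OF c2]]])
      show "?h (\<tau>, s) * Dt (\<tau>, s) = 0" if "\<tau> \<notin> {lo_t H..T}" for \<tau>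
        using that out(1)[of "(\<tau>, s)"] qU by (fastforce simp: U_eq)
    qed (use T in auto)
    from integral_unique[OF this] have "integral It (\<lambda>\<tau>. ?h (\<tau>, s) * Dt (\<tau>, s))
      = integral {lo_t H..T} (\<lambda>\<tau>. ?h (\<tau>, s) * Dt (\<tau>, s))" .
    finally show ?thesis .
  qed
  have s_part: "integral \<Omega> (\<lambda>s. snd (?G (t, s)) $ i * Gs i (t, s)) = integral \<Omega> (\<lambda>s. ?h (t, s) * Ds
      i (t, s))"
    if t: "t \<in> {lo_t H..T}" for t i
  proof -
    have tI: "t \<in> It" using t T by auto
    define F where "F = (\<lambda>s. snd (?G (t, s)) $ i * Gs i (t, s) - ?h (t, s) * Ds i (t, s))"
    have c1': "continuous_on \<Omega> (\<lambda>s. snd (?G (t, s)) $ i * Gs i (t, s))"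
      by (intro continuous_section_\<Omega>[OF _ tI] continuous_on_mult gradient_continuous(3)[OF G]
          continuous_G)
    have c2': "continuous_on \<Omega> (\<lambda>s. ?h (t, s) * Ds i (t, s))"
      by (rule continuous_on_compose2[OF chD[OF cD(2), of UNIV]]) (auto intro!: continuous_intros)
    have cF: "continuous_on \<Omega> F" unfolding F_def by (intro continuous_on_diff c1' c2')
    have line: "integral {lo_s H $ i..hi_s H $ i} (\<lambda>\<sigma>. F (coord_upd s i \<sigma>)) = 0" for s
    proof -
      have "integral {lo_s H $ i..hi_s H $ i} (\<lambda>\<sigma>. ((0, axis i 1) \<bullet> ?G (t, coord_upd s i \<sigma>)) * Gs i
          (t, coord_upd s i \<sigma>)
          - ?h (t, coord_upd s i \<sigma>) * Ds i (t, coord_upd s i \<sigma>)) = 0"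
      proof (rule bump_by_parts_along_curve[OF r bq])
        show "((\<lambda>\<sigma>. (t, coord_upd s i \<sigma>)) has_vector_derivative (0, axis i 1)) (at \<sigma>)" for \<sigma>
          unfolding coord_upd_eq by (auto intro!: derivative_eq_intros simp: has_vector_derivative_def)
        show "((\<lambda>\<sigma>. Gs i (t, coord_upd s i \<sigma>)) has_real_derivative - Ds i (t, coord_upd s i \<sigma>)) (at \<sigma>)"
          if "(t, coord_upd s i \<sigma>) \<in> cbox q1 q2" for \<sigma>
          using G_s_derivative[OF reg R] that qU by blast
        have "coord_upd s i (lo_s H $ i) \<notin> box (lo_s H) (hi_s H)" "coord_upd s i (hi_s H $ i) \<notin> box
            (lo_s H) (hi_s H)"
          unfolding mem_box_cart by (auto intro!: exI[of _ i])
        then show "(t, coord_upd s i (lo_s H $ i)) \<notin> cbox q1 q2" "(t, coord_upd s i (hi_s H $ i)) \<notin>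
            cbox q1 q2"
          using qU by (auto simp: U_eq)
      qed (use lt_s less_imp_le in blast)
      then show ?thesis by (simp add: F_def inner_prod_def inner_axis')
    qed
    have "integral \<Omega> F = integral \<Omega> (\<lambda>s. integral {lo_s H $ i..hi_s H $ i} (\<lambda>\<sigma>. F (coord_upd s i
        \<sigma>))) / (hi_s H $ i - lo_s H $ i)"
      by (rule integral_coord_average[OF cF lt_s])
    also have "integral \<Omega> (\<lambda>s. integral {lo_s H $ i..hi_s H $ i} (\<lambda>\<sigma>. F (coord_upd s i \<sigma>))) =
        integral \<Omega> (\<lambda>s. 0)"
      by (rule integral_cong) (rule line)
    finally show ?thesis
      unfolding F_def by (simp add: integral_diff[OF integrable_continuous[OF c1']
          integrable_continuous[OF c2']])
  qed
  define A where "A = (\<lambda>p. \<mu> (fst p) * pd_x (Lag H) (lag p) * ?h p)"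
  have cA: "continuous_on P A"
    unfolding A_def by (intro continuous_on_mult continuous_\<mu>_P continuous_pd_lag continuous_on_bump)
  have cS: "continuous_on P (\<lambda>p. snd (?G p) $ i * Gs i p)" for i
    by (intro continuous_on_mult gradient_continuous(3)[OF G] continuous_G)
  have cSD: "continuous_on P (\<lambda>p. ?h p * Ds i p)" for i by (rule chD[OF cD(2)])
  have cTD: "continuous_on P (\<lambda>p. ?h p * Dt p)" by (rule chD[OF cD(1)])
  have sub: "{lo_t H..T} \<subseteq> It" using T by auto
  have "0 = integral {lo_t H..T} (\<lambda>t. integral \<Omega> (\<lambda>s. A (t, s) + (\<Sum>i\<in>UNIV. snd (?G (t, s)) $ i * Gs
      i (t, s))))
    + integral \<Omega> (\<lambda>s. integral It (\<lambda>\<tau>. fst (?G (\<tau>, s)) * Gt (\<tau>, s)))"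
    using weak_form[OF h] by (simp add: A_def)
  also have "integral \<Omega> (\<lambda>s. integral It (\<lambda>\<tau>. fst (?G (\<tau>, s)) * Gt (\<tau>, s)))
      = integral \<Omega> (\<lambda>s. integral {lo_t H..T} (\<lambda>\<tau>. ?h (\<tau>, s) * Dt (\<tau>, s)))"
    by (rule integral_cong) (rule t_part)
  also have "\<dots> = integral {lo_t H..T} (\<lambda>t. integral \<Omega> (\<lambda>s. ?h (t, s) * Dt (t, s)))"
    by (rule integral_swap_P[OF cTD sub, symmetric])
  also have "integral {lo_t H..T} (\<lambda>t. integral \<Omega> (\<lambda>s. A (t, s) + (\<Sum>i\<in>UNIV. snd (?G (t, s)) $ i * Gs
      i (t, s))))
      = integral {lo_t H..T} (\<lambda>t. integral \<Omega> (\<lambda>s. A (t, s) + (\<Sum>i\<in>UNIV. ?h (t, s) * Ds i (t, s))))"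
  proof (rule integral_cong)
    fix t assume t: "t \<in> {lo_t H..T}"
    then have tI: "t \<in> It" using sub by blast
    show "integral \<Omega> (\<lambda>s. A (t, s) + (\<Sum>i\<in>UNIV. snd (?G (t, s)) $ i * Gs i (t, s)))
        = integral \<Omega> (\<lambda>s. A (t, s) + (\<Sum>i\<in>UNIV. ?h (t, s) * Ds i (t, s)))"
      by (simp add: integral_add[OF integrable_section[OF cA tI] integrable_sum[OF finite
          integrable_section[OF cS tI]]]
          integral_sum[OF finite integrable_section[OF cS tI]]
          integral_add[OF integrable_section[OF cA tI] integrable_sum[OF finite
              integrable_section[OF cSD tI]]]
          integral_sum[OF finite integrable_section[OF cSD tI]] s_part[OF t])
  qed
  also have "integral {lo_t H..T} (\<lambda>t. integral \<Omega> (\<lambda>s. A (t, s) + (\<Sum>i\<in>UNIV. ?h (t, s) * Ds i (t, s))))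
      + integral {lo_t H..T} (\<lambda>t. integral \<Omega> (\<lambda>s. ?h (t, s) * Dt (t, s)))
      = integral {lo_t H..T} (\<lambda>t. integral \<Omega> (\<lambda>s. A (t, s) + (\<Sum>i\<in>UNIV. ?h (t, s) * Ds i (t, s)))
          + integral \<Omega> (\<lambda>s. ?h (t, s) * Dt (t, s)))"
    by (intro integral_add[symmetric] integrable_continuous_real continuous_on_subset[OF _ sub]
          continuous_integral_\<Omega>[OF cTD] continuous_integral_\<Omega>[OF continuous_on_add[OF cA
              continuous_on_sum[OF cSD]]])
  also have "\<dots> = integral {lo_t H..T} (\<lambda>t. integral \<Omega> (\<lambda>s. ?h (t, s) *
      (pd_x (Lag H) (lag (t, s)) * \<mu> t + Dt (t, s) + (\<Sum>i\<in>UNIV. Ds i (t, s)))))"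
  proof (rule integral_cong)
    fix t assume "t \<in> {lo_t H..T}"
    then have tI: "t \<in> It" using sub by blast
    have "integral \<Omega> (\<lambda>s. A (t, s) + (\<Sum>i\<in>UNIV. ?h (t, s) * Ds i (t, s))) + integral \<Omega> (\<lambda>s. ?h (t, s)
        * Dt (t, s))
        = integral \<Omega> (\<lambda>s. A (t, s) + (\<Sum>i\<in>UNIV. ?h (t, s) * Ds i (t, s)) + ?h (t, s) * Dt (t, s))"
      by (rule integral_add[OF integrable_add[OF integrable_section[OF cA tI] integrable_sum[OF
          finite integrable_section[OF cSD tI]]]
            integrable_section[OF cTD tI], symmetric])
    also have "\<dots> = integral \<Omega> (\<lambda>s. ?h (t, s) *
      (pd_x (Lag H) (lag (t, s)) * \<mu> t + Dt (t, s) + (\<Sum>i\<in>UNIV. Ds i (t, s))))"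
      by (simp add: A_def sum_distrib_left distrib_left mult_ac add_ac)
    finally show "integral \<Omega> (\<lambda>s. A (t, s) + (\<Sum>i\<in>UNIV. ?h (t, s) * Ds i (t, s))) + integral \<Omega> (\<lambda>s.
        ?h (t, s) * Dt (t, s))
        = integral \<Omega> (\<lambda>s. ?h (t, s) *
      (pd_x (Lag H) (lag (t, s)) * \<mu> t + Dt (t, s) + (\<Sum>i\<in>UNIV. Ds i (t, s))))" .
  qed
  also have "\<dots> = integral PT (\<lambda>p. ?h p * (pd_x (Lag H) (lag p) * \<mu> (fst p) + Dt p + (\<Sum>i\<in>UNIV. Ds i p)))"
    by (subst integral_prod_continuous)
       (auto intro!: chD continuous_on_add continuous_on_sum cD cE)
  finally show "integral PT (\<lambda>p. ?h p * (pd_x (Lag H) (lag p) * \<mu> (fst p) + Dt p + (\<Sum>i\<in>UNIV. Ds i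
      p))) = 0"
    by simp
qed

end

section \<open>Du Bois-Reymond argument after \<open>T\<close> and conclusion\<close>

context herglotz_extremal
begin

text \<open>A test function \<phi>(t) \<psi>(s) with \<phi> = 0 up to \<open>T\<close> kills the
  first integral of the weak form. Let \<open>g\<close> be the average of \<open>Gt\<close> against
  the bump \<psi>. Choosing \<open>\<omega> * (g - \<kappa>)\<close> as derivative of \<phi> makes
  the integral of \<open>\<omega> * (g - \<kappa>)^2\<close> vanish, so \<open>g\<close> is found
  constant without ever being differentiated.\<close>

lemma G_t_average_constant:
  assumes lt: "T < hi_t H" and r: "0 < r" and sub: "ball s0 r \<subseteq> box (lo_s H) (hi_s H)"
    and \<tau>: "T < \<tau>" "\<tau> \<le> hi_t H"
  shows "integral \<Omega> (\<lambda>s. bump s0 r s * Gt (\<tau>, s)) = integral \<Omega> (\<lambda>s. bump s0 r s * Gt (hi_t H, s))"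
proof -
  let ?\<psi> = "bump s0 r"
  have c\<psi>: "continuous_on P (\<lambda>p. ?\<psi> (snd p))" "continuous_on P (\<lambda>p. bump_grad s0 r (snd p))"
    by (auto intro!: continuous_on_compose2[OF continuous_on_bump(1)] continuous_on_compose2[OF
        continuous_on_bump(2)] continuous_intros)
  have c\<psi>G: "continuous_on P (\<lambda>p. ?\<psi> (snd p) * Gt p)"
    by (intro continuous_on_mult c\<psi> continuous_G)
  define g where "g = (\<lambda>\<tau>. integral \<Omega> (\<lambda>s. ?\<psi> s * Gt (\<tau>, s)))"
  have cg: "continuous_on It g"
    unfolding g_def using continuous_integral_\<Omega>[OF c\<psi>G] by simp
  \<comment> \<open>Positive exactly after \<open>T\<close>, and continuous, so that \<phi> is C^1
    across \<open>T\<close>.\<close>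
  define \<omega> where "\<omega> = (\<lambda>\<tau>. max 0 (\<tau> - T))"
  have c\<omega>: "continuous_on S \<omega>" for S unfolding \<omega>_def by (intro continuous_intros)
  have ne: "box (lo_t H) (hi_t H) \<noteq> {}" using lt_t by simp
  have W: "integral It \<omega> \<noteq> 0"
  proof
    assume "integral It \<omega> = 0"
    then have "(\<omega> has_integral 0) (cbox (lo_t H) (hi_t H))"
      using integrable_integral[OF integrable_continuous_real[OF c\<omega>]] by (metis box_real(2))
    from has_integral_0_cbox_imp_0[OF c\<omega> _ this ne, of "hi_t H"] lt lt_t show False
      by (auto simp: \<omega>_def)
  qed
  \<comment> \<open>The mean of \<open>g\<close> with weight \<omega>; it makes \<phi> vanish at
    \<open>hi_t H\<close> as well, as the boundary condition on test functions requires.\<close>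
  define \<kappa> where "\<kappa> = integral It (\<lambda>\<tau>. \<omega> \<tau> * g \<tau>) / integral It \<omega>"
  define \<phi>' where "\<phi>' = (\<lambda>\<tau>. \<omega> \<tau> * (g \<tau> - \<kappa>))"
  define \<phi> where "\<phi> = (\<lambda>\<tau>. integral {lo_t H..\<tau>} \<phi>')"
  have c\<phi>': "continuous_on It \<phi>'"
    unfolding \<phi>'_def by (intro continuous_on_mult c\<omega> continuous_on_diff cg continuous_on_const)
  have d\<phi>: "(\<phi> has_real_derivative \<phi>' \<tau>) (at \<tau> within It)" if "\<tau> \<in> It" for \<tau>
    unfolding \<phi>_def by (rule integral_has_real_derivative[OF c\<phi>' that])
  have c\<phi>: "continuous_on It \<phi>" using d\<phi> by (rule DERIV_continuous_on)
  have \<phi>0: "\<phi> \<tau> = 0" if "\<tau> \<le> T" for \<tau>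
  proof -
    have "\<phi> \<tau> = integral {lo_t H..\<tau>} (\<lambda>_. 0)"
      unfolding \<phi>_def by (rule integral_cong) (use that in \<open>auto simp: \<phi>'_def \<omega>_def\<close>)
    then show ?thesis by simp
  qed
  have i\<omega>: "\<omega> integrable_on It" and i\<omega>g: "(\<lambda>\<tau>. \<omega> \<tau> * g \<tau>) integrable_on It"
    by (intro integrable_continuous_real continuous_on_mult c\<omega> cg)+
  have \<phi>hi: "integral It \<phi>' = 0"
  proof -
    have "integral It \<phi>' = integral It (\<lambda>\<tau>. \<omega> \<tau> * g \<tau> - \<omega> \<tau> * \<kappa>)"
      by (simp add: \<phi>'_def right_diff_distrib)
    also have "\<dots> = integral It (\<lambda>\<tau>. \<omega> \<tau> * g \<tau>) - integral It \<omega> * \<kappa>"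
      using integral_diff[OF i\<omega>g integrable_on_mult_left[OF i\<omega>, of \<kappa>]] by simp
    finally show ?thesis using W by (simp add: \<kappa>_def)
  qed
  define h where "h = (\<lambda>p. \<phi> (fst p) * ?\<psi> (snd p))"
  define G where "G = (\<lambda>p. (\<phi>' (fst p) * ?\<psi> (snd p), \<phi> (fst p) *\<^sub>R bump_grad s0 r (snd p)))"
  have out: "?\<psi> s = 0" if "s \<notin> box (lo_s H) (hi_s H)" for s
    using that sub r by (intro bump_outside) auto
  have "test_function h G"
    unfolding test_function_def gradient_def
  proof (intro conjI ballI)
    have "continuous_on P (\<lambda>p. \<phi> (fst p))" "continuous_on P (\<lambda>p. \<phi>' (fst p))"
      by (auto intro!: continuous_on_compose2[OF c\<phi>] continuous_on_compose2[OF c\<phi>']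
          continuous_intros simp: P_eq(1))
    then show "continuous_on P G"
      unfolding G_def by (intro continuous_intros c\<psi>)
    fix p assume p: "p \<in> P"
    have 1: "((\<lambda>p. \<phi> (fst p)) has_derivative (\<lambda>v. \<phi>' (fst p) * fst v)) (at p within P)"
      by (rule has_derivative_in_compose2[of It \<phi> "\<lambda>\<tau> y. \<phi>' \<tau> * y" fst])
         (use d\<phi> p in \<open>auto simp: has_field_derivative_def P_eq(1) intro!: derivative_eq_intros\<close>)
    have 2: "((\<lambda>p. ?\<psi> (snd p)) has_derivative (\<lambda>v. snd v \<bullet> bump_grad s0 r (snd p))) (at p within P)"
      by (rule has_derivative_in_compose2[of UNIV ?\<psi> "\<lambda>s v. v \<bullet> bump_grad s0 r s" snd])
         (use p in \<open>auto intro!: derivative_eq_intros bump_has_derivative\<close>)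
    show "(h has_derivative (\<lambda>v. v \<bullet> G p)) (at p within P)"
      unfolding h_def using has_derivative_mult[OF 1 2]
      by (rule has_derivative_eq_rhs) (simp add: fun_eq_iff G_def inner_prod_def algebra_simps)
  next
    fix p assume p: "p \<in> frontier P"
    then have "p \<in> P" "p \<notin> box (lo_t H, lo_s H) (hi_t H, hi_s H)"
      unfolding P_eq(2) frontier_def by auto
    then have "fst p = lo_t H \<or> fst p = hi_t H \<or> snd p \<notin> box (lo_s H) (hi_s H)"
      by (cases p) (auto simp: box_Pair_eq P_eq(1))
    moreover have "\<phi> (hi_t H) = 0" using \<phi>hi by (simp add: \<phi>_def)
    ultimately show "h p = 0" using \<phi>0[of "lo_t H"] T out by (auto simp: h_def)
  qed
  from weak_form[OF this]
  have "integral {lo_t H..T} (\<lambda>t. integral \<Omega> (\<lambda>s. \<mu> t * pd_x (Lag H) (lag (t, s)) * h (t, s)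
      + (\<Sum>i\<in>UNIV. snd (G (t, s)) $ i * Gs i (t, s))))
    + integral \<Omega> (\<lambda>s. integral It (\<lambda>\<tau>. fst (G (\<tau>, s)) * Gt (\<tau>, s))) = 0" .
  moreover have "integral {lo_t H..T} (\<lambda>t. integral \<Omega> (\<lambda>s. \<mu> t * pd_x (Lag H) (lag (t, s)) * h (t, s)
      + (\<Sum>i\<in>UNIV. snd (G (t, s)) $ i * Gs i (t, s)))) = integral {lo_t H..T} (\<lambda>t. 0)"
    by (rule integral_cong) (use \<phi>0 in \<open>simp add: h_def G_def\<close>)
  ultimately have "integral \<Omega> (\<lambda>s. integral It (\<lambda>\<tau>. \<phi>' \<tau> * (?\<psi> s * Gt (\<tau>, s)))) = 0"
    by (simp add: G_def mult_ac)
  moreover have "continuous_on P (\<lambda>p. \<phi>' (fst p) * (?\<psi> (snd p) * Gt p))"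
    by (intro continuous_on_mult[OF _ c\<psi>G] continuous_on_compose2[OF c\<phi>'])
       (auto intro!: continuous_intros simp: P_eq(1))
  note integral_swap_P[OF this, of "lo_t H" "hi_t H", simplified]
  ultimately have \<phi>g: "integral It (\<lambda>\<tau>. \<phi>' \<tau> * g \<tau>) = 0"
    by (simp add: g_def)
  \<comment> \<open>One factor \<open>g \<tau> - \<kappa>\<close> is part of
    \<open>\<phi>' \<tau>\<close>; the constant in the other contributes nothing, since
    \<open>\<phi>'\<close> has integral 0.\<close>
  have "integral It (\<lambda>\<tau>. \<omega> \<tau> * (g \<tau> - \<kappa>)\<^sup>2) = integral It (\<lambda>\<tau>. \<phi>' \<tau> * g \<tau> - \<phi>' \<tau> * \<kappa>)"
    by (simp add: \<phi>'_def power2_eq_square algebra_simps)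
  also have "\<dots> = integral It (\<lambda>\<tau>. \<phi>' \<tau> * g \<tau>) - integral It (\<lambda>\<tau>. \<phi>' \<tau> * \<kappa>)"
    by (intro integral_diff integrable_continuous_real continuous_on_mult c\<phi>' cg continuous_on_const)
  also have "\<dots> = 0" using \<phi>g \<phi>hi by simp
  finally have z: "integral It (\<lambda>\<tau>. \<omega> \<tau> * (g \<tau> - \<kappa>)\<^sup>2) = 0" .
  have cz: "continuous_on It (\<lambda>\<tau>. \<omega> \<tau> * (g \<tau> - \<kappa>)\<^sup>2)"
    by (intro continuous_on_mult c\<omega> continuous_on_power continuous_on_diff cg continuous_on_const)
  have hi0: "((\<lambda>\<tau>. \<omega> \<tau> * (g \<tau> - \<kappa>)\<^sup>2) has_integral 0) (cbox (lo_t H) (hi_t H))"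
    using integrable_integral[OF integrable_continuous_real[OF cz]] unfolding z by simp
  have \<omega>g: "\<omega> \<tau> * (g \<tau> - \<kappa>)\<^sup>2 = 0" if "\<tau> \<in> It" for \<tau>
    using has_integral_0_cbox_imp_0[OF _ _ hi0 ne, of \<tau>] cz that by (simp add: \<omega>_def)
  have g\<kappa>: "g \<tau> = \<kappa>" if "T < \<tau>" "\<tau> \<le> hi_t H" for \<tau>
    using \<omega>g[of \<tau>] that T by (simp add: \<omega>_def)
  have "g \<tau> = g (hi_t H)" using g\<kappa>[OF \<tau>] g\<kappa>[OF lt order_refl] by simp
  then show ?thesis by (simp add: g_def)
qed

text \<open>The averages against all bumps in \<open>s\<close> determine the continuous function
  \<open>Gt (\<tau>, s) - Gt (hi_t H, s)\<close> on the open box; the faces of \<Omega> and the time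
  \<open>T\<close> itself follow by continuity.\<close>

lemma G_t_constant:
  assumes lt: "T < hi_t H" and s: "s \<in> \<Omega>" and \<tau>: "\<tau> \<in> {T..hi_t H}"
  shows "Gt (\<tau>, s) = Gt (hi_t H, s)"
proof -
  have hi: "hi_t H \<in> It" using lt_t by simp
  have bne: "box (lo_s H) (hi_s H) \<noteq> {}" using lt_s by (simp add: interval_ne_empty_cart)
  have open_case: "Gt (\<tau>, s) - Gt (hi_t H, s) = 0" if \<tau>: "\<tau> \<in> {T<..hi_t H}" and s: "s \<in> \<Omega>" for \<tau> s
  proof -
    have \<tau>I: "\<tau> \<in> It" using \<tau> T by auto
    have c: "continuous_on \<Omega> (\<lambda>s. Gt (\<tau>, s) - Gt (hi_t H, s))"
      by (intro continuous_on_diff continuous_section_\<Omega> continuous_G \<tau>I hi)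
    have inner: "Gt (\<tau>, s) - Gt (hi_t H, s) = 0" if "s \<in> box (lo_s H) (hi_s H)" for s
    proof (rule fundamental_lemma_bump[OF continuous_on_subset[OF c box_subset_cbox] that])
      fix s0 r c d assume r: "0 < r" and b: "ball s0 r \<subseteq> cbox c d" "cbox c d \<subseteq> box (lo_s H) (hi_s H)"
      have i: "(\<lambda>s. bump s0 r s * Gt (\<tau>, s)) integrable_on \<Omega>" if "\<tau> \<in> It" for \<tau>
        by (intro integrable_continuous continuous_on_mult continuous_on_bump continuous_section_\<Omega>
            continuous_G that)
      show "integral \<Omega> (\<lambda>s. bump s0 r s * (Gt (\<tau>, s) - Gt (hi_t H, s))) = 0"
        using G_t_average_constant[OF lt r order_trans[OF b], of \<tau>] \<tau>
        by (simp add: right_diff_distrib integral_diff[OF i[OF \<tau>I] i[OF hi]])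
    qed
    show ?thesis
      using continuous_constant_on_closure[of "box (lo_s H) (hi_s H)", OF _ inner] c s bne
      by (simp add: closure_box)
  qed
  have "continuous_on {T..hi_t H} (\<lambda>\<tau>. Gt (\<tau>, s) - Gt (hi_t H, s))"
    using T by (intro continuous_on_diff continuous_on_const continuous_on_subset[OF
        continuous_slice_t[OF continuous_G(1) s]]) auto
  then have "Gt (\<tau>, s) - Gt (hi_t H, s) = 0"
    using continuous_constant_on_closure[of "{T<..hi_t H}" "\<lambda>\<tau>. Gt (\<tau>, s) - Gt (hi_t H, s)", OF _
        open_case[OF _ s], of \<tau>]
      lt \<tau> by simp
  then show ?thesis by simp
qed

text \<open>From \<open>T\<close> on the right integral based at \<open>T\<close> is 0, so constancy
  of \<open>Gt\<close> says that the left integrals from \<open>lo_t H\<close> and from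
  \<open>T\<close> differ by a constant; hence their derivatives agree.\<close>

theorem Euler_Lagrange_after:
  assumes lt: "T < hi_t H" and s: "s \<in> \<Omega>" and t: "t \<in> {T..hi_t H}"
    and diff: "snd (weight_t H) \<noteq> 0 \<longrightarrow>
      frac_left (lo_t H) (ord_r_t H) (slice_t Fv s) differentiable (at t within It) \<and>
      frac_left T (ord_r_t H) (slice_t Fv s) differentiable (at t within {T..hi_t H})"
  shows "snd (weight_t H) * (RL_left (lo_t H) (hi_t H) (ord_r_t H) (slice_t Fv s) t
    - RL_left T (hi_t H) (ord_r_t H) (slice_t Fv s) t) = 0"
proof (cases "snd (weight_t H) = 0")
  case False
  let ?f1 = "frac_left (lo_t H) (ord_r_t H) (slice_t Fv s)"
  let ?f2 = "frac_left T (ord_r_t H) (slice_t Fv s)"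
  have "(?f1 has_vector_derivative RL_left (lo_t H) (hi_t H) (ord_r_t H) (slice_t Fv s) t) (at t
      within It)"
    using diff False unfolding RL_left_def vector_derivative_works by blast
  \<comment> \<open>The first derivative is taken within the full time interval; at
    \<open>t = T\<close> it has to be restricted to the right-hand side before it can be compared
    with the second.\<close>
  then have 1: "(?f1 has_vector_derivative RL_left (lo_t H) (hi_t H) (ord_r_t H) (slice_t Fv s) t)
      (at t within {T..hi_t H})"
    by (rule has_vector_derivative_within_subset) (use T in auto)
  have 2: "(?f2 has_vector_derivative RL_left T (hi_t H) (ord_r_t H) (slice_t Fv s) t) (at t within
      {T..hi_t H})"
    using diff False unfolding RL_left_def vector_derivative_works by blast
  have "?f1 \<tau> - ?f2 \<tau> = - Gt (hi_t H, s) / snd (weight_t H)" if "\<tau> \<in> {T..hi_t H}" for \<tau>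
    using G_t_constant[OF lt s that] that False
    by (simp add: Gt_def dual_int_def frac_right_after[of T \<tau>] field_simps)
  then have "((\<lambda>\<tau>. ?f1 \<tau> - ?f2 \<tau>) has_vector_derivative 0) (at t within {T..hi_t H})"
    by (intro has_vector_derivative_transform[OF t _ has_vector_derivative_const[of "- Gt (hi_t H,
        s) / snd (weight_t H)"]]) auto
  with has_vector_derivative_diff[OF 1 2]
  have "RL_left (lo_t H) (hi_t H) (ord_r_t H) (slice_t Fv s) t - RL_left T (hi_t H) (ord_r_t H)
      (slice_t Fv s) t = 0"
    using t lt by (intro vector_derivative_unique_within_closed_interval[of T "hi_t H" t]) auto
  then show ?thesis by simp
qed simp

text \<open>\<open>R\<close> lies between an open box and its closure, and the left side of the
  equation is continuous on \<open>R\<close>, so its vanishing on the open box carries over to the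
  points of \<open>R\<close> on the faces.\<close>

theorem Euler_Lagrange:
  assumes R: "{lo_t H<..<T} \<times> box (lo_s H) (hi_s H) \<subseteq> R" "R \<subseteq> {lo_t H..T} \<times> \<Omega>"
    and reg: "dual_regular H x z T R" and p: "p \<in> R"
  shows "pd_x (Lag H) (lag p) * \<mu> (fst p) + Dt p + (\<Sum>i\<in>UNIV. Ds i p) = 0"
proof -
  define E where "E = (\<lambda>p. pd_x (Lag H) (lag p) * \<mu> (fst p) + Dt p + (\<Sum>i\<in>UNIV. Ds i p))"
  have UR: "U \<subseteq> R" using R(1) by (simp add: U_eq)
  have RP: "R \<subseteq> P" using R(2) T by (auto simp: P_eq(1))
  have U0: "E q = 0" if "q \<in> U" for q
    unfolding E_def by (rule Euler_Lagrange_open[OF reg UR that])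
  have cE: "continuous_on R E"
    using reg continuous_on_subset[OF continuous_on_mult[OF continuous_pd_lag(1) continuous_\<mu>_P] RP]
    unfolding E_def dual_regular_def by (intro continuous_on_add continuous_on_sum) auto
  have "box (lo_s H) (hi_s H) \<noteq> {}" using lt_s by (simp add: interval_ne_empty_cart)
  then have "U \<noteq> {}" using T by (simp add: U_eq)
  then have "closure U = PT" by (simp add: closure_box)
  then have cl: "p \<in> closure U" using R(2) p by (auto simp: cbox_Pair_eq)
  have "E p = 0"
  proof (cases "p \<in> U")
    case False
    then have "p islimpt U" using cl by (simp add: closure_def)
    then have nt: "at p within U \<noteq> bot" by (simp add: trivial_limit_within)
    have "(E \<longlongrightarrow> E p) (at p within U)"
      using cE p UR by (meson continuous_on_def tendsto_within_subset)
    moreover have "(E \<longlongrightarrow> 0) (at p within U)"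
      by (rule tendsto_eventually) (simp add: eventually_at_filter U0)
    ultimately show ?thesis using tendsto_unique[OF nt] by blast
  qed (rule U0)
  then show ?thesis by (simp add: E_def)
qed

section \<open>Conditions at the terminal time\<close>

theorem transversality:
  assumes s: "s \<in> \<Omega>"
  shows "transversality_term H x z T s T = 0"
    and "(transversality_term H x z T s \<longlongrightarrow> 0) (at T within It)"
proof -
  show 0: "transversality_term H x z T s T = 0"
    by (simp add: transversality_term_def frac_left_before frac_right_after)
  have c: "continuous_on It (slice_t Fv s)"
    using continuous_slice_t[OF continuous_weighted(1) s] by (simp add: slice_t_def)
  have "continuous_on It (transversality_term H x z T s)"
    unfolding transversality_term_def[abs_def]
    by (intro continuous_on_diff continuous_on_mult continuous_on_const
        continuous_on_frac_right_1[OF ord_t(1) T_mem c] continuous_on_frac_left_1[OF ord_t(2) T_mem c])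
  then show "(transversality_term H x z T s \<longlongrightarrow> 0) (at T within It)"
    using T_mem 0 by (metis continuous_on_def)
qed

text \<open>The same pair \<open>(x, z)\<close> competes with every terminal time near
  \<open>T\<close>, so \<open>\<sigma> * z\<close> has a local minimum at the interior point
  \<open>T\<close>; its derivative there is \<open>\<sigma>\<close> times the integral.\<close>

theorem terminal_condition:
  assumes lt: "T < hi_t H"
  shows "integral \<Omega> (\<lambda>s. Lag H (lag (T, s))) = 0"
proof -
  have d: "(z has_real_derivative integral \<Omega> (\<lambda>s. Lag H (lag (T, s)))) (at T)"
    using z_derivative[OF T_mem] T(1) lt by (simp add: at_within_Icc_at)
  have close: "C1_close H \<epsilon> x x" if "\<epsilon> > 0" for \<epsilon>
  proof -
    have "gradient (\<lambda>p. 0) (\<lambda>p. 0)" by (simp add: gradient_def)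
    then show ?thesis
      using that by (simp add: C1_close_def frechet_derivative_P onorm_zero)
  qed
  obtain \<epsilon> \<sigma> :: real where \<epsilon>: "\<epsilon> > 0" and \<sigma>: "\<sigma> \<noteq> 0"
    and ex: "\<And>y w \<tau>. admissible H y w \<Longrightarrow> \<tau> \<in> {lo_t H<..hi_t H} \<Longrightarrow> C1_close H \<epsilon> x y \<Longrightarrow> \<bar>\<tau> - T\<bar> < \<epsilon>
      \<Longrightarrow> \<sigma> * z T \<le> \<sigma> * w \<tau>"
    by (rule extremizer_signed) (rule that)
  \<comment> \<open>Keeps \<tau> inside the time interval and in the range of local
    extremality.\<close>
  define d0 where "d0 = min \<epsilon> (min (T - lo_t H) (hi_t H - T))"
  have d0: "d0 > 0" using \<epsilon> T(1) lt by (simp add: d0_def)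
  have "\<sigma> * z T \<le> \<sigma> * z \<tau>" if "\<bar>T - \<tau>\<bar> < d0" for \<tau>
    using that by (intro ex[OF adm _ close[OF \<epsilon>]]) (auto simp: d0_def)
  then have "\<sigma> * integral \<Omega> (\<lambda>s. Lag H (lag (T, s))) = 0"
    by (intro DERIV_local_min[OF DERIV_cmult[OF d] d0]) blast
  then show ?thesis using \<sigma> by simp
qed

end

theorem theorem59:
  fixes H :: "('n::finite) herglotz"
    and x :: "real \<times> (real^'n) \<Rightarrow> real" and z :: "real \<Rightarrow> real" and T :: real
  assumes "lo_t H < hi_t H" and "\<And>i. lo_s H $ i < hi_s H $ i"
    and "admissible_order (lo_t H) (hi_t H) (ord_l_t H)"
    and "admissible_order (lo_t H) (hi_t H) (ord_r_t H)"
    and "\<And>i. admissible_order (lo_s H $ i) (hi_s H $ i) (ord_l_s H i)"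
    and "\<And>i. admissible_order (lo_s H $ i) (hi_s H $ i) (ord_r_s H i)"
    and "admissible_weight (weight_t H)" and "\<And>i. admissible_weight (weight_s H i)"
    and "C1_on (dom_L H) (Lag H)"
    and "extremizer H x z T"
  shows "(\<forall>R. {lo_t H<..<T} \<times> box (lo_s H) (hi_s H) \<subseteq> R \<longrightarrow>
            R \<subseteq> {lo_t H..T} \<times> cbox (lo_s H) (hi_s H) \<longrightarrow>
            dual_regular H x z T R \<longrightarrow>
            (\<forall>(t, s)\<in>R.
               pd_x (Lag H) (lag_at H x z (t, s)) * multiplier H x z t
               + dual_t H T (weighted_pd_v H x z) (t, s)
               + (\<Sum>i\<in>UNIV. dual_s H i (weighted_pd_w H x z i) (t, s)) = 0))
       \<and> (\<forall>t\<in>{T..hi_t H}. \<forall>s\<in>cbox (lo_s H) (hi_s H). T < hi_t H \<longrightarrow>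
            (snd (weight_t H) \<noteq> 0 \<longrightarrow>
               frac_left (lo_t H) (ord_r_t H) (slice_t (weighted_pd_v H x z) s)
                 differentiable (at t within {lo_t H..hi_t H}) \<and>
               frac_left T (ord_r_t H) (slice_t (weighted_pd_v H x z) s)
                 differentiable (at t within {T..hi_t H})) \<longrightarrow>
            snd (weight_t H) *
              (RL_left (lo_t H) (hi_t H) (ord_r_t H) (slice_t (weighted_pd_v H x z) s) t
               - RL_left T (hi_t H) (ord_r_t H) (slice_t (weighted_pd_v H x z) s) t) = 0)
       \<and> (\<forall>s\<in>cbox (lo_s H) (hi_s H).
            transversality_term H x z T s T = 0 \<and>
            (transversality_term H x z T s \<longlongrightarrow> 0) (at T within {lo_t H..hi_t H}))
       \<and> (T < hi_t H \<longrightarrow>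
            integral (cbox (lo_s H) (hi_s H)) (\<lambda>s. Lag H (lag_at H x z (T, s))) = 0)"
proof -
  interpret herglotz_extremal H x z T
    using assms by unfold_locales
  show ?thesis
  proof (intro conjI allI impI ballI)
    fix R p
    assume "{lo_t H<..<T} \<times> box (lo_s H) (hi_s H) \<subseteq> R" "R \<subseteq> {lo_t H..T} \<times> cbox (lo_s H) (hi_s H)"
      "dual_regular H x z T R" "p \<in> R"
    then show "case p of (t, s) \<Rightarrow> pd_x (Lag H) (lag_at H x z (t, s)) * multiplier H x z t
        + dual_t H T (weighted_pd_v H x z) (t, s)
        + (\<Sum>i\<in>UNIV. dual_s H i (weighted_pd_w H x z i) (t, s)) = 0"
      using Euler_Lagrange[of R p] by (cases p) simp
  qed (use Euler_Lagrange_after transversality terminal_condition in blast)+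
qed

end
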